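(* Let $M=G/H$ be a naturally reductive homogeneous space of dimension $n$ with a homogeneous spin structure, where $n=3$ or $n\geq5$. Then for every spinor field $\psi$, $$(D^{1/3})^2\psi=\Omega_{\mathfrak g}(\psi)+\frac18\Big[\sum_{i,j}Q_{\mathfrak h}([Z_i,Z_j],[Z_i,Z_j])+\frac13\sum_{i,j}Q_{\mathfrak m}([Z_i,Z_j],[Z_i,Z_j])\Big]\psi$$ $$=\Omega_{\mathfrak g}(\psi)+\frac18\Big[\mathrm{Scal}^{1/3}+\frac19\sum_{i,j}Q_{\mathfrak m}([Z_i,Z_j],[Z_i,Z_j])\Big]\psi ,$$ where $\mathrm{Scal}^{1/3}$ is the scalar curvature of the connection $\nabla^{1/3}$.
   Context: Setting. $M=G/H$ is a Riemannian homogeneous space of dimension $n$, reductive: $\mathfrak g=\mathfrak h\oplus\mathfrak m$ with $\mathrm{Ad}(H)\mathfrak m\subset\mathfrak m$; $\mathfrak m$ is identified with the tangent space at the base point and $\langle\,,\rangle$ is the inner product on $\mathfrak m$ induced by the metric. Subscripts $\mathfrak m,\mathfrak h$ denote components in $\mathfrak g=\mathfrak h\oplus\mathfrak m$. The metric is naturally reductive: $\langle[X,Y]_{\mathfrak m},Z\rangle+\langle Y,[X,Z]_{\mathfrak m}\rangle=0$ for all $X,Y,Z\in\mathfrak m$. It is assumed that $\mathfrak g=\mathfrak m+[\mathfrak m,\mathfrak m]$, and $Q$ denotes the $\mathrm{Ad}(G)$-invariant, symmetric, non-degenerate bilinear form on $\mathfrak g$ (not necessarily positive definite) with $Q(\mathfrak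 h,\mathfrak m)=0$ and $Q|_{\mathfrak m}=\langle\,,\rangle$. For $A,B\in\mathfrak g$ write $Q_{\mathfrak h}(A,B)=Q(A_{\mathfrak h},B_{\mathfrak h})$ and $Q_{\mathfrak m}(A,B)=\langle A_{\mathfrak m},B_{\mathfrak m}\rangle$. $Z_1,\dots,Z_n$ is an orthonormal basis of $\mathfrak m$; all sums run over $1,\dots,n$. Spinors. The Clifford algebra $\mathcal C(\mathfrak m)$ has relations $Z_i\cdot Z_j+Z_j\cdot Z_i=-2\delta_{ij}$. A homogeneous spin structure is a lift $\widetilde{\mathrm{Ad}}:H\to\mathrm{Spin}(\mathfrak m)$ of the isotropy representation $\mathrm{Ad}:H\to\mathrm{SO}(\mathfrak m)$; $\widetilde{\mathrm{ad}}:\mathfrak h\to\mathfrak{spin}(\mathfrak m)\subset\mathcal C(\mathfrak m)$ is its differential, given by $\widetilde{\mathrm{ad}}(Y)=\frac14\sum_{i,j}\langle[Y,Z_i],Z_j\rangle Z_i\cdot Z_j$; $\kappa:\mathrm{Spin}(\mathfrak m)\to\mathrm{GL}(\Delta_{\mathfrak m})$ is the spin representation. Spinor fields are smooth maps $\psi:G\to\Delta_{\mathfrak m}$ with $\psi(gh)=\kappa(\widetilde{\mathrm{Ad}}(h^{-1}))\psi(g)$ for $g\in G$, $h\in H$. $X(\psi)$ is the derivative of $\psi$ along the left invariant vector field induced by $X\in\mathfrak g$. Connections and operators. $\nabla^t$ is the $G$-invariant metric connection $\nabla^t_XY=\nabla^0_XY+t[X,Y]_{\mathfrak m}$, where $\nabla^0$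 is the canonical connection; its Ricci tensor is $\mathrm{Ric}^t(X,Y)=\sum_i\langle R^t(X,Z_i)Z_i,Y\rangle$ and its scalar curvature is the trace of $\mathrm{Ric}^t$. With $H:=\frac14\sum_{i,j,k}\langle[Z_i,Z_j]_{\mathfrak m},Z_k\rangle Z_i\cdot Z_j\cdot Z_k\in\mathcal C(\mathfrak m)$, the Dirac operator of $\nabla^t$ is $D^t\psi=\sum_i Z_i\cdot Z_i(\psi)+t\,H\cdot\psi$. The lifted Casimir element of $\mathfrak h$ is $\widetilde C_{\mathfrak h}=-\sum_i\widetilde{\mathrm{ad}}(X_i)\cdot\widetilde{\mathrm{ad}}(Y_i)\in\mathcal C(\mathfrak m)$, where $X_i,Y_i$ are bases of $\mathfrak h$ with $Q(X_i,Y_j)=\delta_{ij}$, and $\Omega_{\mathfrak g}(\psi)=-\sum_iZ_i^2(\psi)+\widetilde C_{\mathfrak h}\cdot\psi$. *)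

theory Defs
  imports "HOL-Analysis.Analysis" "HOL-Algebra.Group"
begin

section \<open>Smooth maps between open subsets of Euclidean spaces\<close>

primrec Ck_on :: "nat \<Rightarrow> ('a::real_normed_vector \<Rightarrow> 'b::real_normed_vector) \<Rightarrow> 'a set \<Rightarrow> bool" where
  "Ck_on 0 f S \<longleftrightarrow> continuous_on S f"
| "Ck_on (Suc k) f S \<longleftrightarrow> (\<forall>x\<in>S. f differentiable (at x)) \<and>
     (\<forall>v. Ck_on k (\<lambda>x. frechet_derivative f (at x) v) S)"

text \<open>Only meant for open sets.\<close>

definition smooth_on :: "('a::real_normed_vector \<Rightarrow> 'b::real_normed_vector) \<Rightarrow> 'a set \<Rightarrow> bool" where
  "smooth_on f S \<longleftrightarrow> (\<forall>k. Ck_on k f S)"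


section \<open>Lie groups\<close>

text \<open>The underlying set of the group is the whole type \<open>'g\<close>, whose topology is the manifold
  topology. A chart is a pair (domain, coordinate map); the model space is \<open>'e\<close>. The atlas need
  not be maximal.\<close>

record ('g, 'e) lie_group = "'g monoid" +
  atlas :: "('g set \<times> ('g \<Rightarrow> 'e)) set"

definition smooth_atlas ::
    "('g::{t2_space,second_countable_topology} set \<times> ('g \<Rightarrow> 'e::euclidean_space)) set \<Rightarrow> bool" where
  "smooth_atlas A \<longleftrightarrow>
     (\<Union>(U, \<phi>)\<in>A. U) = UNIV \<and>
     (\<forall>(U, \<phi>)\<in>A. open U \<and> open (\<phi> ` U) \<and> homeomorphism U (\<phi> ` U) \<phi> (inv_into U \<phi>)) \<and>
     (\<forall>(U, \<phi>)\<in>A. \<forall>(V, \<psi>)\<in>A. smooth_on (\<lambda>p. \<psi> (inv_into U \<phi> p)) (\<phi> ` (U \<inter> V)))"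

definition is_lie_group ::
    "('g::{t2_space,second_countable_topology}, 'e::euclidean_space, 'z) lie_group_scheme \<Rightarrow> bool" where
  "is_lie_group G \<longleftrightarrow>
     group G \<and> carrier G = UNIV \<and> smooth_atlas (atlas G) \<and>
     continuous_on UNIV (\<lambda>(x, y). x \<otimes>\<^bsub>G\<^esub> y) \<and>
     continuous_on UNIV (\<lambda>x. inv\<^bsub>G\<^esub> x) \<and>
     (\<forall>(U, \<phi>)\<in>atlas G. \<forall>(V, \<psi>)\<in>atlas G. \<forall>(W, \<eta>)\<in>atlas G.
        smooth_on (\<lambda>(p, q). \<eta> (inv_into U \<phi> p \<otimes>\<^bsub>G\<^esub> inv_into V \<psi> q))
          {(\<phi> x, \<psi> y) |x y. x \<in> U \<and> y \<in> V \<and> x \<otimes>\<^bsub>G\<^esub> y \<in> W}) \<and>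
     (\<forall>(U, \<phi>)\<in>atlas G. \<forall>(W, \<eta>)\<in>atlas G.
        smooth_on (\<lambda>p. \<eta> (inv\<^bsub>G\<^esub> (inv_into U \<phi> p))) {\<phi> x |x. x \<in> U \<and> inv\<^bsub>G\<^esub> x \<in> W})"

definition smooth_map ::
    "('g::{t2_space,second_countable_topology}, 'e::euclidean_space, 'z) lie_group_scheme
      \<Rightarrow> ('g \<Rightarrow> 'b::real_normed_vector) \<Rightarrow> bool" where
  "smooth_map G f \<longleftrightarrow> (\<forall>(U, \<phi>)\<in>atlas G. smooth_on (\<lambda>p. f (inv_into U \<phi> p)) (\<phi> ` U))"

text \<open>A chart around the identity is chosen once and for all. Its differential at the identity
  identifies the Lie algebra of \<open>G\<close>, as a vector space, with \<open>'e\<close>.\<close>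

definition id_chart :: "('g, 'e, 'z) lie_group_scheme \<Rightarrow> 'g set \<times> ('g \<Rightarrow> 'e)" where
  "id_chart G = (SOME c. c \<in> atlas G \<and> \<one>\<^bsub>G\<^esub> \<in> fst c)"

abbreviation id_dom :: "('g, 'e, 'z) lie_group_scheme \<Rightarrow> 'g set" where
  "id_dom G \<equiv> fst (id_chart G)"

abbreviation id_coord :: "('g, 'e, 'z) lie_group_scheme \<Rightarrow> 'g \<Rightarrow> 'e" where
  "id_coord G \<equiv> snd (id_chart G)"

text \<open>\<open>lderiv G X f g\<close> is \<open>X(f)(g)\<close>, the derivative at \<open>g\<close> of \<open>f\<close> along the left invariant vector
  field induced by \<open>X\<close>, i.e. the derivative at the identity of \<open>x \<mapsto> f (g x)\<close> in direction \<open>X\<close>.\<close>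

definition lderiv ::
    "('g, 'e::euclidean_space, 'z) lie_group_scheme \<Rightarrow> 'e \<Rightarrow> ('g \<Rightarrow> 'b::real_normed_vector)
      \<Rightarrow> 'g \<Rightarrow> 'b" where
  "lderiv G X f g =
     frechet_derivative (\<lambda>p. f (g \<otimes>\<^bsub>G\<^esub> inv_into (id_dom G) (id_coord G) p))
       (at (id_coord G \<one>\<^bsub>G\<^esub>)) X"

text \<open>The commutator of the left invariant vector fields induced by \<open>X\<close> and \<open>Y\<close>, evaluated at the
  identity: near the identity, \<open>lderiv G Y (id_coord G)\<close> is the coordinate expression of the left
  invariant field induced by \<open>Y\<close>.\<close>

definition lie_bracket ::
    "('g, 'e::euclidean_space, 'z) lie_group_scheme \<Rightarrow> 'e \<Rightarrow> 'e \<Rightarrow> 'e" where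
  "lie_bracket G X Y =
     lderiv G X (lderiv G Y (id_coord G)) \<one>\<^bsub>G\<^esub> - lderiv G Y (lderiv G X (id_coord G)) \<one>\<^bsub>G\<^esub>"

definition Ad :: "('g, 'e::euclidean_space, 'z) lie_group_scheme \<Rightarrow> 'g \<Rightarrow> 'e \<Rightarrow> 'e" where
  "Ad G g X = lderiv G X (\<lambda>x. id_coord G (g \<otimes>\<^bsub>G\<^esub> x \<otimes>\<^bsub>G\<^esub> inv\<^bsub>G\<^esub> g)) \<one>\<^bsub>G\<^esub>"

text \<open>The tangent space at the identity of a closed (hence embedded) subgroup \<open>K\<close>: the velocities of
  the smooth curves in \<open>K\<close> starting at the identity.\<close>

definition lie_subalgebra ::
    "('g, 'e::euclidean_space, 'z) lie_group_scheme \<Rightarrow> 'g set \<Rightarrow> 'e set" where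
  "lie_subalgebra G K =
     {X. \<exists>\<gamma> \<epsilon>. (0::real) < \<epsilon> \<and> \<gamma> 0 = \<one>\<^bsub>G\<^esub> \<and> (\<forall>s\<in>{-\<epsilon><..<\<epsilon>}. \<gamma> s \<in> K \<inter> id_dom G) \<and>
        smooth_on (\<lambda>s. id_coord G (\<gamma> s)) {-\<epsilon><..<\<epsilon>} \<and>
        ((\<lambda>s. id_coord G (\<gamma> s)) has_vector_derivative X) (at 0)}"


section \<open>Naturally reductive homogeneous spaces\<close>

definition linear_on_set :: "'a::real_vector set \<Rightarrow> ('a \<Rightarrow> 'b::real_vector) \<Rightarrow> bool" where
  "linear_on_set S f \<longleftrightarrow>
     (\<forall>x\<in>S. \<forall>y\<in>S. \<forall>a b. f (a *\<^sub>R x + b *\<^sub>R y) = a *\<^sub>R f x + b *\<^sub>R f y)"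

text \<open>The homogeneous space \<open>G/H\<close> with \<open>H = isotropy M\<close>; \<open>mspace M\<close> is the complement \<open>m\<close> of the Lie
  algebra of \<open>H\<close> (inside the Lie algebra \<open>'e\<close> of \<open>G\<close>), identified with the tangent space at the base
  point, and the \<open>G\<close>-invariant Riemannian metric is given by the \<open>Ad H\<close>-invariant inner product
  \<open>metric M\<close> on \<open>m\<close>. The values of \<open>metric M\<close> outside \<open>m\<close> and the inner product of the type \<open>'e\<close> are
  irrelevant.\<close>

record ('g, 'e) reductive_space = "('g, 'e) lie_group" +
  isotropy :: "'g set"
  mspace :: "'e set"
  metric :: "'e \<Rightarrow> 'e \<Rightarrow> real"

abbreviation hspace :: "('g, 'e::euclidean_space, 'z) reductive_space_scheme \<Rightarrow> 'e set" where
  "hspace M \<equiv> lie_subalgebra M (isotropy M)"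

definition mpart :: "('g, 'e::euclidean_space, 'z) reductive_space_scheme \<Rightarrow> 'e \<Rightarrow> 'e" where
  "mpart M A = (THE x. x \<in> mspace M \<and> A - x \<in> hspace M)"

definition hpart :: "('g, 'e::euclidean_space, 'z) reductive_space_scheme \<Rightarrow> 'e \<Rightarrow> 'e" where
  "hpart M A = A - mpart M A"

definition riemannian_reductive ::
    "('g::{t2_space,second_countable_topology}, 'e::euclidean_space, 'z) reductive_space_scheme
      \<Rightarrow> bool" where
  "riemannian_reductive M \<longleftrightarrow>
     is_lie_group M \<and> subgroup (isotropy M) M \<and> closed (isotropy M) \<and>
     subspace (mspace M) \<and> hspace M \<inter> mspace M = {0} \<and>
     (\<forall>A. \<exists>x\<in>hspace M. \<exists>y\<in>mspace M. A = x + y) \<and>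
     (\<forall>h\<in>isotropy M. Ad M h ` mspace M \<subseteq> mspace M) \<and>
     (\<forall>x\<in>mspace M. linear_on_set (mspace M) (metric M x)) \<and>
     (\<forall>x\<in>mspace M. \<forall>y\<in>mspace M. metric M x y = metric M y x) \<and>
     (\<forall>x\<in>mspace M. x \<noteq> 0 \<longrightarrow> 0 < metric M x x) \<and>
     (\<forall>h\<in>isotropy M. \<forall>x\<in>mspace M. \<forall>y\<in>mspace M.
        metric M (Ad M h x) (Ad M h y) = metric M x y)"

text \<open>The last conjunct is the standing assumption that \<open>m\<close> and \<open>[m, m]\<close> together span the Lie
  algebra.\<close>

definition naturally_reductive ::
    "('g::{t2_space,second_countable_topology}, 'e::euclidean_space, 'z) reductive_space_scheme
      \<Rightarrow> bool" where
  "naturally_reductive M \<longleftrightarrow>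
     riemannian_reductive M \<and>
     (\<forall>X\<in>mspace M. \<forall>Y\<in>mspace M. \<forall>Z\<in>mspace M.
        metric M (mpart M (lie_bracket M X Y)) Z + metric M Y (mpart M (lie_bracket M X Z)) = 0) \<and>
     span (mspace M \<union> {lie_bracket M X Y |X Y. X \<in> mspace M \<and> Y \<in> mspace M}) = UNIV"

definition invariant_form ::
    "('g, 'e::euclidean_space, 'z) reductive_space_scheme \<Rightarrow> ('e \<Rightarrow> 'e \<Rightarrow> real) \<Rightarrow> bool" where
  "invariant_form M Q \<longleftrightarrow>
     bilinear Q \<and> (\<forall>A B. Q A B = Q B A) \<and> (\<forall>A. (\<forall>B. Q A B = 0) \<longrightarrow> A = 0) \<and>
     (\<forall>g\<in>carrier M. \<forall>A B. Q (Ad M g A) (Ad M g B) = Q A B) \<and>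
     (\<forall>A\<in>hspace M. \<forall>B\<in>mspace M. Q A B = 0) \<and>
     (\<forall>A\<in>mspace M. \<forall>B\<in>mspace M. Q A B = metric M A B)"

definition Q_h ::
    "('g, 'e::euclidean_space, 'z) reductive_space_scheme \<Rightarrow> ('e \<Rightarrow> 'e \<Rightarrow> real)
      \<Rightarrow> 'e \<Rightarrow> 'e \<Rightarrow> real" where
  "Q_h M Q A B = Q (hpart M A) (hpart M B)"

definition Q_m :: "('g, 'e::euclidean_space, 'z) reductive_space_scheme \<Rightarrow> 'e \<Rightarrow> 'e \<Rightarrow> real" where
  "Q_m M A B = metric M (mpart M A) (mpart M B)"

definition orthonormal_basis_m ::
    "('g, 'e::euclidean_space, 'z) reductive_space_scheme \<Rightarrow> (nat \<Rightarrow> 'e) \<Rightarrow> bool" where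
  "orthonormal_basis_m M Z \<longleftrightarrow>
     span (Z ` {1..dim (mspace M)}) = mspace M \<and>
     (\<forall>i\<in>{1..dim (mspace M)}. \<forall>j\<in>{1..dim (mspace M)}.
        metric M (Z i) (Z j) = (if i = j then 1 else 0))"

definition dual_bases_h ::
    "('g, 'e::euclidean_space, 'z) reductive_space_scheme \<Rightarrow> ('e \<Rightarrow> 'e \<Rightarrow> real)
      \<Rightarrow> (nat \<Rightarrow> 'e) \<Rightarrow> (nat \<Rightarrow> 'e) \<Rightarrow> bool" where
  "dual_bases_h M Q Xs Ys \<longleftrightarrow>
     span (Xs ` {1..dim (hspace M)}) = hspace M \<and>
     span (Ys ` {1..dim (hspace M)}) = hspace M \<and>
     (\<forall>i\<in>{1..dim (hspace M)}. \<forall>j\<in>{1..dim (hspace M)}.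
        Q (Xs i) (Ys j) = (if i = j then 1 else 0))"


section \<open>The family of connections and their curvature\<close>

text \<open>The tangent bundle of \<open>G/H\<close> is the bundle associated with the isotropy representation on \<open>m\<close>.
  Vector fields on \<open>G/H\<close> are therefore the equivariant smooth maps \<open>V\<close> from \<open>G\<close> to \<open>m\<close>; the tangent
  vector at \<open>gH\<close> is the image of \<open>V g\<close> under the differential of the translation by \<open>g\<close>.\<close>

definition vector_field ::
    "('g::{t2_space,second_countable_topology}, 'e::euclidean_space, 'z) reductive_space_scheme
      \<Rightarrow> ('g \<Rightarrow> 'e) \<Rightarrow> bool" where
  "vector_field M V \<longleftrightarrow>
     smooth_map M V \<and> (\<forall>g. V g \<in> mspace M) \<and>
     (\<forall>g. \<forall>h\<in>isotropy M. V (g \<otimes>\<^bsub>M\<^esub> h) = Ad M (inv\<^bsub>M\<^esub> h) (V g))"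

text \<open>The canonical connection differentiates along the horizontal lift, which at \<open>g\<close> is the left
  invariant field induced by \<open>X g \<in> m\<close>.\<close>

definition nabla ::
    "('g, 'e::euclidean_space, 'z) reductive_space_scheme \<Rightarrow> real \<Rightarrow> ('g \<Rightarrow> 'e) \<Rightarrow> ('g \<Rightarrow> 'e)
      \<Rightarrow> 'g \<Rightarrow> 'e" where
  "nabla M t X Y g = lderiv M (X g) Y g + t *\<^sub>R mpart M (lie_bracket M (X g) (Y g))"

text \<open>The Lie bracket of vector fields on \<open>G/H\<close>: the projection of the commutator of their horizontal
  lifts.\<close>

definition vf_bracket ::
    "('g, 'e::euclidean_space, 'z) reductive_space_scheme \<Rightarrow> ('g \<Rightarrow> 'e) \<Rightarrow> ('g \<Rightarrow> 'e)
      \<Rightarrow> 'g \<Rightarrow> 'e" where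
  "vf_bracket M X Y g = lderiv M (X g) Y g - lderiv M (Y g) X g + mpart M (lie_bracket M (X g) (Y g))"

definition curvature_op ::
    "('g, 'e::euclidean_space, 'z) reductive_space_scheme \<Rightarrow> real \<Rightarrow> ('g \<Rightarrow> 'e) \<Rightarrow> ('g \<Rightarrow> 'e)
      \<Rightarrow> ('g \<Rightarrow> 'e) \<Rightarrow> 'g \<Rightarrow> 'e" where
  "curvature_op M t X Y V g =
     nabla M t X (nabla M t Y V) g - nabla M t Y (nabla M t X V) g
       - nabla M t (vf_bracket M X Y) V g"

text \<open>The curvature tensor at \<open>gH\<close>, with \<open>T\<^sub>g\<^sub>H(G/H)\<close> identified with \<open>m\<close> through \<open>g\<close>: evaluate on
  arbitrary vector fields with the prescribed values at \<open>g\<close>. (Such vector fields exist, for example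
  the fundamental vector fields \<open>k \<mapsto> (Ad(k\<inverse>)A)\<^sub>m\<close>, so the description determines the
  value as soon as \<open>curvature_op\<close> is tensorial.)\<close>

definition curvature ::
    "('g::{t2_space,second_countable_topology}, 'e::euclidean_space, 'z) reductive_space_scheme
      \<Rightarrow> real \<Rightarrow> 'g \<Rightarrow> 'e \<Rightarrow> 'e \<Rightarrow> 'e \<Rightarrow> 'e" where
  "curvature M t g x y v =
     (THE w. \<forall>X Y V. vector_field M X \<and> vector_field M Y \<and> vector_field M V \<and>
        X g = x \<and> Y g = y \<and> V g = v \<longrightarrow> curvature_op M t X Y V g = w)"

definition ricci ::
    "('g::{t2_space,second_countable_topology}, 'e::euclidean_space, 'z) reductive_space_scheme
      \<Rightarrow> (nat \<Rightarrow> 'e) \<Rightarrow> real \<Rightarrow> 'g \<Rightarrow> 'e \<Rightarrow> 'e \<Rightarrow> real" where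
  "ricci M Z t g x y = (\<Sum>i=1..dim (mspace M). metric M (curvature M t g x (Z i) (Z i)) y)"

definition scal ::
    "('g::{t2_space,second_countable_topology}, 'e::euclidean_space, 'z) reductive_space_scheme
      \<Rightarrow> (nat \<Rightarrow> 'e) \<Rightarrow> real \<Rightarrow> 'g \<Rightarrow> real" where
  "scal M Z t g = (\<Sum>j=1..dim (mspace M). ricci M Z t g (Z j) (Z j))"


section \<open>Homogeneous spin structures\<close>

text \<open>The Clifford algebra of \<open>m\<close> is the type \<open>'c\<close>, with \<open>m\<close> embedded by \<open>cliff\<close>; its topology is
  that of a finite-dimensional real vector space. Its complex representation on
  \<open>\<Delta>\<^sub>m = complex^'k\<close> is \<open>spinrep\<close>, and \<open>slift\<close> is the lift of the isotropy representation to the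
  spin group.\<close>

record ('g, 'e, 'c, 'k) spin_space = "('g, 'e) reductive_space" +
  cliff :: "'e \<Rightarrow> 'c"
  spinrep :: "'c \<Rightarrow> complex^'k^'k"
  slift :: "'g \<Rightarrow> 'c"

text \<open>An algebra of dimension \<open>2\<^sup>n\<close> generated by \<open>m\<close> subject to the Clifford relations is the
  Clifford algebra.\<close>

definition clifford_algebra ::
    "('g, 'e::euclidean_space, 'c::{euclidean_space,real_algebra_1}, 'k::finite, 'z)
      spin_space_scheme \<Rightarrow> bool" where
  "clifford_algebra M \<longleftrightarrow>
     linear_on_set (mspace M) (cliff M) \<and>
     (\<forall>v\<in>mspace M. \<forall>w\<in>mspace M.
        cliff M v * cliff M w + cliff M w * cliff M v = (- 2 * metric M v w) *\<^sub>R 1) \<and>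
     span {prod_list (map (cliff M) vs) |vs. set vs \<subseteq> mspace M} = UNIV \<and>
     DIM('c) = 2 ^ dim (mspace M)"

text \<open>The complex representations of the Clifford algebra of the dimension required here are
  irreducible. For even \<open>n\<close> there is one up to isomorphism, for odd \<open>n\<close> there are two, and either is
  allowed. The spin representation of the spin group is the restriction.\<close>

definition spinor_module ::
    "('g, 'e::euclidean_space, 'c::{euclidean_space,real_algebra_1}, 'k::finite, 'z)
      spin_space_scheme \<Rightarrow> bool" where
  "spinor_module M \<longleftrightarrow>
     linear (spinrep M) \<and> spinrep M 1 = mat 1 \<and>
     (\<forall>a b. spinrep M (a * b) = spinrep M a ** spinrep M b) \<and>
     CARD('k) = 2 ^ (dim (mspace M) div 2)"

definition spin_group ::
    "('g, 'e::euclidean_space, 'c::{euclidean_space,real_algebra_1}, 'k::finite, 'z)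
      spin_space_scheme \<Rightarrow> 'c set" where
  "spin_group M =
     {prod_list (map (cliff M) vs) |vs. set vs \<subseteq> {v \<in> mspace M. metric M v v = 1} \<and> even (length vs)}"

text \<open>The last conjunct says that the twofold covering from the spin group to \<open>SO(m)\<close>, which sends
  \<open>a\<close> to \<open>v \<mapsto> a v a\<inverse>\<close>, maps \<open>slift M h\<close> to \<open>Ad h\<close>. Continuity on the closed subgroup
  implies smoothness.\<close>

definition spin_lift ::
    "('g::{t2_space,second_countable_topology}, 'e::euclidean_space,
      'c::{euclidean_space,real_algebra_1}, 'k::finite, 'z) spin_space_scheme \<Rightarrow> bool" where
  "spin_lift M \<longleftrightarrow>
     (\<forall>h\<in>isotropy M. slift M h \<in> spin_group M) \<and>
     (\<forall>h\<in>isotropy M. \<forall>k\<in>isotropy M. slift M (h \<otimes>\<^bsub>M\<^esub> k) = slift M h * slift M k) \<and>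
     continuous_on (isotropy M) (slift M) \<and>
     (\<forall>h\<in>isotropy M. \<forall>v\<in>mspace M. slift M h * cliff M v = cliff M (Ad M h v) * slift M h)"

definition homogeneous_spin_structure ::
    "('g::{t2_space,second_countable_topology}, 'e::euclidean_space,
      'c::{euclidean_space,real_algebra_1}, 'k::finite, 'z) spin_space_scheme \<Rightarrow> bool" where
  "homogeneous_spin_structure M \<longleftrightarrow> clifford_algebra M \<and> spinor_module M \<and> spin_lift M"

definition spinor_field ::
    "('g::{t2_space,second_countable_topology}, 'e::euclidean_space,
      'c::{euclidean_space,real_algebra_1}, 'k::finite, 'z) spin_space_scheme
      \<Rightarrow> ('g \<Rightarrow> complex^'k) \<Rightarrow> bool" where
  "spinor_field M \<psi> \<longleftrightarrow>
     smooth_map M \<psi> \<and>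
     (\<forall>g. \<forall>h\<in>isotropy M. \<psi> (g \<otimes>\<^bsub>M\<^esub> h) = spinrep M (slift M (inv\<^bsub>M\<^esub> h)) *v \<psi> g)"


section \<open>The Dirac operators and the Casimir operator\<close>

definition cubic_element ::
    "('g, 'e::euclidean_space, 'c::{euclidean_space,real_algebra_1}, 'k::finite, 'z)
      spin_space_scheme \<Rightarrow> (nat \<Rightarrow> 'e) \<Rightarrow> 'c" where
  "cubic_element M Z =
     (1/4) *\<^sub>R (\<Sum>i=1..dim (mspace M). \<Sum>j=1..dim (mspace M). \<Sum>k=1..dim (mspace M).
       metric M (mpart M (lie_bracket M (Z i) (Z j))) (Z k) *\<^sub>R
         (cliff M (Z i) * cliff M (Z j) * cliff M (Z k)))"

definition dirac ::
    "('g, 'e::euclidean_space, 'c::{euclidean_space,real_algebra_1}, 'k::finite, 'z)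
      spin_space_scheme \<Rightarrow> (nat \<Rightarrow> 'e) \<Rightarrow> real \<Rightarrow> ('g \<Rightarrow> complex^'k) \<Rightarrow> 'g \<Rightarrow> complex^'k" where
  "dirac M Z t \<psi> g =
     (\<Sum>i=1..dim (mspace M). spinrep M (cliff M (Z i)) *v lderiv M (Z i) \<psi> g)
       + t *\<^sub>R (spinrep M (cubic_element M Z) *v \<psi> g)"

definition ad_lift ::
    "('g, 'e::euclidean_space, 'c::{euclidean_space,real_algebra_1}, 'k::finite, 'z)
      spin_space_scheme \<Rightarrow> (nat \<Rightarrow> 'e) \<Rightarrow> 'e \<Rightarrow> 'c" where
  "ad_lift M Z Y =
     (1/4) *\<^sub>R (\<Sum>i=1..dim (mspace M). \<Sum>j=1..dim (mspace M).
       metric M (lie_bracket M Y (Z i)) (Z j) *\<^sub>R (cliff M (Z i) * cliff M (Z j)))"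

definition casimir_h ::
    "('g, 'e::euclidean_space, 'c::{euclidean_space,real_algebra_1}, 'k::finite, 'z)
      spin_space_scheme \<Rightarrow> (nat \<Rightarrow> 'e) \<Rightarrow> (nat \<Rightarrow> 'e) \<Rightarrow> (nat \<Rightarrow> 'e) \<Rightarrow> 'c" where
  "casimir_h M Z Xs Ys = - (\<Sum>i=1..dim (hspace M). ad_lift M Z (Xs i) * ad_lift M Z (Ys i))"

definition Omega_g ::
    "('g, 'e::euclidean_space, 'c::{euclidean_space,real_algebra_1}, 'k::finite, 'z)
      spin_space_scheme \<Rightarrow> (nat \<Rightarrow> 'e) \<Rightarrow> (nat \<Rightarrow> 'e) \<Rightarrow> (nat \<Rightarrow> 'e)
      \<Rightarrow> ('g \<Rightarrow> complex^'k) \<Rightarrow> 'g \<Rightarrow> complex^'k" where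
  "Omega_g M Z Xs Ys \<psi> g =
     - (\<Sum>i=1..dim (mspace M). lderiv M (Z i) (lderiv M (Z i) \<psi>) g)
       + spinrep M (casimir_h M Z Xs Ys) *v \<psi> g"

end

theory Submission
  imports Defs
begin

text \<open>Left invariant derivatives satisfy \<open>X Y - Y X = [X, Y]\<close>, and equivariance of a spinor field
  \<open>\<psi>\<close> under the isotropy group gives \<open>Y(\<psi>) = - ad_lift Y \<psi>\<close> for \<open>Y\<close> in \<open>h\<close>. Squaring
  \<open>D\<^sup>t = \<Sum> Z\<^sub>i Z\<^sub>i(\<psi>) + t H \<psi>\<close>, the antisymmetric second order part becomes first order terms
  \<open>1/2 \<Sum> A\<^sub>k Z\<^sub>k(\<psi>)\<close> with \<open>A\<^sub>k = \<Sum> \<langle>[Z\<^sub>i, Z\<^sub>j], Z\<^sub>k\<rangle> Z\<^sub>i Z\<^sub>j\<close>, plus twice the Casimir element of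
  \<open>h\<close>. Since \<open>Z\<^sub>k H + H Z\<^sub>k = - 3/2 A\<^sub>k\<close>, the value \<open>t = 1/3\<close> is the one for which the first order
  terms cancel. There remains the element \<open>C + H\<^sup>2 / 9\<close> of the Clifford algebra. Modulo scalars it is
  \<open>- 1/16 \<Sum> Q([Z\<^sub>i, Z\<^sub>j], [Z\<^sub>k, Z\<^sub>l]) Z\<^sub>i Z\<^sub>j Z\<^sub>k Z\<^sub>l\<close>, which is itself a scalar by the Jacobi identity.
  The curvature tensor, evaluated on fundamental vector fields, gives
  \<open>Scal\<^sup>t = \<Sum> Q\<^sub>h + (t - t\<^sup>2) \<Sum> Q\<^sub>m\<close>.\<close>

section \<open>Smooth maps\<close>

text \<open>Two obstacles shape the development. The lift \<open>slift\<close> is only known to be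
  continuous, so equivariance of spinors cannot simply be differentiated. The covering relation
  determines the derivative of \<open>slift\<close> up to a scalar, and an inner product on the
  Clifford algebra that is invariant under the spin group removes the scalar. Moreover
  \<open>Ad\<close>, the bracket and the Lie algebra of the isotropy group are given by charts and
  curves only, so the Jacobi identity, the infinitesimal invariance of \<open>Q\<close> and even the
  linearity of \<open>h\<close> have to be derived.

  The scalar comes from \<open>H\<^sup>2 = - 9/16 \<Sum> A\<^sub>p\<^sup>2 - 3/4 N\<close> with
  \<open>N = \<Sum> Q\<^sub>m\<close>. The weight 1/9 turns -9/16 into the -1/16 that the Casimir
  element carries, so the \<open>Q\<^sub>h\<close> part and the \<open>Q\<^sub>m\<close> part join
  to the full form \<open>Q\<close>. By invariance,
  \<open>Q([x, y], [z, w]) = Q([[x, y], z], w)\<close> then has the symmetries of a torsion free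
  curvature tensor, and its quartic Clifford sum collapses as in the Lichnerowicz formula. The
  scalars add up to \<open>1/8 (\<Sum> Q\<^sub>h + N) - N/12\<close>, which is where the factor 1/3
  in front of \<open>\<Sum> Q\<^sub>m\<close> originates.\<close>

abbreviation fderiv :: "('a::real_normed_vector \<Rightarrow> 'b::real_normed_vector) \<Rightarrow> 'a \<Rightarrow> 'a \<Rightarrow> 'b" where
  "fderiv f x \<equiv> frechet_derivative f (at x)"

lemma frechet_derivative_eqI:
  "(f has_derivative f') (at x) \<Longrightarrow> fderiv f x = f'"
  using frechet_derivative_at by metis

lemma Ck_on_cong:
  assumes "open S" "\<And>x. x \<in> S \<Longrightarrow> f x = g x"
  shows "Ck_on k f S \<longleftrightarrow> Ck_on k g S"
  using assms
proof (induction k arbitrary: f g)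
  case 0
  then show ?case by (simp cong: continuous_on_cong)
next
  case (Suc k)
  have d: "f differentiable at x \<longleftrightarrow> g differentiable at x"
    and e: "fderiv f x = fderiv g x" if "x \<in> S" for x
  proof -
    have *: "(f has_derivative D) (at x) \<longleftrightarrow> (g has_derivative D) (at x)" for D
      using has_derivative_transform_within_open[OF _ \<open>open S\<close> that, of f D UNIV g]
        has_derivative_transform_within_open[OF _ \<open>open S\<close> that, of g D UNIV f] Suc.prems(2)
      by fastforce
    then show "f differentiable at x \<longleftrightarrow> g differentiable at x"
      by (simp add: differentiable_def)
    show "fderiv f x = fderiv g x"
      using * by (simp add: frechet_derivative_def)
  qed
  have "Ck_on k (\<lambda>x. fderiv f x v) S
      \<longleftrightarrow> Ck_on k (\<lambda>x. fderiv g x v) S" for v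
    by (rule Suc.IH) (use Suc.prems e in auto)
  with d show ?case by simp
qed

lemma Ck_on_subset: "Ck_on k f S \<Longrightarrow> T \<subseteq> S \<Longrightarrow> Ck_on k f T"
  by (induction k arbitrary: f) (auto intro: continuous_on_subset)

lemma Ck_on_local:
  assumes "\<And>x. x \<in> S \<Longrightarrow> \<exists>T. open T \<and> x \<in> T \<and> Ck_on k f T"
  shows "Ck_on k f S"
  using assms
proof (induction k arbitrary: f)
  case 0
  then show ?case
    by (metis Ck_on.simps(1) continuous_at_imp_continuous_on continuous_on_eq_continuous_at)
next
  case (Suc k)
  have "f differentiable at x" if "x \<in> S" for x
    using Suc.prems[OF that] by auto
  moreover have "Ck_on k (\<lambda>x. fderiv f x v) S" for v
    by (rule Suc.IH) (use Suc.prems in fastforce)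
  ultimately show ?case by simp
qed

lemma Ck_on_Suc_imp: "Ck_on (Suc k) f S \<Longrightarrow> Ck_on k f S"
proof (induction k arbitrary: f)
  case 0
  then show ?case
    by (auto intro!: continuous_at_imp_continuous_on differentiable_imp_continuous_within)
next
  case (Suc k)
  then show ?case by (metis Ck_on.simps(2))
qed

lemma Ck_on_const: "Ck_on k (\<lambda>x. c) S"
  by (induction k arbitrary: c) auto

lemma Ck_on_bounded_linear:
  assumes "open S" "bounded_linear L" "Ck_on k f S"
  shows "Ck_on k (\<lambda>x. L (f x)) S"
  using assms(3)
proof (induction k arbitrary: f)
  case 0
  then show ?case
    using bounded_linear.continuous_on[OF assms(2)] by simp
next
  case (Suc k)
  have d: "((\<lambda>x. L (f x)) has_derivative (\<lambda>v. L (fderiv f x v))) (at x)"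
    if "x \<in> S" for x
    using Suc.prems that
    by (auto intro!: bounded_linear.has_derivative[OF assms(2)] simp: frechet_derivative_works[symmetric])
  then have "(\<lambda>x. L (f x)) differentiable at x" if "x \<in> S" for x
    using that differentiable_def by blast
  moreover have "Ck_on k (\<lambda>x. fderiv (\<lambda>x. L (f x)) x v) S" for v
  proof -
    have "Ck_on k (\<lambda>x. L (fderiv f x v)) S"
      by (rule Suc.IH) (use Suc.prems in simp)
    then show ?thesis
      using Ck_on_cong[OF \<open>open S\<close>, of "\<lambda>x. fderiv (\<lambda>x. L (f x)) x v"]
      by (simp add: frechet_derivative_eqI[OF d])
  qed
  ultimately show ?case by simp
qed

lemma Ck_on_add:
  assumes "open S" "Ck_on k f S" "Ck_on k g S"
  shows "Ck_on k (\<lambda>x. f x + g x) S"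
  using assms(2,3)
proof (induction k arbitrary: f g)
  case 0
  then show ?case by (simp add: continuous_on_add)
next
  case (Suc k)
  have d: "((\<lambda>x. f x + g x) has_derivative
      (\<lambda>v. fderiv f x v + fderiv g x v)) (at x)"
    if "x \<in> S" for x
    using Suc.prems that
    by (auto intro!: derivative_intros simp: frechet_derivative_works[symmetric])
  then have "(\<lambda>x. f x + g x) differentiable at x" if "x \<in> S" for x
    using that differentiable_def by blast
  moreover have "Ck_on k (\<lambda>x. fderiv (\<lambda>x. f x + g x) x v) S" for v
  proof -
    have "Ck_on k (\<lambda>x. fderiv f x v + fderiv g x v) S"
      by (rule Suc.IH) (use Suc.prems in simp_all)
    then show ?thesis
      using Ck_on_cong[OF \<open>open S\<close>, of "\<lambda>x. fderiv (\<lambda>x. f x + g x) x v"]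
      by (simp add: frechet_derivative_eqI[OF d])
  qed
  ultimately show ?case by simp
qed

lemma Ck_on_bilinear:
  assumes "open S" "bounded_bilinear B" "Ck_on k f S" "Ck_on k g S"
  shows "Ck_on k (\<lambda>x. B (f x) (g x)) S"
  using assms(3,4)
proof (induction k arbitrary: f g)
  case 0
  then show ?case using bounded_bilinear.continuous_on[OF assms(2)] by simp
next
  case (Suc k)
  have d: "((\<lambda>x. B (f x) (g x)) has_derivative
      (\<lambda>v. B (f x) (fderiv g x v) + B (fderiv f x v) (g x))) (at x)"
    if "x \<in> S" for x
    using Suc.prems that
    by (auto intro!: bounded_bilinear.FDERIV[OF assms(2)] simp: frechet_derivative_works[symmetric])
  then have "(\<lambda>x. B (f x) (g x)) differentiable at x" if "x \<in> S" for x
    using that differentiable_def by blast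
  moreover have "Ck_on k (\<lambda>x. fderiv (\<lambda>x. B (f x) (g x)) x v) S" for v
  proof -
    have "Ck_on k (\<lambda>x. B (f x) (fderiv g x v) + B (fderiv f x v) (g x)) S"
      by (intro Ck_on_add Suc.IH assms(1))
        (use Suc.prems Suc.prems[THEN Ck_on_Suc_imp] in simp_all)
    then show ?thesis
      using Ck_on_cong[OF \<open>open S\<close>, of "\<lambda>x. fderiv (\<lambda>x. B (f x) (g x)) x v"]
      by (simp add: frechet_derivative_eqI[OF d])
  qed
  ultimately show ?case by simp
qed

lemma Ck_on_sum:
  assumes "open S" "finite I" "\<And>i. i \<in> I \<Longrightarrow> Ck_on k (f i) S"
  shows "Ck_on k (\<lambda>x. \<Sum>i\<in>I. f i x) S"
  using assms(2,3) by (induction I) (simp_all add: Ck_on_const Ck_on_add assms(1))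

lemma linear_euclidean_expand:
  fixes L :: "'a::euclidean_space \<Rightarrow> 'b::real_vector"
  assumes "linear L"
  shows "L v = (\<Sum>b\<in>Basis. (v \<bullet> b) *\<^sub>R L b)"
proof -
  have "L v = L (\<Sum>b\<in>Basis. (v \<bullet> b) *\<^sub>R b)"
    by (simp add: euclidean_representation)
  also have "\<dots> = (\<Sum>b\<in>Basis. (v \<bullet> b) *\<^sub>R L b)"
    by (simp add: linear_sum[OF assms] linear_scale[OF assms])
  finally show ?thesis .
qed

text \<open>\<open>Ck_on\<close> speaks of derivatives in fixed directions, whereas the chain rule
  differentiates \<open>f\<close> in the moving direction \<open>fderiv g x v\<close>. Expanding
  that direction over \<open>Basis\<close> leaves a finite sum of products to which the induction
  hypothesis applies, which is why the intermediate space is Euclidean.\<close>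

lemma Ck_on_compose:
  fixes f :: "'b::euclidean_space \<Rightarrow> 'c::real_normed_vector"
    and g :: "'a::real_normed_vector \<Rightarrow> 'b"
  assumes "open S" "open T" "g ` S \<subseteq> T" "Ck_on k f T" "Ck_on k g S"
  shows "Ck_on k (\<lambda>x. f (g x)) S"
  using assms(4,5)
proof (induction k arbitrary: f)
  case 0
  then show ?case
    using continuous_on_compose2[OF _ _ assms(3)] by auto
next
  case (Suc k)
  have d: "((\<lambda>x. f (g x)) has_derivative
      (\<lambda>v. fderiv f (g x) (fderiv g x v))) (at x)"
    if "x \<in> S" for x
  proof -
    have "(g has_derivative fderiv g x) (at x)"
      using Suc.prems that by (auto simp: frechet_derivative_works[symmetric])
    moreover have "(f has_derivative fderiv f (g x)) (at (g x))"
      using Suc.prems that assms(3) by (auto simp: frechet_derivative_works[symmetric])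
    ultimately show ?thesis by (rule has_derivative_compose)
  qed
  then have "(\<lambda>x. f (g x)) differentiable at x" if "x \<in> S" for x
    using that differentiable_def by blast
  moreover have "Ck_on k (\<lambda>x. fderiv (\<lambda>x. f (g x)) x v) S" for v
  proof -
    let ?D = "\<lambda>x. \<Sum>b\<in>Basis. (fderiv g x v \<bullet> b) *\<^sub>R fderiv f (g x) b"
    have g: "Ck_on k g S" using Suc.prems Ck_on_Suc_imp by blast
    have "Ck_on k ?D S"
    proof (intro Ck_on_sum Ck_on_bilinear[OF assms(1) bounded_bilinear_scaleR] assms(1))
      fix b :: 'b
      show "Ck_on k (\<lambda>x. fderiv f (g x) b) S"
        by (rule Suc.IH[OF _ g]) (use Suc.prems in simp)
      show "Ck_on k (\<lambda>x. fderiv g x v \<bullet> b) S"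
        by (rule Ck_on_bounded_linear[OF assms(1) bounded_linear_inner_left])
          (use Suc.prems in simp)
    qed simp
    moreover have "fderiv (\<lambda>x. f (g x)) x v = ?D x" if "x \<in> S" for x
    proof -
      have "linear (fderiv f (g x))"
        using Suc.prems that assms(3) by (intro linear_frechet_derivative) auto
      then show ?thesis
        unfolding frechet_derivative_eqI[OF d[OF that]] by (rule linear_euclidean_expand)
    qed
    ultimately show ?thesis
      using Ck_on_cong[OF \<open>open S\<close>, of "\<lambda>x. fderiv (\<lambda>x. f (g x)) x v" ?D] by simp
  qed
  ultimately show ?case by simp
qed

lemma smooth_on_cong:
  "open S \<Longrightarrow> (\<And>x. x \<in> S \<Longrightarrow> f x = g x) \<Longrightarrow> smooth_on f S \<longleftrightarrow> smooth_on g S"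
  unfolding smooth_on_def using Ck_on_cong by blast

lemma smooth_on_subset: "smooth_on f S \<Longrightarrow> T \<subseteq> S \<Longrightarrow> smooth_on f T"
  unfolding smooth_on_def using Ck_on_subset by blast

lemma smooth_on_local:
  assumes "\<And>x. x \<in> S \<Longrightarrow> \<exists>T. open T \<and> x \<in> T \<and> smooth_on f T"
  shows "smooth_on f S"
  unfolding smooth_on_def using assms by (metis Ck_on_local smooth_on_def)

lemma smooth_on_differentiable: "smooth_on f S \<Longrightarrow> x \<in> S \<Longrightarrow> f differentiable at x"
  unfolding smooth_on_def by (metis Ck_on.simps(2))

lemma smooth_on_has_derivative:
  "smooth_on f S \<Longrightarrow> x \<in> S \<Longrightarrow> (f has_derivative fderiv f x) (at x)"
  using smooth_on_differentiable frechet_derivative_works by blast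

lemma smooth_on_continuous: "smooth_on f S \<Longrightarrow> continuous_on S f"
  unfolding smooth_on_def by (metis Ck_on.simps(1))

lemma smooth_on_frechet_derivative:
  "smooth_on f S \<Longrightarrow> smooth_on (\<lambda>x. fderiv f x v) S"
  unfolding smooth_on_def by (metis Ck_on.simps(2))

lemma smooth_on_const: "smooth_on (\<lambda>x. c) S"
  unfolding smooth_on_def by (simp add: Ck_on_const)

lemma smooth_on_bounded_linear:
  "open S \<Longrightarrow> bounded_linear L \<Longrightarrow> smooth_on f S \<Longrightarrow> smooth_on (\<lambda>x. L (f x)) S"
  unfolding smooth_on_def using Ck_on_bounded_linear by blast

lemma smooth_on_add:
  "open S \<Longrightarrow> smooth_on f S \<Longrightarrow> smooth_on g S \<Longrightarrow> smooth_on (\<lambda>x. f x + g x) S"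
  unfolding smooth_on_def using Ck_on_add by blast

lemma smooth_on_bilinear:
  "open S \<Longrightarrow> bounded_bilinear B \<Longrightarrow> smooth_on f S \<Longrightarrow> smooth_on g S
    \<Longrightarrow> smooth_on (\<lambda>x. B (f x) (g x)) S"
  unfolding smooth_on_def using Ck_on_bilinear by blast

lemma smooth_on_compose:
  fixes f :: "'b::euclidean_space \<Rightarrow> 'c::real_normed_vector"
    and g :: "'a::real_normed_vector \<Rightarrow> 'b"
  shows "open S \<Longrightarrow> open T \<Longrightarrow> g ` S \<subseteq> T \<Longrightarrow> smooth_on f T \<Longrightarrow> smooth_on g S
    \<Longrightarrow> smooth_on (\<lambda>x. f (g x)) S"
  unfolding smooth_on_def using Ck_on_compose by blast

lemma smooth_on_ident: "smooth_on (\<lambda>x. x) S"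
proof -
  have "Ck_on k (\<lambda>x. x) S" for k
    by (cases k) (auto simp: Ck_on_const)
  then show ?thesis by (simp add: smooth_on_def)
qed

lemma smooth_on_linear_ident: "bounded_linear L \<Longrightarrow> smooth_on L S"
  using smooth_on_bounded_linear[OF open_UNIV _ smooth_on_ident, of L] smooth_on_subset by blast

lemma smooth_on_Pair:
  assumes "open S" "smooth_on f S" "smooth_on g S"
  shows "smooth_on (\<lambda>x. (f x, g x)) S"
proof -
  have "smooth_on (\<lambda>x. (f x, 0) + (0, g x)) S"
    by (intro smooth_on_add assms(1)
        smooth_on_bounded_linear[OF assms(1) bounded_linear_Pair[OF bounded_linear_ident bounded_linear_zero] assms(2)]
        smooth_on_bounded_linear[OF assms(1) bounded_linear_Pair[OF bounded_linear_zero bounded_linear_ident] assms(3)])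
  then show ?thesis by simp
qed

lemma smooth_on_slice:
  "smooth_on (\<lambda>x. (x, c)) S" "smooth_on (\<lambda>x. (c, x)) S"
proof -
  have "smooth_on (\<lambda>x. (x, c)) UNIV" "smooth_on (\<lambda>x. (c, x)) UNIV"
    by (intro smooth_on_Pair open_UNIV smooth_on_ident smooth_on_const)+
  then show "smooth_on (\<lambda>x. (x, c)) S" "smooth_on (\<lambda>x. (c, x)) S"
    using smooth_on_subset by blast+
qed

section \<open>Symmetry of second derivatives\<close>

text \<open>The second difference \<open>f (x + h v + h w) - f (x + h v) - f (x + h w) + f x\<close> is symmetric in
  \<open>v\<close> and \<open>w\<close>, and applying the mean value theorem twice expresses it through either of the mixed
  second derivatives.\<close>

lemma second_difference_mean_value:
  fixes f :: "'a::real_normed_vector \<Rightarrow> real"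
  assumes "open S" "smooth_on f S" "0 < h"
    and S: "\<And>s t. 0 \<le> s \<Longrightarrow> s \<le> h \<Longrightarrow> 0 \<le> t \<Longrightarrow> t \<le> h \<Longrightarrow> x + s *\<^sub>R v + t *\<^sub>R w \<in> S"
  obtains s t where "0 \<le> s" "s \<le> h" "0 \<le> t" "t \<le> h"
    "f (x + h *\<^sub>R v + h *\<^sub>R w) - f (x + h *\<^sub>R v) - f (x + h *\<^sub>R w) + f x
      = h * h * fderiv (\<lambda>y. fderiv f y v) (x + s *\<^sub>R v + t *\<^sub>R w) w"
proof -
  let ?D = "\<lambda>y. fderiv f y v"
  have scal: "fderiv F y (r *\<^sub>R u) = r * fderiv F y u"
    if "smooth_on F S" "y \<in> S" for F :: "'a \<Rightarrow> real" and y r u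
    using linear_scale[OF linear_frechet_derivative[OF smooth_on_differentiable[OF that]]] by simp
  have der1: "((\<lambda>s. f (x + s *\<^sub>R v + h *\<^sub>R w) - f (x + s *\<^sub>R v)) has_real_derivative
      (?D (x + s *\<^sub>R v + h *\<^sub>R w) - ?D (x + s *\<^sub>R v))) (at s)"
    if "0 \<le> s" "s \<le> h" for s
  proof -
    have in1: "x + s *\<^sub>R v + h *\<^sub>R w \<in> S" and in2: "x + s *\<^sub>R v \<in> S"
      using S[of s h] S[of s 0] that \<open>0 < h\<close> by auto
    have "((\<lambda>s. f (x + s *\<^sub>R v + h *\<^sub>R w)) has_derivative
        (\<lambda>r. fderiv f (x + s *\<^sub>R v + h *\<^sub>R w) (r *\<^sub>R v))) (at s)"
      by (rule has_derivative_compose[where g=f and f="\<lambda>s. x + s *\<^sub>R v + h *\<^sub>R w",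
              OF _ smooth_on_has_derivative[OF assms(2) in1]])
        (auto intro!: derivative_eq_intros)
    moreover have "((\<lambda>s. f (x + s *\<^sub>R v)) has_derivative
        (\<lambda>r. fderiv f (x + s *\<^sub>R v) (r *\<^sub>R v))) (at s)"
      by (rule has_derivative_compose[where g=f and f="\<lambda>s. x + s *\<^sub>R v",
              OF _ smooth_on_has_derivative[OF assms(2) in2]])
        (auto intro!: derivative_eq_intros)
    ultimately have "((\<lambda>s. f (x + s *\<^sub>R v + h *\<^sub>R w) - f (x + s *\<^sub>R v)) has_derivative
        (\<lambda>r. r * ?D (x + s *\<^sub>R v + h *\<^sub>R w) - r * ?D (x + s *\<^sub>R v))) (at s)"
      unfolding scal[OF assms(2) in1] scal[OF assms(2) in2] by (rule has_derivative_diff)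
    moreover have "(\<lambda>r. r * ?D (x + s *\<^sub>R v + h *\<^sub>R w) - r * ?D (x + s *\<^sub>R v))
        = (*) (?D (x + s *\<^sub>R v + h *\<^sub>R w) - ?D (x + s *\<^sub>R v))"
      by (auto simp: fun_eq_iff algebra_simps)
    ultimately show ?thesis
      unfolding has_field_derivative_def by simp
  qed
  obtain s where s: "0 < s" "s < h" and eq1:
    "(f (x + h *\<^sub>R v + h *\<^sub>R w) - f (x + h *\<^sub>R v)) - (f (x + 0 *\<^sub>R v + h *\<^sub>R w) - f (x + 0 *\<^sub>R v))
      = (h - 0) * (?D (x + s *\<^sub>R v + h *\<^sub>R w) - ?D (x + s *\<^sub>R v))"
    using MVT2[OF \<open>0 < h\<close> der1] by blast
  have sm: "smooth_on ?D S" by (rule smooth_on_frechet_derivative[OF assms(2)])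
  have der2: "((\<lambda>t. ?D (x + s *\<^sub>R v + t *\<^sub>R w)) has_real_derivative
      fderiv ?D (x + s *\<^sub>R v + t *\<^sub>R w) w) (at t)" if "0 \<le> t" "t \<le> h" for t
  proof -
    have in1: "x + s *\<^sub>R v + t *\<^sub>R w \<in> S" using S[of s t] that s by auto
    have "((\<lambda>t. ?D (x + s *\<^sub>R v + t *\<^sub>R w)) has_derivative
        (\<lambda>r. fderiv ?D (x + s *\<^sub>R v + t *\<^sub>R w) (r *\<^sub>R w))) (at t)"
      by (rule has_derivative_compose[where g="?D" and f="\<lambda>t. x + s *\<^sub>R v + t *\<^sub>R w",
              OF _ smooth_on_has_derivative[OF sm in1]])
        (auto intro!: derivative_eq_intros)
    then show ?thesis
      unfolding has_field_derivative_def by (simp add: scal[OF sm in1] mult_commute_abs)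
  qed
  obtain t where t: "0 < t" "t < h" and eq2:
    "?D (x + s *\<^sub>R v + h *\<^sub>R w) - ?D (x + s *\<^sub>R v + 0 *\<^sub>R w)
      = (h - 0) * fderiv ?D (x + s *\<^sub>R v + t *\<^sub>R w) w"
    using MVT2[OF \<open>0 < h\<close> der2] by blast
  show thesis
    by (rule that[of s t]) (use s t eq1 eq2 in \<open>auto simp: algebra_simps\<close>)
qed

lemma second_derivative_symmetric_real:
  fixes f :: "'a::real_normed_vector \<Rightarrow> real"
  assumes "open S" "smooth_on f S" "x \<in> S"
  shows "fderiv (\<lambda>y. fderiv f y v) x w
    = fderiv (\<lambda>y. fderiv f y w) x v"
proof -
  define D where "D v w y = fderiv (\<lambda>y. fderiv f y v) y w" for v w y
  have cont: "isCont (D v w) x" for v w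
    using smooth_on_continuous[OF smooth_on_frechet_derivative[OF smooth_on_frechet_derivative[OF assms(2)]]]
      assms(1,3) unfolding D_def by (auto simp: continuous_on_eq_continuous_at)
  obtain r where r: "r > 0" "ball x r \<subseteq> S" using assms openE by blast
  have close: "\<exists>d>0. \<forall>h s t. 0 < h \<and> h < d \<and> 0 \<le> s \<and> s \<le> h \<and> 0 \<le> t \<and> t \<le> h \<longrightarrow>
      x + s *\<^sub>R v + t *\<^sub>R w \<in> ball x e" if "e > 0" for e v w
  proof (intro exI conjI allI impI)
    show "0 < e / (norm v + norm w + 1)"
      using that by (simp add: add_nonneg_pos)
    fix h s t :: real
    assume *: "0 < h \<and> h < e / (norm v + norm w + 1) \<and> 0 \<le> s \<and> s \<le> h \<and> 0 \<le> t \<and> t \<le> h"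
    have "norm (s *\<^sub>R v + t *\<^sub>R w) \<le> s * norm v + t * norm w"
      using * norm_triangle_ineq[of "s *\<^sub>R v" "t *\<^sub>R w"] by simp
    also have "\<dots> \<le> h * (norm v + norm w + 1)"
      using * by (simp add: distrib_left add_mono mult_right_mono add_increasing2)
    also have "\<dots> < e"
      using * by (simp add: pos_less_divide_eq add_nonneg_pos)
    finally show "x + s *\<^sub>R v + t *\<^sub>R w \<in> ball x e"
      using norm_minus_cancel[of "s *\<^sub>R v + t *\<^sub>R w"]
      by (simp add: dist_norm add.assoc del: norm_minus_cancel)
  qed
  have "D v w x = D w v x"
  proof (rule ccontr)
    assume ne: "D v w x \<noteq> D w v x"
    \<comment> \<open>Half of the gap: on a small ball both mixed derivatives stay within this
      distance of their values at \<open>x\<close>, while the second difference forces a value of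
      one to equal a value of the other inside that ball.\<close>
    define \<epsilon> where "\<epsilon> = \<bar>D v w x - D w v x\<bar> / 2"
    have "\<epsilon> > 0" using ne by (simp add: \<epsilon>_def)
    then obtain e1 e2 where e: "e1 > 0" "e2 > 0"
      "\<And>y. y \<in> ball x e1 \<Longrightarrow> \<bar>D v w y - D v w x\<bar> < \<epsilon>"
      "\<And>y. y \<in> ball x e2 \<Longrightarrow> \<bar>D w v y - D w v x\<bar> < \<epsilon>"
      using cont unfolding continuous_at_eps_delta
      by (auto simp: dist_real_def dist_commute) metis
    define e0 where "e0 = min r (min e1 e2)"
    have "e0 > 0" using e r by (simp add: e0_def)
    obtain d where d: "d > 0" "\<And>h s t. 0 < h \<Longrightarrow> h < d \<Longrightarrow> 0 \<le> s \<Longrightarrow> s \<le> h \<Longrightarrow> 0 \<le> t \<Longrightarrow> t \<le> h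
        \<Longrightarrow> x + s *\<^sub>R v + t *\<^sub>R w \<in> ball x e0"
      using close[OF \<open>e0 > 0\<close>, of v w] by blast
    define h where "h = d / 2"
    have h: "0 < h" "h < d" using d by (auto simp: h_def)
    have in1: "x + s *\<^sub>R v + t *\<^sub>R w \<in> ball x e0" "x + t *\<^sub>R w + s *\<^sub>R v \<in> ball x e0"
      if "0 \<le> s" "s \<le> h" "0 \<le> t" "t \<le> h" for s t
      using d(2)[OF h that] by (simp_all add: algebra_simps)
    have sub: "ball x e0 \<subseteq> S" "ball x e0 \<subseteq> ball x e1" "ball x e0 \<subseteq> ball x e2"
      using r by (auto simp: e0_def)
    obtain s t where st: "0 \<le> s" "s \<le> h" "0 \<le> t" "t \<le> h"
      "f (x + h *\<^sub>R v + h *\<^sub>R w) - f (x + h *\<^sub>R v) - f (x + h *\<^sub>R w) + f x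
        = h * h * D v w (x + s *\<^sub>R v + t *\<^sub>R w)"
      unfolding D_def
      by (rule second_difference_mean_value[OF assms(1,2) h(1), of x v w]) (use in1 sub in blast)+
    obtain s' t' where st': "0 \<le> s'" "s' \<le> h" "0 \<le> t'" "t' \<le> h"
      "f (x + h *\<^sub>R w + h *\<^sub>R v) - f (x + h *\<^sub>R w) - f (x + h *\<^sub>R v) + f x
        = h * h * D w v (x + s' *\<^sub>R w + t' *\<^sub>R v)"
      unfolding D_def
      by (rule second_difference_mean_value[OF assms(1,2) h(1), of x w v]) (use in1 sub in blast)+
    have "f (x + h *\<^sub>R w + h *\<^sub>R v) = f (x + h *\<^sub>R v + h *\<^sub>R w)" by (simp add: algebra_simps)
    then have "h * h * D v w (x + s *\<^sub>R v + t *\<^sub>R w) = h * h * D w v (x + s' *\<^sub>R w + t' *\<^sub>R v)"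
      using st(5) st'(5) by linarith
    then have "D v w (x + s *\<^sub>R v + t *\<^sub>R w) = D w v (x + s' *\<^sub>R w + t' *\<^sub>R v)"
      using h by simp
    moreover have "\<bar>D v w (x + s *\<^sub>R v + t *\<^sub>R w) - D v w x\<bar> < \<epsilon>"
      using e(3) in1(1)[OF st(1-4)] sub by blast
    moreover have "\<bar>D w v (x + s' *\<^sub>R w + t' *\<^sub>R v) - D w v x\<bar> < \<epsilon>"
      using e(4) in1(2)[OF st'(3,4,1,2)] sub by blast
    ultimately have "\<bar>D v w x - D w v x\<bar> < \<epsilon> + \<epsilon>" by linarith
    then show False unfolding \<epsilon>_def by simp
  qed
  then show ?thesis by (simp add: D_def)
qed

lemma frechet_derivative_bounded_linear:
  assumes "bounded_linear L" "f differentiable at x"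
  shows "fderiv (\<lambda>x. L (f x)) x v = L (fderiv f x v)"
  using frechet_derivative_eqI[OF bounded_linear.has_derivative[OF assms(1)]]
    assms(2) frechet_derivative_works by metis

text \<open>The mean value theorem behind the real case has no vector valued form, so the components
  along \<open>Basis\<close> are compared.\<close>

lemma second_derivative_symmetric:
  fixes f :: "'a::real_normed_vector \<Rightarrow> 'b::euclidean_space"
  assumes "open S" "smooth_on f S" "x \<in> S"
  shows "fderiv (\<lambda>y. fderiv f y v) x w
    = fderiv (\<lambda>y. fderiv f y w) x v"
proof (rule euclidean_eqI)
  fix b :: 'b
  let ?L = "\<lambda>z::'b. z \<bullet> b"
  have L: "bounded_linear ?L" by (rule bounded_linear_inner_left)
  have *: "fderiv (\<lambda>y. fderiv f y v) x w \<bullet> b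
      = fderiv (\<lambda>y. fderiv (\<lambda>y. f y \<bullet> b) y v) x w" for v w
  proof -
    have "fderiv (\<lambda>y. fderiv f y v) x w \<bullet> b
        = fderiv (\<lambda>y. fderiv f y v \<bullet> b) x w"
      using frechet_derivative_bounded_linear[OF L] smooth_on_differentiable
        smooth_on_frechet_derivative[OF assms(2)] assms(3) by metis
    also have "\<dots> = fderiv (\<lambda>y. fderiv (\<lambda>y. f y \<bullet> b) y v) x w"
    proof -
      have "fderiv f y v \<bullet> b = fderiv (\<lambda>y. f y \<bullet> b) y v" if "y \<in> S" for y
        using frechet_derivative_bounded_linear[OF L smooth_on_differentiable[OF assms(2) that]] by simp
      moreover have "(\<lambda>y. fderiv f y v \<bullet> b) differentiable at x"
        using smooth_on_differentiable[OF smooth_on_bounded_linear[OF assms(1) L smooth_on_frechet_derivative[OF assms(2)]] assms(3)] .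
      ultimately show ?thesis
        using frechet_derivative_transform_within_open[OF _ assms(1,3),
            of "\<lambda>y. fderiv f y v \<bullet> b"
              "\<lambda>y. fderiv (\<lambda>y. f y \<bullet> b) y v"] by simp
    qed
    finally show ?thesis .
  qed
  show "fderiv (\<lambda>y. fderiv f y v) x w \<bullet> b
      = fderiv (\<lambda>y. fderiv f y w) x v \<bullet> b"
    unfolding *
    by (rule second_derivative_symmetric_real[OF assms(1) smooth_on_bounded_linear[OF assms(1) L assms(2)] assms(3)])
qed

section \<open>Calculus on Lie groups\<close>

lemma frechet_derivative_along_field:
  fixes F :: "'a::euclidean_space \<Rightarrow> 'b::real_normed_vector"
  assumes "open S" "smooth_on F S" "x \<in> S" "(W has_derivative W') (at x)"
  shows "((\<lambda>p. fderiv F p (W p)) has_derivative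
      (\<lambda>v. fderiv F x (W' v)
        + fderiv (\<lambda>p. fderiv F p (W x)) x v)) (at x)"
proof -
  let ?D = "\<lambda>b p. fderiv F p b"
  have exp: "?D w p = (\<Sum>b\<in>Basis. (w \<bullet> b) *\<^sub>R ?D b p)" if "p \<in> S" for p w
    by (rule linear_euclidean_expand)
      (rule linear_frechet_derivative[OF smooth_on_differentiable[OF assms(2) that]])
  have dD: "(?D b has_derivative fderiv (?D b) x) (at x)" for b
    by (rule smooth_on_has_derivative[OF smooth_on_frechet_derivative[OF assms(2)] assms(3)])
  have DW: "((\<lambda>p. \<Sum>b\<in>Basis. (W p \<bullet> b) *\<^sub>R ?D b p) has_derivative
      (\<lambda>v. \<Sum>b\<in>Basis. (W x \<bullet> b) *\<^sub>R fderiv (?D b) x v + (W' v \<bullet> b) *\<^sub>R ?D b x)) (at x)"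
    using assms(4) by (auto intro!: derivative_eq_intros dD)
  have "((\<lambda>p. \<Sum>b\<in>Basis. (W x \<bullet> b) *\<^sub>R ?D b p) has_derivative
      (\<lambda>v. \<Sum>b\<in>Basis. (W x \<bullet> b) *\<^sub>R fderiv (?D b) x v)) (at x)"
    by (auto intro!: derivative_eq_intros dD)
  then have "(?D (W x) has_derivative
      (\<lambda>v. \<Sum>b\<in>Basis. (W x \<bullet> b) *\<^sub>R fderiv (?D b) x v)) (at x)"
    by (rule has_derivative_transform_within_open[OF _ assms(1,3)]) (simp add: exp[symmetric])
  then have "fderiv (?D (W x)) x
      = (\<lambda>v. \<Sum>b\<in>Basis. (W x \<bullet> b) *\<^sub>R fderiv (?D b) x v)"
    by (rule frechet_derivative_eqI)
  moreover have "((\<lambda>p. ?D (W p) p) has_derivative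
      (\<lambda>v. \<Sum>b\<in>Basis. (W x \<bullet> b) *\<^sub>R fderiv (?D b) x v + (W' v \<bullet> b) *\<^sub>R ?D b x)) (at x)"
    by (rule has_derivative_transform_within_open[OF DW assms(1,3)]) (simp add: exp[symmetric])
  ultimately show ?thesis
    by (simp add: sum.distrib exp[OF assms(3), of "W' _", symmetric] add.commute)
qed

section \<open>Smooth maps into and out of a Lie group\<close>

locale lie =
  fixes G :: "('g::{t2_space,second_countable_topology}, 'e::euclidean_space, 'z) lie_group_scheme"
    (structure)
  assumes lie: "is_lie_group G"
begin

sublocale group G
  using lie by (simp add: is_lie_group_def)

lemma carrier_UNIV [simp]: "carrier G = UNIV"
  using lie by (simp add: is_lie_group_def)

lemma cancel [simp]: "inv x \<otimes> (x \<otimes> y) = y" "x \<otimes> (inv x \<otimes> y) = y"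
  by (simp_all add: m_assoc[symmetric])

lemma chartD:
  assumes "(U, \<phi>) \<in> atlas G"
  shows "open U" "open (\<phi> ` U)" "homeomorphism U (\<phi> ` U) \<phi> (inv_into U \<phi>)" "inj_on \<phi> U"
    "continuous_on U \<phi>" "continuous_on (\<phi> ` U) (inv_into U \<phi>)"
proof -
  show *: "open U" "open (\<phi> ` U)" "homeomorphism U (\<phi> ` U) \<phi> (inv_into U \<phi>)"
    using lie assms by (auto simp: is_lie_group_def smooth_atlas_def)
  show "inj_on \<phi> U" "continuous_on U \<phi>" "continuous_on (\<phi> ` U) (inv_into U \<phi>)"
    using *(3) unfolding homeomorphism_def by (auto intro: inj_on_inverseI)
qed

lemma chart_inv:
  assumes "(U, \<phi>) \<in> atlas G"
  shows "x \<in> U \<Longrightarrow> inv_into U \<phi> (\<phi> x) = x" "p \<in> \<phi> ` U \<Longrightarrow> \<phi> (inv_into U \<phi> p) = p"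
    "p \<in> \<phi> ` U \<Longrightarrow> inv_into U \<phi> p \<in> U"
  using chartD[OF assms] by (auto intro: inv_into_into f_inv_into_f)

lemma chart_image_open:
  assumes "(U, \<phi>) \<in> atlas G" "open \<Omega>"
  shows "open (\<phi> ` (U \<inter> \<Omega>))"
proof -
  have "openin (top_of_set (\<phi> ` U)) (\<phi> ` (U \<inter> \<Omega>))"
    by (rule homeomorphism_imp_open_map[OF chartD(3)[OF assms(1)]]) (use assms(2) in auto)
  then show ?thesis
    using chartD(2)[OF assms(1)] openin_open_trans by blast
qed

lemma chart_at: obtains U \<phi> where "(U, \<phi>) \<in> atlas G" "x \<in> U"
proof -
  have "x \<in> (\<Union>(U, \<phi>)\<in>atlas G. U)"
    using lie by (simp add: is_lie_group_def smooth_atlas_def)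
  then show ?thesis using that by blast
qed

lemma transition_smooth:
  "(U, \<phi>) \<in> atlas G \<Longrightarrow> (V, \<psi>) \<in> atlas G \<Longrightarrow>
    smooth_on (\<lambda>p. \<psi> (inv_into U \<phi> p)) (\<phi> ` (U \<inter> V))"
  using lie unfolding is_lie_group_def smooth_atlas_def by blast

text \<open>A smooth map from an open set of a Euclidean space into the group. Working with
  parametrised families of group elements avoids a theory of maps between manifolds: plots are
  closed under multiplication and inversion, and composing one with a smooth function lands in
  ordinary calculus.\<close>

definition plot :: "('p::euclidean_space \<Rightarrow> 'g) \<Rightarrow> 'p set \<Rightarrow> bool" where
  "plot a S \<longleftrightarrow> open S \<and> continuous_on S a \<and>
     (\<forall>(U, \<phi>)\<in>atlas G. smooth_on (\<lambda>p. \<phi> (a p)) (S \<inter> a -` U))"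

lemma plotD:
  assumes "plot a S"
  shows "open S" "continuous_on S a"
    "(U, \<phi>) \<in> atlas G \<Longrightarrow> smooth_on (\<lambda>p. \<phi> (a p)) (S \<inter> a -` U)"
  using assms by (auto simp: plot_def)

lemma plot_preimage_open: "plot a S \<Longrightarrow> open U \<Longrightarrow> open (S \<inter> a -` U)"
  by (rule continuous_open_preimage[OF plotD(2) plotD(1)])

lemma plot_subset:
  assumes "plot a S" "open T" "T \<subseteq> S"
  shows "plot a T"
  unfolding plot_def
proof (intro conjI assms(2))
  show "continuous_on T a" using plotD(2)[OF assms(1)] assms(3) continuous_on_subset by blast
  show "\<forall>(U, \<phi>)\<in>atlas G. smooth_on (\<lambda>p. \<phi> (a p)) (T \<inter> a -` U)"
  proof clarify
    fix U \<phi> assume "(U, \<phi>) \<in> atlas G"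
    from plotD(3)[OF assms(1) this] show "smooth_on (\<lambda>p. \<phi> (a p)) (T \<inter> a -` U)"
      by (rule smooth_on_subset) (use assms(3) in auto)
  qed
qed

lemma plot_const: "open S \<Longrightarrow> plot (\<lambda>p. x) S"
  by (auto simp: plot_def smooth_on_const)

lemma plot_chart:
  assumes "(U, \<phi>) \<in> atlas G"
  shows "plot (inv_into U \<phi>) (\<phi> ` U)"
  unfolding plot_def
proof (intro conjI)
  show "open (\<phi> ` U)" "continuous_on (\<phi> ` U) (inv_into U \<phi>)"
    using chartD[OF assms] by auto
  have "\<phi> ` U \<inter> inv_into U \<phi> -` V = \<phi> ` (U \<inter> V)" for V
    using chart_inv[OF assms] by (auto simp: image_iff)
  then show "\<forall>(V, \<psi>)\<in>atlas G. smooth_on (\<lambda>p. \<psi> (inv_into U \<phi> p)) (\<phi> ` U \<inter> inv_into U \<phi> -` V)"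
    using transition_smooth[OF assms] by auto
qed

lemma plot_reparam:
  fixes h :: "'q::euclidean_space \<Rightarrow> 'p::euclidean_space"
  assumes "plot a S" "open T" "smooth_on h T" "h ` T \<subseteq> S"
  shows "plot (\<lambda>x. a (h x)) T"
  unfolding plot_def
proof (intro conjI assms(2))
  show c: "continuous_on T (\<lambda>x. a (h x))"
    using continuous_on_compose2[OF plotD(2)[OF assms(1)] smooth_on_continuous[OF assms(3)] assms(4)] .
  show "\<forall>(U, \<phi>)\<in>atlas G. smooth_on (\<lambda>p. \<phi> (a (h p))) (T \<inter> (\<lambda>x. a (h x)) -` U)"
  proof clarify
    fix U \<phi> assume U: "(U, \<phi>) \<in> atlas G"
    have "open (T \<inter> (\<lambda>x. a (h x)) -` U)"
      using continuous_open_preimage[OF c assms(2) chartD(1)[OF U]] .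
    then show "smooth_on (\<lambda>p. \<phi> (a (h p))) (T \<inter> (\<lambda>x. a (h x)) -` U)"
      by (rule smooth_on_compose[OF _ plot_preimage_open[OF assms(1) chartD(1)[OF U]] _ plotD(3)[OF assms(1) U]])
        (use assms(3,4) in \<open>auto intro: smooth_on_subset\<close>)
  qed
qed

text \<open>Smoothness of the group law is given for triples of charts only, so the claim is
  localised to a neighbourhood \<open>T\<close> on which both factors and the product stay in one
  chart each.\<close>

lemma plot_mult:
  assumes "plot a S" "plot b S"
  shows "plot (\<lambda>p. a p \<otimes> b p) S"
  unfolding plot_def
proof (intro conjI)
  have cm: "continuous_on UNIV (\<lambda>(x, y). x \<otimes> y)"
    using lie by (simp add: is_lie_group_def)
  show S: "open S" using plotD(1)[OF assms(1)] .
  show c: "continuous_on S (\<lambda>p. a p \<otimes> b p)"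
    using continuous_on_compose2[OF cm continuous_on_Pair[OF plotD(2)[OF assms(1)] plotD(2)[OF assms(2)]]]
    by simp
  show "\<forall>(W, \<eta>)\<in>atlas G. smooth_on (\<lambda>p. \<eta> (a p \<otimes> b p)) (S \<inter> (\<lambda>p. a p \<otimes> b p) -` W)"
  proof clarify
    fix W \<eta> assume W: "(W, \<eta>) \<in> atlas G"
    show "smooth_on (\<lambda>p. \<eta> (a p \<otimes> b p)) (S \<inter> (\<lambda>p. a p \<otimes> b p) -` W)"
    proof (rule smooth_on_local)
      fix x assume x: "x \<in> S \<inter> (\<lambda>p. a p \<otimes> b p) -` W"
      obtain U \<phi> where U: "(U, \<phi>) \<in> atlas G" "a x \<in> U" by (rule chart_at)
      obtain V \<psi> where V: "(V, \<psi>) \<in> atlas G" "b x \<in> V" by (rule chart_at)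
      define T where "T = (S \<inter> a -` U) \<inter> (S \<inter> b -` V) \<inter> (S \<inter> (\<lambda>p. a p \<otimes> b p) -` W)"
      have T: "open T"
        unfolding T_def
        by (intro open_Int plot_preimage_open[OF assms(1)] plot_preimage_open[OF assms(2)]
            chartD(1)[OF U(1)] chartD(1)[OF V(1)] continuous_open_preimage[OF c S chartD(1)[OF W]])
      let ?D = "{(\<phi> x, \<psi> y) |x y. x \<in> U \<and> y \<in> V \<and> x \<otimes> y \<in> W}"
      let ?m = "\<lambda>z. inv_into U \<phi> (fst z) \<otimes> inv_into V \<psi> (snd z)"
      have sm: "smooth_on (\<lambda>(p, q). \<eta> (inv_into U \<phi> p \<otimes> inv_into V \<psi> q)) ?D"
        using lie U(1) V(1) W unfolding is_lie_group_def by fast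
      \<comment> \<open>Continuity of the product in coordinates serves to see that
        \<open>?D\<close> is open, as the chain rule requires.\<close>
      have "continuous_on (\<phi> ` U \<times> \<psi> ` V) ?m"
        by (rule continuous_on_compose2[OF cm, where f="\<lambda>z. (inv_into U \<phi> (fst z), inv_into V \<psi> (snd z))", simplified])
          (intro continuous_intros continuous_on_compose2[OF chartD(6)[OF U(1)]]
            continuous_on_compose2[OF chartD(6)[OF V(1)]]; auto)
      then have "open ((\<phi> ` U \<times> \<psi> ` V) \<inter> ?m -` W)"
        by (rule continuous_open_preimage[OF _ open_Times[OF chartD(2)[OF U(1)] chartD(2)[OF V(1)]]
              chartD(1)[OF W]])
      moreover have "(\<phi> ` U \<times> \<psi> ` V) \<inter> ?m -` W = ?D"
      proof (intro equalityI subsetI)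
        fix z assume z: "z \<in> (\<phi> ` U \<times> \<psi> ` V) \<inter> ?m -` W"
        then have "z = (\<phi> (inv_into U \<phi> (fst z)), \<psi> (inv_into V \<psi> (snd z)))"
          using chart_inv(2)[OF U(1)] chart_inv(2)[OF V(1)] by (auto simp: mem_Times_iff prod_eq_iff)
        moreover have "inv_into U \<phi> (fst z) \<in> U" "inv_into V \<psi> (snd z) \<in> V"
          using z chart_inv(3)[OF U(1)] chart_inv(3)[OF V(1)] by (auto simp: mem_Times_iff)
        ultimately show "z \<in> ?D" using z by blast
      next
        fix z assume "z \<in> ?D"
        then show "z \<in> (\<phi> ` U \<times> \<psi> ` V) \<inter> ?m -` W"
          by (auto simp: chart_inv(1)[OF U(1)] chart_inv(1)[OF V(1)])
      qed
      ultimately have D: "open ?D" by simp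
      have "smooth_on (\<lambda>p. (\<lambda>(p, q). \<eta> (inv_into U \<phi> p \<otimes> inv_into V \<psi> q)) (\<phi> (a p), \<psi> (b p))) T"
      proof (rule smooth_on_compose[OF T D _ sm])
        show "(\<lambda>p. (\<phi> (a p), \<psi> (b p))) ` T \<subseteq> ?D" by (auto simp: T_def)
        show "smooth_on (\<lambda>p. (\<phi> (a p), \<psi> (b p))) T"
          by (intro smooth_on_Pair T smooth_on_subset[OF plotD(3)[OF assms(1) U(1)]]
              smooth_on_subset[OF plotD(3)[OF assms(2) V(1)]]) (auto simp: T_def)
      qed
      then have "smooth_on (\<lambda>p. \<eta> (a p \<otimes> b p)) T"
        by (rule iffD1[OF smooth_on_cong[OF T], rotated])
          (auto simp: T_def chart_inv[OF U(1)] chart_inv[OF V(1)])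
      moreover have "x \<in> T" using x U(2) V(2) by (auto simp: T_def)
      ultimately show "\<exists>T. open T \<and> x \<in> T \<and> smooth_on (\<lambda>p. \<eta> (a p \<otimes> b p)) T"
        using T by blast
    qed
  qed
qed

lemma plot_inv:
  assumes "plot a S"
  shows "plot (\<lambda>p. inv (a p)) S"
  unfolding plot_def
proof (intro conjI)
  have ci: "continuous_on UNIV (\<lambda>x. inv x)"
    using lie by (simp add: is_lie_group_def)
  show S: "open S" using plotD(1)[OF assms(1)] .
  show c: "continuous_on S (\<lambda>p. inv (a p))"
    using continuous_on_compose2[OF ci plotD(2)[OF assms(1)]] by simp
  show "\<forall>(W, \<eta>)\<in>atlas G. smooth_on (\<lambda>p. \<eta> (inv (a p))) (S \<inter> (\<lambda>p. inv (a p)) -` W)"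
  proof clarify
    fix W \<eta> assume W: "(W, \<eta>) \<in> atlas G"
    show "smooth_on (\<lambda>p. \<eta> (inv (a p))) (S \<inter> (\<lambda>p. inv (a p)) -` W)"
    proof (rule smooth_on_local)
      fix x assume x: "x \<in> S \<inter> (\<lambda>p. inv (a p)) -` W"
      obtain U \<phi> where U: "(U, \<phi>) \<in> atlas G" "a x \<in> U" by (rule chart_at)
      define T where "T = (S \<inter> a -` U) \<inter> (S \<inter> (\<lambda>p. inv (a p)) -` W)"
      have T: "open T"
        unfolding T_def
        by (intro open_Int plot_preimage_open[OF assms(1)]
            chartD(1)[OF U(1)] continuous_open_preimage[OF c S chartD(1)[OF W]])
      let ?D = "{\<phi> x |x. x \<in> U \<and> inv x \<in> W}"
      let ?m = "\<lambda>z. inv (inv_into U \<phi> z)"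
      have sm: "smooth_on (\<lambda>p. \<eta> (?m p)) ?D"
        using lie U(1) W unfolding is_lie_group_def by fast
      have "continuous_on (\<phi> ` U) ?m"
        by (rule continuous_on_compose2[OF ci chartD(6)[OF U(1)]]) simp
      then have "open ((\<phi> ` U) \<inter> ?m -` W)"
        by (rule continuous_open_preimage[OF _ chartD(2)[OF U(1)] chartD(1)[OF W]])
      moreover have "(\<phi> ` U) \<inter> ?m -` W = ?D"
      proof (intro equalityI subsetI)
        fix z assume z: "z \<in> (\<phi> ` U) \<inter> ?m -` W"
        then have "z = \<phi> (inv_into U \<phi> z)" "inv_into U \<phi> z \<in> U"
          using chart_inv(2,3)[OF U(1)] by auto
        then show "z \<in> ?D" using z by blast
      qed (auto simp: chart_inv(1)[OF U(1)])
      ultimately have D: "open ?D" by simp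
      have "smooth_on (\<lambda>p. \<eta> (?m (\<phi> (a p)))) T"
      proof (rule smooth_on_compose[OF T D _ sm])
        show "(\<lambda>p. \<phi> (a p)) ` T \<subseteq> ?D" by (auto simp: T_def)
        show "smooth_on (\<lambda>p. \<phi> (a p)) T"
          by (intro smooth_on_subset[OF plotD(3)[OF assms(1) U(1)]]) (auto simp: T_def)
      qed
      then have "smooth_on (\<lambda>p. \<eta> (inv (a p))) T"
        by (rule iffD1[OF smooth_on_cong[OF T], rotated])
          (auto simp: T_def chart_inv[OF U(1)])
      moreover have "x \<in> T" using x U(2) by (auto simp: T_def)
      ultimately show "\<exists>T. open T \<and> x \<in> T \<and> smooth_on (\<lambda>p. \<eta> (inv (a p))) T"
        using T by blast
    qed
  qed
qed

text \<open>A version of \<open>smooth_map\<close> on an open part of the group, needed because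
  \<open>id_coord\<close> and its left invariant derivatives are smooth on the chart domain
  only.\<close>

definition lsmooth :: "('g \<Rightarrow> 'b::real_normed_vector) \<Rightarrow> 'g set \<Rightarrow> bool" where
  "lsmooth f \<Omega> \<longleftrightarrow> open \<Omega> \<and>
     (\<forall>(U, \<phi>)\<in>atlas G. smooth_on (\<lambda>p. f (inv_into U \<phi> p)) (\<phi> ` (U \<inter> \<Omega>)))"

lemma lsmoothD:
  assumes "lsmooth f \<Omega>"
  shows "open \<Omega>" "(U, \<phi>) \<in> atlas G \<Longrightarrow> smooth_on (\<lambda>p. f (inv_into U \<phi> p)) (\<phi> ` (U \<inter> \<Omega>))"
  using assms by (auto simp: lsmooth_def)

lemma lsmoothI:
  assumes "open \<Omega>"
    "\<And>U \<phi>. (U, \<phi>) \<in> atlas G \<Longrightarrow> smooth_on (\<lambda>p. f (inv_into U \<phi> p)) (\<phi> ` (U \<inter> \<Omega>))"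
  shows "lsmooth f \<Omega>"
  using assms by (auto simp: lsmooth_def)

lemma smooth_map_iff_lsmooth: "smooth_map G f \<longleftrightarrow> lsmooth f UNIV"
  by (simp add: smooth_map_def lsmooth_def)

lemma plot_compose:
  assumes "plot a S" "lsmooth f \<Omega>" "a ` S \<subseteq> \<Omega>"
  shows "smooth_on (\<lambda>p. f (a p)) S"
proof (rule smooth_on_local)
  fix x assume x: "x \<in> S"
  obtain U \<phi> where U: "(U, \<phi>) \<in> atlas G" "a x \<in> U" by (rule chart_at)
  let ?T = "S \<inter> a -` U"
  have T: "open ?T" by (rule plot_preimage_open[OF assms(1) chartD(1)[OF U(1)]])
  have "smooth_on (\<lambda>p. f (inv_into U \<phi> (\<phi> (a p)))) ?T"
    by (rule smooth_on_compose[OF T chart_image_open[OF U(1) lsmoothD(1)[OF assms(2)]] _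
          lsmoothD(2)[OF assms(2) U(1)] plotD(3)[OF assms(1) U(1)]]) (use assms(3) in auto)
  then have "smooth_on (\<lambda>p. f (a p)) ?T"
    by (rule iffD1[OF smooth_on_cong[OF T], rotated]) (auto simp: chart_inv[OF U(1)])
  then show "\<exists>T. open T \<and> x \<in> T \<and> smooth_on (\<lambda>p. f (a p)) T"
    using T x U(2) by auto
qed

lemma lsmooth_add: "lsmooth f \<Omega> \<Longrightarrow> lsmooth f' \<Omega> \<Longrightarrow> lsmooth (\<lambda>x. f x + f' x) \<Omega>"
  by (rule lsmoothI[OF lsmoothD(1)], assumption)
    (rule smooth_on_add[OF chart_image_open[OF _ lsmoothD(1)] lsmoothD(2) lsmoothD(2)])

lemma lsmooth_bounded_linear: "bounded_linear L \<Longrightarrow> lsmooth f \<Omega> \<Longrightarrow> lsmooth (\<lambda>x. L (f x)) \<Omega>"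
  by (rule lsmoothI[OF lsmoothD(1)], assumption)
    (rule smooth_on_bounded_linear[OF chart_image_open[OF _ lsmoothD(1)] _ lsmoothD(2)])

lemma lsmooth_bilinear:
  "bounded_bilinear B \<Longrightarrow> lsmooth f \<Omega> \<Longrightarrow> lsmooth f' \<Omega> \<Longrightarrow> lsmooth (\<lambda>x. B (f x) (f' x)) \<Omega>"
  by (rule lsmoothI[OF lsmoothD(1)], assumption)
    (rule smooth_on_bilinear[OF chart_image_open[OF _ lsmoothD(1)] _ lsmoothD(2) lsmoothD(2)])

lemma lsmooth_const: "open \<Omega> \<Longrightarrow> lsmooth (\<lambda>x. c) \<Omega>"
  by (rule lsmoothI) (simp_all add: smooth_on_const)

lemma lsmooth_sum:
  "finite I \<Longrightarrow> open \<Omega> \<Longrightarrow> (\<And>i. i \<in> I \<Longrightarrow> lsmooth (f i) \<Omega>) \<Longrightarrow> lsmooth (\<lambda>x. \<Sum>i\<in>I. f i x) \<Omega>"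
  by (induction I rule: finite_induct) (auto intro: lsmooth_add lsmooth_const)

lemma lsmooth_diff: "lsmooth f \<Omega> \<Longrightarrow> lsmooth f' \<Omega> \<Longrightarrow> lsmooth (\<lambda>x. f x - f' x) \<Omega>"
  using lsmooth_add[of f \<Omega> "\<lambda>x. - f' x"]
    lsmooth_bounded_linear[OF bounded_linear_minus[OF bounded_linear_ident], of f' \<Omega>] by simp

section \<open>The chart at the identity and left invariant derivatives\<close>

abbreviation "U0 \<equiv> id_dom G"
abbreviation "\<phi>0 \<equiv> id_coord G"
abbreviation "c0 \<equiv> \<phi>0 \<one>"
abbreviation "V0 \<equiv> \<phi>0 ` U0"
abbreviation "\<iota> \<equiv> inv_into U0 \<phi>0"

lemma id_chart: "(U0, \<phi>0) \<in> atlas G" "\<one> \<in> U0"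
proof -
  obtain U \<phi> where U: "(U, \<phi>) \<in> atlas G" "\<one> \<in> U" by (rule chart_at)
  then have "id_chart G \<in> atlas G \<and> \<one> \<in> fst (id_chart G)"
    unfolding id_chart_def by (intro someI[of "\<lambda>c. c \<in> atlas G \<and> \<one> \<in> fst c" "(U, \<phi>)"]) auto
  then show "(U0, \<phi>0) \<in> atlas G" "\<one> \<in> U0" by simp_all
qed

lemma open_U0: "open U0" and open_V0: "open V0" and c0_V0: "c0 \<in> V0" and plot_\<iota>: "plot \<iota> V0"
  using chartD[OF id_chart(1)] id_chart plot_chart[OF id_chart(1)] by auto

lemma \<iota>_c0 [simp]: "\<iota> c0 = \<one>"
  using chart_inv(1)[OF id_chart(1)] id_chart(2) .

lemma \<iota>_\<phi>0: "x \<in> U0 \<Longrightarrow> \<iota> (\<phi>0 x) = x" and \<phi>0_\<iota>: "p \<in> V0 \<Longrightarrow> \<phi>0 (\<iota> p) = p"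
  and \<iota>_in: "p \<in> V0 \<Longrightarrow> \<iota> p \<in> U0"
  using chart_inv[OF id_chart(1)] by auto

lemma lsmooth_\<phi>0: "lsmooth \<phi>0 U0"
  by (rule lsmoothI[OF open_U0]) (rule transition_smooth[OF _ id_chart(1)])

lemma translate_smooth:
  assumes "lsmooth f \<Omega>" "g \<in> \<Omega>"
  obtains S where "open S" "c0 \<in> S" "S \<subseteq> V0" "\<And>p. p \<in> S \<Longrightarrow> g \<otimes> \<iota> p \<in> \<Omega>"
    "smooth_on (\<lambda>p. f (g \<otimes> \<iota> p)) S"
proof -
  have pl: "plot (\<lambda>p. g \<otimes> \<iota> p) V0"
    by (rule plot_mult[OF plot_const[OF open_V0] plot_\<iota>])
  let ?S = "V0 \<inter> (\<lambda>p. g \<otimes> \<iota> p) -` \<Omega>"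
  have S: "open ?S" by (rule plot_preimage_open[OF pl lsmoothD(1)[OF assms(1)]])
  show thesis
  proof (rule that[OF S])
    show "c0 \<in> ?S" using c0_V0 assms(2) by simp
    show "smooth_on (\<lambda>p. f (g \<otimes> \<iota> p)) ?S"
      by (rule plot_compose[OF plot_subset[OF pl S] assms(1)]) auto
  qed auto
qed

lemma lderiv_has_derivative:
  assumes "lsmooth f \<Omega>" "g \<in> \<Omega>"
  shows "((\<lambda>p. f (g \<otimes> \<iota> p)) has_derivative (\<lambda>X. lderiv G X f g)) (at c0)"
proof -
  obtain S where S: "open S" "c0 \<in> S" "smooth_on (\<lambda>p. f (g \<otimes> \<iota> p)) S"
    by (rule translate_smooth[OF assms]) blast
  then show ?thesis
    unfolding lderiv_def using smooth_on_has_derivative by blast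
qed

lemma lderiv_eqI:
  "((\<lambda>p. f (g \<otimes> \<iota> p)) has_derivative f') (at c0) \<Longrightarrow> lderiv G X f g = f' X"
  unfolding lderiv_def by (simp add: frechet_derivative_eqI)

lemma lderiv_linear: "lsmooth f \<Omega> \<Longrightarrow> g \<in> \<Omega> \<Longrightarrow> linear (\<lambda>X. lderiv G X f g)"
  using lderiv_has_derivative has_derivative_linear by blast

lemma lderiv_cong:
  assumes "lsmooth f \<Omega>" "g \<in> \<Omega>" "\<And>x. x \<in> \<Omega> \<Longrightarrow> f' x = f x"
  shows "lderiv G X f' g = lderiv G X f g"
proof (rule lderiv_eqI)
  obtain S where S: "open S" "c0 \<in> S" "\<And>p. p \<in> S \<Longrightarrow> g \<otimes> \<iota> p \<in> \<Omega>"
    by (rule translate_smooth[OF assms(1,2)]) blast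
  show "((\<lambda>p. f' (g \<otimes> \<iota> p)) has_derivative (\<lambda>X. lderiv G X f g)) (at c0)"
    by (rule has_derivative_transform_within_open[OF lderiv_has_derivative[OF assms(1,2)] S(1,2)])
      (simp add: assms(3) S(3))
qed

lemma lderiv_add:
  assumes "lsmooth f \<Omega>" "lsmooth f' \<Omega>" "g \<in> \<Omega>"
  shows "lderiv G X (\<lambda>x. f x + f' x) g = lderiv G X f g + lderiv G X f' g"
  by (rule lderiv_eqI)
    (rule has_derivative_add[OF lderiv_has_derivative[OF assms(1,3)] lderiv_has_derivative[OF assms(2,3)]])

lemma lderiv_diff:
  assumes "lsmooth f \<Omega>" "lsmooth f' \<Omega>" "g \<in> \<Omega>"
  shows "lderiv G X (\<lambda>x. f x - f' x) g = lderiv G X f g - lderiv G X f' g"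
  by (rule lderiv_eqI)
    (rule has_derivative_diff[OF lderiv_has_derivative[OF assms(1,3)] lderiv_has_derivative[OF assms(2,3)]])

lemma lderiv_sum:
  assumes "\<And>i. i \<in> I \<Longrightarrow> lsmooth (f i) \<Omega>" "g \<in> \<Omega>"
  shows "lderiv G X (\<lambda>x. \<Sum>i\<in>I. f i x) g = (\<Sum>i\<in>I. lderiv G X (f i) g)"
  by (rule lderiv_eqI) (rule has_derivative_sum, rule lderiv_has_derivative[OF assms])

lemma lderiv_bounded_linear:
  assumes "bounded_linear L" "lsmooth f \<Omega>" "g \<in> \<Omega>"
  shows "lderiv G X (\<lambda>x. L (f x)) g = L (lderiv G X f g)"
  by (rule lderiv_eqI)
    (rule bounded_linear.has_derivative[OF assms(1) lderiv_has_derivative[OF assms(2,3)]])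

lemma lderiv_bilinear:
  assumes "bounded_bilinear B" "lsmooth f \<Omega>" "lsmooth f' \<Omega>" "g \<in> \<Omega>"
  shows "lderiv G X (\<lambda>x. B (f x) (f' x)) g = B (f g) (lderiv G X f' g) + B (lderiv G X f g) (f' g)"
  using lderiv_eqI[OF bounded_bilinear.FDERIV[OF assms(1) lderiv_has_derivative[OF assms(2,4)]
      lderiv_has_derivative[OF assms(3,4)]]] by simp

lemma lderiv_const: "lderiv G X (\<lambda>x. c) g = 0"
  by (rule lderiv_eqI[where f'="\<lambda>x. 0"]) simp

lemma lderiv_\<phi>0_one: "lderiv G X \<phi>0 \<one> = X"
proof (rule lderiv_eqI)
  show "((\<lambda>p. \<phi>0 (\<one> \<otimes> \<iota> p)) has_derivative (\<lambda>X. X)) (at c0)"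
    by (rule has_derivative_transform_within_open[OF has_derivative_ident open_V0 c0_V0])
      (simp add: \<phi>0_\<iota>)
qed

lemma lderiv_translate: "lderiv G X f g = lderiv G X (\<lambda>x. f (g \<otimes> x)) \<one>"
  by (simp add: lderiv_def)

text \<open>Smooth dependence on a parameter: with \<open>k\<close> read in a chart and the inner
  variable in the identity chart, the derivative at the identity is a partial derivative of one
  function of two variables in direction \<open>(0, X)\<close>, restricted to the slice
  \<open>(r, c0)\<close>. Both \<open>lderiv\<close> and \<open>Ad\<close> are of this form.\<close>

lemma lsmooth_partial:
  fixes K :: "'g \<Rightarrow> 'g \<Rightarrow> 'b::real_normed_vector"
  assumes "open \<Omega>"
    and "\<And>U \<phi>. (U, \<phi>) \<in> atlas G \<Longrightarrow> \<exists>D. open D \<and> (\<forall>r\<in>\<phi> ` (U \<inter> \<Omega>). (r, c0) \<in> D) \<and>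
      smooth_on (\<lambda>z. K (inv_into U \<phi> (fst z)) (\<iota> (snd z))) D"
  shows "lsmooth (\<lambda>k. lderiv G X (K k) \<one>) \<Omega>"
  unfolding lsmooth_def
proof (intro conjI assms(1))
  show "\<forall>(U, \<phi>)\<in>atlas G. smooth_on (\<lambda>p. lderiv G X (K (inv_into U \<phi> p)) \<one>) (\<phi> ` (U \<inter> \<Omega>))"
  proof clarify
    fix U \<phi> assume U: "(U, \<phi>) \<in> atlas G"
    let ?S = "\<phi> ` (U \<inter> \<Omega>)"
    have S: "open ?S" by (rule chart_image_open[OF U assms(1)])
    let ?F = "\<lambda>z. K (inv_into U \<phi> (fst z)) (\<iota> (snd z))"
    obtain D where D: "open D" "\<And>r. r \<in> ?S \<Longrightarrow> (r, c0) \<in> D" "smooth_on ?F D"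
      using assms(2)[OF U] by blast
    have "smooth_on (\<lambda>r. fderiv ?F (r, c0) (0, X)) ?S"
      by (rule smooth_on_compose[OF S D(1) _ smooth_on_frechet_derivative[OF D(3)], where g="\<lambda>r. (r, c0)"])
        (use D(2) smooth_on_slice in auto)
    moreover have "fderiv ?F (r, c0) (0, X) = lderiv G X (K (inv_into U \<phi> r)) \<one>"
      if "r \<in> ?S" for r
    proof -
      have "((\<lambda>p. ?F (r, p)) has_derivative (\<lambda>X. fderiv ?F (r, c0) (0, X))) (at c0)"
        by (rule has_derivative_compose[where g="?F" and f="\<lambda>p. (r, p)",
              OF _ smooth_on_has_derivative[OF D(3) D(2)[OF that]]])
          (auto intro!: derivative_eq_intros)
      then have "((\<lambda>p. K (inv_into U \<phi> r) (\<one> \<otimes> \<iota> p)) has_derivative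
          (\<lambda>X. fderiv ?F (r, c0) (0, X))) (at c0)" by simp
      then show ?thesis by (rule lderiv_eqI[symmetric])
    qed
    ultimately show "smooth_on (\<lambda>p. lderiv G X (K (inv_into U \<phi> p)) \<one>) ?S"
      by (rule iffD1[OF smooth_on_cong[OF S], rotated])
  qed
qed

lemma plot_fst: "plot a S \<Longrightarrow> open T \<Longrightarrow> plot (\<lambda>z. a (fst z)) (S \<times> T)"
  by (rule plot_reparam[where h=fst, OF _ open_Times[OF plotD(1)]
        smooth_on_linear_ident[OF bounded_linear_fst]]) auto

lemma plot_snd: "plot a S \<Longrightarrow> open T \<Longrightarrow> plot (\<lambda>z. a (snd z)) (T \<times> S)"
  by (rule plot_reparam[where h=snd, OF _ open_Times[OF _ plotD(1)]
        smooth_on_linear_ident[OF bounded_linear_snd]]) auto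

lemma lsmooth_lderiv:
  assumes "lsmooth f \<Omega>"
  shows "lsmooth (lderiv G X f) \<Omega>"
proof -
  have "lsmooth (\<lambda>k. lderiv G X (\<lambda>x. f (k \<otimes> x)) \<one>) \<Omega>"
  proof (rule lsmooth_partial[OF lsmoothD(1)[OF assms]])
    fix U \<phi> assume U: "(U, \<phi>) \<in> atlas G"
    let ?m = "\<lambda>z. inv_into U \<phi> (fst z) \<otimes> \<iota> (snd z)"
    have pl: "plot ?m (\<phi> ` U \<times> V0)"
      by (intro plot_mult plot_fst plot_snd plot_chart[OF U] plot_\<iota> open_V0 chartD(2)[OF U])
    let ?D = "(\<phi> ` U \<times> V0) \<inter> ?m -` \<Omega>"
    have D: "open ?D" by (rule plot_preimage_open[OF pl lsmoothD(1)[OF assms]])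
    have "smooth_on (\<lambda>z. f (?m z)) ?D"
      by (rule plot_compose[OF plot_subset[OF pl D] assms]) auto
    moreover have "\<forall>r\<in>\<phi> ` (U \<inter> \<Omega>). (r, c0) \<in> ?D"
      using c0_V0 by (auto simp: chart_inv[OF U])
    ultimately show "\<exists>D. open D \<and> (\<forall>r\<in>\<phi> ` (U \<inter> \<Omega>). (r, c0) \<in> D) \<and> smooth_on (\<lambda>z. f (?m z)) D"
      using D by blast
  qed
  then show ?thesis by (simp add: lderiv_translate[symmetric])
qed

section \<open>The group law in the identity chart and the Lie bracket\<close>

definition dom_\<mu> :: "('e \<times> 'e) set" where
  "dom_\<mu> = (V0 \<times> V0) \<inter> (\<lambda>z. \<iota> (fst z) \<otimes> \<iota> (snd z)) -` U0"

definition \<mu> :: "'e \<times> 'e \<Rightarrow> 'e" where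
  "\<mu> z = \<phi>0 (\<iota> (fst z) \<otimes> \<iota> (snd z))"

lemma plot_\<iota>_mult: "plot (\<lambda>z. \<iota> (fst z) \<otimes> \<iota> (snd z)) (V0 \<times> V0)"
  by (intro plot_mult plot_fst plot_snd plot_\<iota> open_V0)

lemma open_dom_\<mu>: "open dom_\<mu>"
  unfolding dom_\<mu>_def by (rule plot_preimage_open[OF plot_\<iota>_mult open_U0])

lemma smooth_\<mu>: "smooth_on \<mu> dom_\<mu>"
  unfolding \<mu>_def
  by (rule plot_compose[OF plot_subset[OF plot_\<iota>_mult open_dom_\<mu>] lsmooth_\<phi>0]) (auto simp: dom_\<mu>_def)

lemma dom_\<mu>_c0: "p \<in> V0 \<Longrightarrow> (p, c0) \<in> dom_\<mu>" "p \<in> V0 \<Longrightarrow> (c0, p) \<in> dom_\<mu>"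
  using c0_V0 by (auto simp: dom_\<mu>_def \<iota>_in \<iota>_\<phi>0)

lemma \<mu>_c0: "p \<in> V0 \<Longrightarrow> \<mu> (p, c0) = p" "p \<in> V0 \<Longrightarrow> \<mu> (c0, p) = p"
  by (simp_all add: \<mu>_def \<phi>0_\<iota>)

lemma \<mu>_deriv_snd:
  assumes "r \<in> V0"
  shows "fderiv \<mu> (r, c0) (0, A) = lderiv G A \<phi>0 (\<iota> r)"
proof -
  have "((\<lambda>p. \<mu> (r, p)) has_derivative (\<lambda>A. fderiv \<mu> (r, c0) (0, A))) (at c0)"
    by (rule has_derivative_compose[where g=\<mu> and f="\<lambda>p. (r, p)",
          OF _ smooth_on_has_derivative[OF smooth_\<mu> dom_\<mu>_c0(1)[OF assms]]])
      (auto intro!: derivative_eq_intros)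
  then have "((\<lambda>p. \<phi>0 (\<iota> r \<otimes> \<iota> p)) has_derivative
      (\<lambda>A. fderiv \<mu> (r, c0) (0, A))) (at c0)"
    by (simp add: \<mu>_def)
  then show ?thesis by (rule lderiv_eqI[symmetric])
qed

text \<open>The second slot of \<open>\<mu>\<close> is the right factor, so the inner derivative is
  a partial derivative in that slot, and moving the base point varies the left factor. Hence the
  bracket is the antisymmetric part of the mixed second derivative of the group law.\<close>

lemma lderiv_lderiv_\<phi>0:
  "lderiv G X (lderiv G Y \<phi>0) \<one> = fderiv (\<lambda>z. fderiv \<mu> z (0, Y)) (c0, c0) (X, 0)"
proof -
  have "((\<lambda>p. fderiv \<mu> (p, c0) (0, Y)) has_derivative
      (\<lambda>X. fderiv (\<lambda>z. fderiv \<mu> z (0, Y)) (c0, c0) (X, 0))) (at c0)"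
    by (rule has_derivative_compose[where g="\<lambda>z. fderiv \<mu> z (0, Y)" and f="\<lambda>p. (p, c0)",
          OF _ smooth_on_has_derivative[OF smooth_on_frechet_derivative[OF smooth_\<mu>] dom_\<mu>_c0(1)[OF c0_V0]]])
      (auto intro!: derivative_eq_intros)
  then have "((\<lambda>p. lderiv G Y \<phi>0 (\<one> \<otimes> \<iota> p)) has_derivative
      (\<lambda>X. fderiv (\<lambda>z. fderiv \<mu> z (0, Y)) (c0, c0) (X, 0))) (at c0)"
    by (rule has_derivative_transform_within_open[OF _ open_V0 c0_V0]) (simp add: \<mu>_deriv_snd)
  then show ?thesis by (rule lderiv_eqI)
qed

text \<open>A second left invariant derivative is the Hessian of the translated function plus a
  first derivative along a vector that does not depend on \<open>f\<close>. The Hessian is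
  symmetric, so only that vector matters in a commutator.\<close>

lemma lderiv_lderiv:
  fixes f :: "'g \<Rightarrow> 'b::euclidean_space"
  assumes "lsmooth f \<Omega>" "g \<in> \<Omega>"
  defines "F \<equiv> \<lambda>p. f (g \<otimes> \<iota> p)"
  shows "lderiv G X (lderiv G Y f) g = lderiv G (lderiv G X (lderiv G Y \<phi>0) \<one>) f g
    + fderiv (\<lambda>p. fderiv F p Y) c0 X"
proof -
  obtain S where S: "open S" "c0 \<in> S" "S \<subseteq> V0" "\<And>p. p \<in> S \<Longrightarrow> g \<otimes> \<iota> p \<in> \<Omega>" "smooth_on F S"
    by (rule translate_smooth[OF assms(1,2)], rule that) (simp_all add: F_def)
  define W where "W p = lderiv G Y \<phi>0 (\<iota> p)" for p
  \<comment> \<open>Right multiplication by \<open>\<iota> q\<close> moves the coordinate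
    \<open>p\<close> to \<open>\<phi>0 (\<iota> p \<otimes> \<iota> q)\<close>; the derivative of
    this in \<open>q\<close> at \<open>c0\<close> is the coordinate expression \<open>W\<close> of
    the left invariant field.\<close>
  have field: "lderiv G Y f (g \<otimes> \<iota> p) = fderiv F p (W p)" if p: "p \<in> S" for p
  proof -
    have pV: "p \<in> V0" using p S(3) by blast
    have "((\<lambda>q. \<phi>0 (\<iota> p \<otimes> \<iota> q)) has_derivative (\<lambda>Y. lderiv G Y \<phi>0 (\<iota> p))) (at c0)"
      by (rule lderiv_has_derivative[OF lsmooth_\<phi>0 \<iota>_in[OF pV]])
    moreover have "(F has_derivative fderiv F p) (at (\<phi>0 (\<iota> p \<otimes> \<iota> c0)))"
      using smooth_on_has_derivative[OF S(5) p] \<phi>0_\<iota>[OF pV] by simp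
    ultimately have der: "((\<lambda>q. F (\<phi>0 (\<iota> p \<otimes> \<iota> q))) has_derivative
        (\<lambda>Y. fderiv F p (lderiv G Y \<phi>0 (\<iota> p)))) (at c0)"
      by (rule has_derivative_compose[where g=F and f="\<lambda>q. \<phi>0 (\<iota> p \<otimes> \<iota> q)"])
    have pl: "plot (\<lambda>q. \<iota> p \<otimes> \<iota> q) V0"
      by (rule plot_mult[OF plot_const[OF open_V0] plot_\<iota>])
    have c0S: "c0 \<in> V0 \<inter> (\<lambda>q. \<iota> p \<otimes> \<iota> q) -` U0"
      using c0_V0 \<iota>_in[OF pV] by simp
    have "((\<lambda>q. f (g \<otimes> \<iota> p \<otimes> \<iota> q)) has_derivative
        (\<lambda>Y. fderiv F p (lderiv G Y \<phi>0 (\<iota> p)))) (at c0)"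
      by (rule has_derivative_transform_within_open[OF der plot_preimage_open[OF pl open_U0] c0S])
        (auto simp: F_def \<iota>_\<phi>0 m_assoc)
    from lderiv_eqI[OF this] show ?thesis by (simp add: W_def)
  qed
  have W0: "W c0 = Y" by (simp add: W_def lderiv_\<phi>0_one)
  have "((\<lambda>p. lderiv G Y \<phi>0 (\<one> \<otimes> \<iota> p)) has_derivative (\<lambda>X. lderiv G X (lderiv G Y \<phi>0) \<one>)) (at c0)"
    by (rule lderiv_has_derivative[OF lsmooth_lderiv[OF lsmooth_\<phi>0] id_chart(2)])
  then have "(W has_derivative (\<lambda>X. lderiv G X (lderiv G Y \<phi>0) \<one>)) (at c0)"
    by (simp add: W_def[abs_def])
  from frechet_derivative_along_field[OF S(1,5,2) this]
  have "((\<lambda>p. lderiv G Y f (g \<otimes> \<iota> p)) has_derivative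
      (\<lambda>v. fderiv F c0 (lderiv G v (lderiv G Y \<phi>0) \<one>)
        + fderiv (\<lambda>p. fderiv F p Y) c0 v)) (at c0)"
    unfolding W0 by (rule has_derivative_transform_within_open[OF _ S(1,2)]) (simp add: field)
  from lderiv_eqI[OF this] show ?thesis
    by (simp add: lderiv_def F_def)
qed

text \<open>The two Hessian terms cancel, and the difference of the remaining direction vectors is
  the bracket by definition.\<close>

lemma lderiv_commutator:
  fixes f :: "'g \<Rightarrow> 'b::euclidean_space"
  assumes "lsmooth f \<Omega>" "g \<in> \<Omega>"
  shows "lderiv G X (lderiv G Y f) g - lderiv G Y (lderiv G X f) g = lderiv G (lie_bracket G X Y) f g"
proof -
  obtain S where S: "open S" "c0 \<in> S" "smooth_on (\<lambda>p. f (g \<otimes> \<iota> p)) S"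
    by (rule translate_smooth[OF assms]) blast
  show ?thesis
    unfolding lderiv_lderiv[OF assms, of X Y] lderiv_lderiv[OF assms, of Y X]
      second_derivative_symmetric[OF S(1,3,2), of Y X] lie_bracket_def
    by (simp add: linear_diff[OF lderiv_linear[OF assms]])
qed

lemma lie_bracket_anti: "lie_bracket G X Y = - lie_bracket G Y X"
  by (simp add: lie_bracket_def)

lemma linear_lie_bracket: "linear (lie_bracket G X)"
proof -
  note L = lderiv_linear[OF lsmooth_\<phi>0]
  note sm = lsmooth_lderiv[OF lsmooth_\<phi>0]
  note one = id_chart(2)
  have add: "lderiv G Z (lderiv G (a + b) \<phi>0) \<one> = lderiv G Z (lderiv G a \<phi>0) \<one> + lderiv G Z (lderiv G b \<phi>0) \<one>" for Z a b
    using lderiv_cong[OF lsmooth_add[OF sm sm] one, of "lderiv G (a + b) \<phi>0" a b Z]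
      lderiv_add[OF sm sm one] by (simp add: linear_add[OF L])
  have scale: "lderiv G Z (lderiv G (r *\<^sub>R a) \<phi>0) \<one> = r *\<^sub>R lderiv G Z (lderiv G a \<phi>0) \<one>" for Z r a
    using lderiv_cong[OF lsmooth_bounded_linear[OF bounded_linear_scaleR_right sm] one, of "lderiv G (r *\<^sub>R a) \<phi>0" r a Z]
      lderiv_bounded_linear[OF bounded_linear_scaleR_right sm one] by (simp add: linear_scale[OF L])
  note L2 = lderiv_linear[OF sm one]
  show ?thesis
    by (rule linearI)
      (simp_all add: lie_bracket_def add scale linear_add[OF L2] linear_scale[OF L2] algebra_simps)
qed

lemma bilinear_lie_bracket: "bilinear (lie_bracket G)"
proof -
  have "(\<lambda>X. lie_bracket G X Y) = (\<lambda>X. - lie_bracket G Y X)" for Y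
    using lie_bracket_anti by blast
  then show ?thesis
    by (simp add: bilinear_def linear_lie_bracket linear_compose_neg)
qed

lemma lie_bracket_jacobi:
  "lie_bracket G X (lie_bracket G Y Z) + lie_bracket G Y (lie_bracket G Z X)
    + lie_bracket G Z (lie_bracket G X Y) = 0"
proof -
  note sm = lsmooth_lderiv[OF lsmooth_\<phi>0]
  note sm2 = lsmooth_lderiv[OF lsmooth_lderiv[OF lsmooth_\<phi>0]]
  note one = id_chart(2)
  \<comment> \<open>The commutator formula is applied to \<open>\<phi>0\<close> inside the outer
    derivative and to \<open>lderiv G X \<phi>0\<close> in the subtracted term. Each double bracket
    becomes four triple derivatives, and the twelve terms of the cyclic sum cancel in pairs.\<close>
  have *: "lie_bracket G X (lie_bracket G Y Z)
      = (lderiv G X (lderiv G Y (lderiv G Z \<phi>0)) \<one> - lderiv G X (lderiv G Z (lderiv G Y \<phi>0)) \<one>)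
        - (lderiv G Y (lderiv G Z (lderiv G X \<phi>0)) \<one> - lderiv G Z (lderiv G Y (lderiv G X \<phi>0)) \<one>)" for X Y Z
  proof -
    have "lderiv G X (lderiv G (lie_bracket G Y Z) \<phi>0) \<one>
        = lderiv G X (\<lambda>x. lderiv G Y (lderiv G Z \<phi>0) x - lderiv G Z (lderiv G Y \<phi>0) x) \<one>"
      by (rule lderiv_cong[OF lsmooth_diff[OF sm2 sm2] one])
        (simp add: lderiv_commutator[OF lsmooth_\<phi>0])
    then show ?thesis
      unfolding lie_bracket_def[of G X "lie_bracket G Y Z"] lderiv_commutator[OF sm one, symmetric]
      by (simp add: lderiv_diff[OF sm2 sm2 one])
  qed
  show ?thesis unfolding * by simp
qed

section \<open>The adjoint representation\<close>

lemma lderiv_conjugate: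
  fixes f :: "'g \<Rightarrow> 'b::real_normed_vector"
  assumes "lsmooth f \<Omega>" "\<one> \<in> \<Omega>"
  shows "lderiv G A (\<lambda>x. f (h \<otimes> x \<otimes> inv h)) \<one> = lderiv G (Ad G h A) f \<one>"
proof (rule lderiv_eqI)
  let ?c = "\<lambda>p. h \<otimes> \<iota> p \<otimes> inv h"
  have pl: "plot ?c V0"
    by (intro plot_mult plot_const open_V0 plot_\<iota>)
  let ?S = "V0 \<inter> ?c -` U0"
  have S: "open ?S" "c0 \<in> ?S"
    using plot_preimage_open[OF pl open_U0] c0_V0 id_chart(2) by auto
  have "smooth_on (\<lambda>p. \<phi>0 (?c p)) ?S"
    by (rule plot_compose[OF plot_subset[OF pl S(1)] lsmooth_\<phi>0]) auto
  then have "((\<lambda>p. \<phi>0 (?c p)) has_derivative (\<lambda>A. Ad G h A)) (at c0)"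
    using smooth_on_has_derivative[OF _ S(2)] by (fastforce simp: Ad_def lderiv_def)
  moreover have "((\<lambda>p. f (\<one> \<otimes> \<iota> p)) has_derivative (\<lambda>X. lderiv G X f \<one>)) (at (\<phi>0 (?c c0)))"
    using lderiv_has_derivative[OF assms] by simp
  ultimately have "((\<lambda>p. f (\<one> \<otimes> \<iota> (\<phi>0 (?c p)))) has_derivative (\<lambda>A. lderiv G (Ad G h A) f \<one>)) (at c0)"
    by (rule has_derivative_compose[where g="\<lambda>p. f (\<one> \<otimes> \<iota> p)" and f="\<lambda>p. \<phi>0 (?c p)"])
  then show "((\<lambda>p. f (h \<otimes> (\<one> \<otimes> \<iota> p) \<otimes> inv h)) has_derivative (\<lambda>A. lderiv G (Ad G h A) f \<one>)) (at c0)"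
    by (rule has_derivative_transform_within_open[OF _ S]) (simp add: \<iota>_\<phi>0)
qed

lemma lsmooth_conjugate: "\<exists>\<Omega>. \<one> \<in> \<Omega> \<and> lsmooth (\<lambda>x. \<phi>0 (g \<otimes> x \<otimes> inv g)) \<Omega>"
proof -
  have c: "continuous_on UNIV (\<lambda>x. g \<otimes> x \<otimes> inv g)"
  proof -
    have m: "continuous_on UNIV (\<lambda>(x, y). x \<otimes> y)" using lie by (simp add: is_lie_group_def)
    have "continuous_on UNIV (\<lambda>x. g \<otimes> x)" "continuous_on UNIV (\<lambda>x. x \<otimes> inv g)"
      using continuous_on_compose2[OF m, of UNIV "\<lambda>x. (g, x)"]
        continuous_on_compose2[OF m, of UNIV "\<lambda>x. (x, inv g)"] by (simp_all add: continuous_on_Pair)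
    then show ?thesis using continuous_on_compose2[of UNIV "\<lambda>x. x \<otimes> inv g" UNIV "\<lambda>x. g \<otimes> x"] by simp
  qed
  let ?\<Omega> = "(\<lambda>x. g \<otimes> x \<otimes> inv g) -` U0"
  have \<Omega>: "open ?\<Omega>" using open_vimage[OF open_U0 c] .
  have "lsmooth (\<lambda>x. \<phi>0 (g \<otimes> x \<otimes> inv g)) ?\<Omega>"
  proof (rule lsmoothI[OF \<Omega>])
    fix U \<phi> assume U: "(U, \<phi>) \<in> atlas G"
    have "plot (\<lambda>p. g \<otimes> inv_into U \<phi> p \<otimes> inv g) (\<phi> ` (U \<inter> ?\<Omega>))"
      by (intro plot_mult plot_const chart_image_open[OF U \<Omega>]
          plot_subset[OF plot_chart[OF U] chart_image_open[OF U \<Omega>]]) auto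
    then show "smooth_on (\<lambda>p. \<phi>0 (g \<otimes> inv_into U \<phi> p \<otimes> inv g)) (\<phi> ` (U \<inter> ?\<Omega>))"
      by (rule plot_compose[OF _ lsmooth_\<phi>0]) (auto simp: chart_inv(1)[OF U])
  qed
  then show ?thesis using id_chart(2) by (intro exI[of _ ?\<Omega>]) simp
qed

lemma linear_Ad: "linear (Ad G g)"
proof -
  obtain \<Omega> where "\<one> \<in> \<Omega>" "lsmooth (\<lambda>x. \<phi>0 (g \<otimes> x \<otimes> inv g)) \<Omega>" using lsmooth_conjugate by blast
  then have "linear (\<lambda>X. lderiv G X (\<lambda>x. \<phi>0 (g \<otimes> x \<otimes> inv g)) \<one>)" by (rule lderiv_linear[rotated])
  then show ?thesis by (simp add: Ad_def[abs_def])
qed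

lemma Ad_mult: "Ad G (g \<otimes> h) A = Ad G g (Ad G h A)"
proof -
  obtain \<Omega> where "\<one> \<in> \<Omega>" "lsmooth (\<lambda>x. \<phi>0 (g \<otimes> x \<otimes> inv g)) \<Omega>" using lsmooth_conjugate by blast
  from lderiv_conjugate[OF this(2,1), of A h] show ?thesis
    by (simp add: Ad_def[of G g] Ad_def[of G "g \<otimes> h"] m_assoc inv_mult_group)
qed

lemma Ad_one: "Ad G \<one> A = A"
  by (simp add: Ad_def lderiv_\<phi>0_one)

lemma Ad_inv [simp]: "Ad G g (Ad G (inv g) A) = A" "Ad G (inv g) (Ad G g A) = A"
  by (simp_all add: Ad_mult[symmetric] Ad_one)

lemma lsmooth_Ad: "lsmooth (\<lambda>k. Ad G k A) UNIV" "lsmooth (\<lambda>k. Ad G (inv k) A) UNIV"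
proof -
  \<comment> \<open>Here \<open>s\<close> is the identity or the inversion. The inverse variant is
    what makes fundamental vector fields smooth.\<close>
  have gen: "lsmooth (\<lambda>k. lderiv G A (\<lambda>x. \<phi>0 (s k \<otimes> x \<otimes> inv (s k))) \<one>) UNIV"
    if s: "\<And>U \<phi>. (U, \<phi>) \<in> atlas G \<Longrightarrow> plot (\<lambda>p. s (inv_into U \<phi> p)) (\<phi> ` U)" for s
  proof (rule lsmooth_partial[OF open_UNIV])
    fix U \<phi> assume U: "(U, \<phi>) \<in> atlas G"
    let ?m = "\<lambda>z. s (inv_into U \<phi> (fst z)) \<otimes> \<iota> (snd z) \<otimes> inv (s (inv_into U \<phi> (fst z)))"
    have pl: "plot ?m (\<phi> ` U \<times> V0)"
      by (intro plot_mult plot_inv plot_snd[OF plot_\<iota> chartD(2)[OF U]] plot_fst[OF s[OF U] open_V0])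
    let ?D = "(\<phi> ` U \<times> V0) \<inter> ?m -` U0"
    have D: "open ?D" by (rule plot_preimage_open[OF pl open_U0])
    have "smooth_on (\<lambda>z. \<phi>0 (?m z)) ?D"
      by (rule plot_compose[OF plot_subset[OF pl D] lsmooth_\<phi>0]) auto
    moreover have "\<forall>r\<in>\<phi> ` (U \<inter> UNIV). (r, c0) \<in> ?D"
      using c0_V0 id_chart(2) by auto
    ultimately show "\<exists>D. open D \<and> (\<forall>r\<in>\<phi> ` (U \<inter> UNIV). (r, c0) \<in> D) \<and> smooth_on (\<lambda>z. \<phi>0 (?m z)) D"
      using D by blast
  qed
  show "lsmooth (\<lambda>k. Ad G k A) UNIV"
    using gen[of "\<lambda>x. x"] plot_chart by (simp add: Ad_def)
  show "lsmooth (\<lambda>k. Ad G (inv k) A) UNIV"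
    using gen[of "\<lambda>x. inv x"] plot_inv[OF plot_chart] by (simp add: Ad_def)
qed

text \<open>Differentiate \<open>\<mu> (\<phi>0 (k x k\<inverse>), \<phi>0 k) = \<mu> (\<phi>0 k, \<phi>0 x)\<close> first in \<open>x\<close> and then in \<open>k\<close>, both
  at the identity.\<close>

lemma lderiv_Ad: "lderiv G C (\<lambda>k. Ad G k A) \<one> = lie_bracket G C A"
proof -
  have Dmu: "(\<mu> has_derivative fderiv \<mu> z) (at z)" if "z \<in> dom_\<mu>" for z
    by (rule smooth_on_has_derivative[OF smooth_\<mu> that])
  have z0: "(c0, c0) \<in> dom_\<mu>" by (rule dom_\<mu>_c0(1)[OF c0_V0])
  have first: "fderiv \<mu> (c0, r) (Ad G (\<iota> r) A, 0) = lderiv G A \<phi>0 (\<iota> r)" if r: "r \<in> V0" for r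
  proof -
    let ?k = "\<iota> r"
    let ?c = "\<lambda>p. ?k \<otimes> \<iota> p \<otimes> inv ?k"
    have pl: "plot ?c V0" by (intro plot_mult plot_const open_V0 plot_\<iota>)
    have plr: "plot (\<lambda>p. ?k \<otimes> \<iota> p) V0" by (intro plot_mult plot_const open_V0 plot_\<iota>)
    let ?S = "(V0 \<inter> ?c -` U0) \<inter> (V0 \<inter> (\<lambda>p. ?k \<otimes> \<iota> p) -` U0)"
    have S: "open ?S" "c0 \<in> ?S"
      using plot_preimage_open[OF pl open_U0] plot_preimage_open[OF plr open_U0] c0_V0 id_chart(2) \<iota>_in[OF r] by auto
    have "smooth_on (\<lambda>p. \<phi>0 (?c p)) ?S"
      by (rule plot_compose[OF plot_subset[OF pl S(1)] lsmooth_\<phi>0]) auto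
    then have "((\<lambda>p. \<phi>0 (?c p)) has_derivative (\<lambda>A. Ad G ?k A)) (at c0)"
      using smooth_on_has_derivative[OF _ S(2)] by (fastforce simp: Ad_def lderiv_def)
    then have "((\<lambda>p. (\<phi>0 (?c p), r)) has_derivative (\<lambda>A. (Ad G ?k A, 0))) (at c0)"
      by (auto intro!: derivative_eq_intros)
    moreover have "(\<mu> has_derivative fderiv \<mu> (c0, r)) (at (\<phi>0 (?c c0), r))"
      using Dmu[OF dom_\<mu>_c0(2)[OF r]] by simp
    ultimately have "((\<lambda>p. \<mu> (\<phi>0 (?c p), r)) has_derivative
        (\<lambda>A. fderiv \<mu> (c0, r) (Ad G ?k A, 0))) (at c0)"
      by (rule has_derivative_compose[where g=\<mu> and f="\<lambda>p. (\<phi>0 (?c p), r)"])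
    then have "((\<lambda>p. \<phi>0 (?k \<otimes> \<iota> p)) has_derivative
        (\<lambda>A. fderiv \<mu> (c0, r) (Ad G ?k A, 0))) (at c0)"
      by (rule has_derivative_transform_within_open[OF _ S]) (simp add: \<mu>_def \<iota>_\<phi>0 m_assoc)
    then show ?thesis by (rule lderiv_eqI[symmetric])
  qed
  \<comment> \<open>The moving direction \<open>(Ad k A, 0)\<close>, regarded as a field on all of
    the domain of \<open>\<mu>\<close> so that the product rule for derivatives along a field
    applies; afterwards only the slice \<open>(c0, r)\<close> is used.\<close>
  define w where "w z = (Ad G (\<iota> (snd z)) A, 0 :: 'e)" for z :: "'e \<times> 'e"
  define D\<mu> where "D\<mu> v z = fderiv \<mu> z v" for v z
  have "((\<lambda>p. Ad G (\<one> \<otimes> \<iota> p) A) has_derivative (\<lambda>C. lderiv G C (\<lambda>k. Ad G k A) \<one>)) (at c0)"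
    by (rule lderiv_has_derivative[OF lsmooth_Ad(1)]) simp
  then have "((\<lambda>p. Ad G (\<iota> p) A) has_derivative (\<lambda>C. lderiv G C (\<lambda>k. Ad G k A) \<one>)) (at (snd (c0, c0)))"
    by simp
  from has_derivative_compose[where f=snd, OF has_derivative_snd[OF has_derivative_ident] this]
  have "(w has_derivative (\<lambda>v. (lderiv G (snd v) (\<lambda>k. Ad G k A) \<one>, 0))) (at (c0, c0))"
    unfolding w_def by (auto intro!: derivative_eq_intros)
  from frechet_derivative_along_field[OF open_dom_\<mu> smooth_\<mu> z0 this]
  have "((\<lambda>z. fderiv \<mu> z (w z)) has_derivative
      (\<lambda>v. fderiv \<mu> (c0, c0) (lderiv G (snd v) (\<lambda>k. Ad G k A) \<one>, 0)
        + fderiv (D\<mu> (A, 0)) (c0, c0) v)) (at (c0, c0))"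
    by (simp add: w_def Ad_one D\<mu>_def[abs_def])
  then have "((\<lambda>r. fderiv \<mu> (c0, r) (w (c0, r))) has_derivative
      (\<lambda>C. fderiv \<mu> (c0, c0) (lderiv G (snd (0 :: 'e, C)) (\<lambda>k. Ad G k A) \<one>, 0)
        + fderiv (D\<mu> (A, 0)) (c0, c0) (0, C))) (at c0)"
    by (rule has_derivative_compose[where f="\<lambda>r. (c0, r)" and g="\<lambda>z. fderiv \<mu> z (w z)", rotated]) (auto intro!: derivative_eq_intros)
  then have "((\<lambda>r. lderiv G A \<phi>0 (\<one> \<otimes> \<iota> r)) has_derivative
      (\<lambda>C. fderiv \<mu> (c0, c0) (lderiv G C (\<lambda>k. Ad G k A) \<one>, 0)
        + fderiv (D\<mu> (A, 0)) (c0, c0) (0, C))) (at c0)"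
    unfolding snd_conv
    by (rule has_derivative_transform_within_open[OF _ open_V0 c0_V0]) (simp add: w_def first)
  then have "lderiv G C (lderiv G A \<phi>0) \<one>
      = fderiv \<mu> (c0, c0) (lderiv G C (\<lambda>k. Ad G k A) \<one>, 0)
        + fderiv (D\<mu> (A, 0)) (c0, c0) (0, C)"
    by (rule lderiv_eqI)
  \<comment> \<open>Exchanging the order of differentiation turns this mixed second derivative of
    \<open>\<mu>\<close> into the subtracted half of the bracket.\<close>
  also have "fderiv (D\<mu> (A, 0)) (c0, c0) (0, C) = lderiv G A (lderiv G C \<phi>0) \<one>"
    unfolding D\<mu>_def[abs_def] lderiv_lderiv_\<phi>0
    by (rule second_derivative_symmetric[OF open_dom_\<mu> smooth_\<mu> z0])
  also have "fderiv \<mu> (c0, c0) (v, 0) = v" for v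
  proof -
    have "((\<lambda>p. \<mu> (p, c0)) has_derivative (\<lambda>v. fderiv \<mu> (c0, c0) (v, 0))) (at c0)"
      by (rule has_derivative_compose[where f="\<lambda>p. (p, c0)" and g=\<mu>, OF _ Dmu[OF z0]])
        (auto intro!: derivative_eq_intros)
    moreover have "((\<lambda>p. \<mu> (p, c0)) has_derivative (\<lambda>v. v)) (at c0)"
      by (rule has_derivative_transform_within_open[OF has_derivative_ident open_V0 c0_V0]) (simp add: \<mu>_c0)
    ultimately show ?thesis by (metis has_derivative_unique)
  qed
  finally show ?thesis by (simp add: lie_bracket_def)
qed

text \<open>Elements of the Lie algebra of a subgroup are known only as velocities of curves; this
  chain rule lets them act as left invariant derivatives.\<close>

lemma has_vector_derivative_along_curve:
  assumes "lsmooth f \<Omega>" "g \<in> \<Omega>" and "0 < \<epsilon>" "\<gamma> 0 = \<one>"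
    and "\<And>s. s \<in> {-\<epsilon><..<\<epsilon>} \<Longrightarrow> \<gamma> s \<in> U0"
    and "((\<lambda>s. \<phi>0 (\<gamma> s)) has_vector_derivative Y) (at 0)"
  shows "((\<lambda>s. f (g \<otimes> \<gamma> s)) has_vector_derivative lderiv G Y f g) (at 0)"
proof -
  have lin: "linear (\<lambda>Y. lderiv G Y f g)" by (rule lderiv_linear[OF assms(1,2)])
  have "((\<lambda>p. f (g \<otimes> \<iota> p)) has_derivative (\<lambda>Y. lderiv G Y f g)) (at (\<phi>0 (\<gamma> 0)))"
    using lderiv_has_derivative[OF assms(1,2)] assms(4) by simp
  from has_derivative_compose[where f="\<lambda>s. \<phi>0 (\<gamma> s)" and g="\<lambda>p. f (g \<otimes> \<iota> p)",
      OF assms(6)[unfolded has_vector_derivative_def] this]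
  have "((\<lambda>s. f (g \<otimes> \<iota> (\<phi>0 (\<gamma> s)))) has_derivative (\<lambda>s. s *\<^sub>R lderiv G Y f g)) (at 0)"
    by (simp add: linear_scale[OF lin])
  then show ?thesis
    unfolding has_vector_derivative_def
    by (rule has_derivative_transform_within_open[OF _ open_greaterThanLessThan[of "-\<epsilon>" \<epsilon>]])
      (use assms(3,5) in \<open>auto simp: \<iota>_\<phi>0\<close>)
qed

end

section \<open>Curvature of naturally reductive spaces\<close>

context lie begin

lemma lsmooth_translate:
  assumes "lsmooth f UNIV"
  shows "lsmooth (\<lambda>k. f (g \<otimes> k)) UNIV"
proof (rule lsmoothI[OF open_UNIV])
  fix U \<phi> assume U: "(U, \<phi>) \<in> atlas G"
  have "plot (\<lambda>p. g \<otimes> inv_into U \<phi> p) (\<phi> ` U)"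
    by (intro plot_mult plot_const plot_chart[OF U] chartD(2)[OF U])
  from plot_compose[OF this assms] show "smooth_on (\<lambda>p. f (g \<otimes> inv_into U \<phi> p)) (\<phi> ` (U \<inter> UNIV))"
    by simp
qed

lemma lderiv_expand:
  assumes "lsmooth V \<Omega>" "g \<in> \<Omega>"
  shows "lderiv G y V g = (\<Sum>b\<in>Basis. (y \<bullet> b) *\<^sub>R lderiv G b V g)"
  by (rule linear_euclidean_expand[OF lderiv_linear[OF assms]])

text \<open>Leibniz rule for a field that need not be left invariant: expanding \<open>Y k\<close>
  over \<open>Basis\<close> separates the variation of the field from that of
  \<open>V\<close>.\<close>

lemma lderiv_along_field:
  assumes Y: "lsmooth Y UNIV" and V: "lsmooth V UNIV"
  shows "lderiv G x (\<lambda>k. lderiv G (Y k) V k) g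
      = lderiv G x (lderiv G (Y g) V) g + lderiv G (lderiv G x Y g) V g" (is ?eq)
    and "lsmooth (\<lambda>k. lderiv G (Y k) V k) UNIV" (is ?sm)
proof -
  have Yb: "lsmooth (\<lambda>k. Y k \<bullet> b) UNIV" for b
    by (rule lsmooth_bounded_linear[OF bounded_linear_inner_left Y])
  have tm: "lsmooth (\<lambda>k. (Y k \<bullet> b) *\<^sub>R lderiv G b V k) UNIV" for b
    by (rule lsmooth_bilinear[OF bounded_bilinear_scaleR Yb lsmooth_lderiv[OF V]])
  have exp: "(\<lambda>k. lderiv G (Y k) V k) = (\<lambda>k. \<Sum>b\<in>Basis. (Y k \<bullet> b) *\<^sub>R lderiv G b V k)"
    using lderiv_expand[OF V] by blast
  show ?sm
    unfolding exp by (intro lsmooth_sum tm) auto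
  have "lderiv G x (\<lambda>k. lderiv G (Y k) V k) g
      = (\<Sum>b\<in>Basis. lderiv G x (\<lambda>k. (Y k \<bullet> b) *\<^sub>R lderiv G b V k) g)"
    unfolding exp by (rule lderiv_sum[OF tm UNIV_I])
  also have "\<dots> = (\<Sum>b\<in>Basis. (Y g \<bullet> b) *\<^sub>R lderiv G x (lderiv G b V) g)
      + (\<Sum>b\<in>Basis. (lderiv G x Y g \<bullet> b) *\<^sub>R lderiv G b V g)"
    by (simp add: lderiv_bilinear[OF bounded_bilinear_scaleR Yb lsmooth_lderiv[OF V] UNIV_I]
        lderiv_bounded_linear[OF bounded_linear_inner_left Y UNIV_I] sum.distrib)
  also have "(\<Sum>b\<in>Basis. (Y g \<bullet> b) *\<^sub>R lderiv G x (lderiv G b V) g) = lderiv G x (lderiv G (Y g) V) g"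
  proof -
    have "lderiv G (Y g) V = (\<lambda>k. \<Sum>b\<in>Basis. (Y g \<bullet> b) *\<^sub>R lderiv G b V k)"
      using lderiv_expand[OF V] by blast
    then show ?thesis
      by (simp add: lderiv_sum[OF lsmooth_bounded_linear[OF bounded_linear_scaleR_right lsmooth_lderiv[OF V]] UNIV_I]
          lderiv_bounded_linear[OF bounded_linear_scaleR_right lsmooth_lderiv[OF V] UNIV_I])
  qed
  finally show ?eq
    by (simp only: lderiv_expand[OF V UNIV_I, of "lderiv G x Y g", symmetric])
qed

end

locale reductive =
  fixes M :: "('g::{t2_space,second_countable_topology}, 'e::euclidean_space, 'z) reductive_space_scheme"
    (structure)
    and Q :: "'e \<Rightarrow> 'e \<Rightarrow> real"
  assumes nat_red: "naturally_reductive M" and inv_form: "invariant_form M Q"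
begin

lemma riem: "riemannian_reductive M"
  using nat_red by (simp add: naturally_reductive_def)

sublocale lie M
  using riem by unfold_locales (simp add: riemannian_reductive_def)

abbreviation "\<mm> \<equiv> mspace M"
abbreviation "\<hh> \<equiv> hspace M"
abbreviation "br \<equiv> lie_bracket M"
abbreviation "\<pi> \<equiv> mpart M"

section \<open>The reductive decomposition and the invariant form\<close>

lemma subspace_m: "subspace \<mm>"
  and decomp: "\<exists>x\<in>\<hh>. \<exists>y\<in>\<mm>. A = x + y"
  and Ad_m: "h \<in> isotropy M \<Longrightarrow> x \<in> \<mm> \<Longrightarrow> Ad M h x \<in> \<mm>"
  and metric_pos: "x \<in> \<mm> \<Longrightarrow> x \<noteq> 0 \<Longrightarrow> 0 < metric M x x"
  and subgroup_H: "subgroup (isotropy M) M"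
  using riem unfolding riemannian_reductive_def by blast+

lemma bilinear_Q: "bilinear Q"
  and Q_sym: "Q A B = Q B A"
  and Q_Ad: "Q (Ad M g A) (Ad M g B) = Q A B"
  and Q_h_m: "A \<in> \<hh> \<Longrightarrow> B \<in> \<mm> \<Longrightarrow> Q A B = 0"
  and Q_metric: "A \<in> \<mm> \<Longrightarrow> B \<in> \<mm> \<Longrightarrow> Q A B = metric M A B"
  using inv_form unfolding invariant_form_def by auto

lemmas Q_simps = bilinear_ladd[OF bilinear_Q] bilinear_radd[OF bilinear_Q]
  bilinear_lsub[OF bilinear_Q] bilinear_rsub[OF bilinear_Q] bilinear_lneg[OF bilinear_Q]
  bilinear_rneg[OF bilinear_Q] bilinear_lmul[OF bilinear_Q] bilinear_rmul[OF bilinear_Q]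
  bilinear_lzero[OF bilinear_Q] bilinear_rzero[OF bilinear_Q]

text \<open>\<open>h\<close> is defined by velocities of curves, from which not even closure under
  addition is visible. If \<open>A = x + y\<close> is \<open>Q\<close>-orthogonal to
  \<open>m\<close>, pairing with \<open>y\<close> gives \<open>metric M y y = 0\<close>, hence
  \<open>y = 0\<close>. As an orthogonal complement \<open>h\<close> is a subspace.\<close>

lemma h_iff: "A \<in> \<hh> \<longleftrightarrow> (\<forall>B\<in>\<mm>. Q A B = 0)"
proof
  assume *: "\<forall>B\<in>\<mm>. Q A B = 0"
  obtain x y where xy: "x \<in> \<hh>" "y \<in> \<mm>" "A = x + y" using decomp by blast
  then have "metric M y y = 0"
    using * Q_h_m Q_metric by (force simp: Q_simps)
  then have "y = 0" using metric_pos xy(2) by force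
  then show "A \<in> \<hh>" using xy by simp
qed (use Q_h_m in blast)

lemma subspace_h: "subspace \<hh>"
  by (rule subspaceI) (auto simp: h_iff Q_simps)

lemma h_inter_m: "A \<in> \<hh> \<Longrightarrow> A \<in> \<mm> \<Longrightarrow> A = 0"
  using Q_h_m Q_metric metric_pos by fastforce

lemma mpart_eqI: "x \<in> \<mm> \<Longrightarrow> A - x \<in> \<hh> \<Longrightarrow> \<pi> A = x"
  unfolding mpart_def
proof (rule the_equality)
  assume x: "x \<in> \<mm>" "A - x \<in> \<hh>"
  fix y assume y: "y \<in> \<mm> \<and> A - y \<in> \<hh>"
  have "(A - y) - (A - x) \<in> \<hh>" using subspace_diff[OF subspace_h] x y by blast
  moreover have "x - y \<in> \<mm>" using subspace_diff[OF subspace_m] x y by blast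
  ultimately have "x - y = 0" by (intro h_inter_m) simp_all
  then show "y = x" by simp
qed simp

lemma mpart_in [simp]: "\<pi> A \<in> \<mm>" and hpart_in [simp]: "hpart M A \<in> \<hh>"
proof -
  obtain x y where xy: "x \<in> \<hh>" "y \<in> \<mm>" "A = x + y" using decomp by blast
  then have "\<pi> A = y" by (intro mpart_eqI) auto
  then show "\<pi> A \<in> \<mm>" "hpart M A \<in> \<hh>" using xy by (auto simp: hpart_def)
qed

lemma hpart_plus_mpart: "hpart M A + \<pi> A = A"
  by (simp add: hpart_def)

lemma mpart_m [simp]: "x \<in> \<mm> \<Longrightarrow> \<pi> x = x"
  using mpart_eqI subspace_0[OF subspace_h] by simp

lemma linear_mpart: "linear \<pi>"
proof (rule linearI)
  fix A B :: 'e and r :: real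
  have "A + B - (\<pi> A + \<pi> B) = hpart M A + hpart M B" "r *\<^sub>R A - r *\<^sub>R \<pi> A = r *\<^sub>R hpart M A"
    by (simp_all add: hpart_def algebra_simps)
  then show "\<pi> (A + B) = \<pi> A + \<pi> B" "\<pi> (r *\<^sub>R A) = r *\<^sub>R \<pi> A"
    by (auto intro!: mpart_eqI subspace_add[OF subspace_m] subspace_add[OF subspace_h]
        subspace_scale[OF subspace_m] subspace_scale[OF subspace_h])
qed

lemma linear_hpart: "linear (hpart M)"
  unfolding hpart_def[abs_def] by (intro linear_compose_sub linear_mpart linear_ident)

lemma Q_mpart: "x \<in> \<mm> \<Longrightarrow> Q A x = metric M (\<pi> A) x"
  using Q_h_m[of "hpart M A" x] Q_metric[of "\<pi> A" x] hpart_plus_mpart[of A] mpart_in[of A]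
  by (metis Q_simps(1) add_0 hpart_in)

lemma Q_hpart: "y \<in> \<hh> \<Longrightarrow> Q A y = Q (hpart M A) y"
  using Q_h_m[of y "\<pi> A"] hpart_plus_mpart[of A] mpart_in[of A]
  by (metis Q_simps(1) Q_sym add.right_neutral)

lemma Q_split: "Q A B = Q_h M Q A B + Q_m M A B"
proof -
  have "Q A B = Q (hpart M A + \<pi> A) (hpart M B + \<pi> B)" by (simp add: hpart_plus_mpart)
  also have "\<dots> = Q (hpart M A) (hpart M B) + Q (\<pi> A) (\<pi> B)"
    by (simp add: Q_simps Q_h_m Q_sym[of "\<pi> A" "hpart M B"])
  finally show ?thesis by (simp add: Q_h_def Q_m_def Q_metric)
qed

text \<open>The function \<open>k \<mapsto> Q (Ad k A) (Ad k B)\<close> is constant, and its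
  derivative at the identity along \<open>C\<close> is the left hand side.\<close>

lemma Q_bracket: "Q (br C A) B + Q A (br C B) = 0"
proof -
  have "lderiv M C (\<lambda>k. Q (Ad M k A) (Ad M k B)) \<one> = Q A (br C B) + Q (br C A) B"
    using bilinear_Q unfolding bilinear_conv_bounded_bilinear
    by (simp add: lderiv_bilinear[OF _ lsmooth_Ad(1) lsmooth_Ad(1) UNIV_I] lderiv_Ad Ad_one)
  then show ?thesis by (simp add: Q_Ad lderiv_const)
qed

lemma Q_bracket_assoc: "Q (br A B) C = Q A (br B C)"
  using Q_bracket[of B A C] lie_bracket_anti[of A B] by (simp add: Q_simps)

lemma inv_H: "h \<in> isotropy M \<Longrightarrow> inv h \<in> isotropy M"
  using subgroup_H by (rule subgroup.m_inv_closed)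

text \<open>\<open>Ad\<close> of the isotropy group preserves both \<open>Q\<close> and
  \<open>m\<close>, hence also the orthogonal complement of \<open>m\<close>.\<close>

lemma Ad_h: "h \<in> isotropy M \<Longrightarrow> y \<in> \<hh> \<Longrightarrow> Ad M h y \<in> \<hh>"
  unfolding h_iff
proof (intro ballI)
  fix B assume h: "h \<in> isotropy M" and y: "\<forall>B\<in>\<mm>. Q y B = 0" and B: "B \<in> \<mm>"
  have "Q (Ad M h y) B = Q (Ad M h y) (Ad M h (Ad M (inv h) B))" by simp
  also have "\<dots> = 0" using y Ad_m[OF inv_H[OF h] B] unfolding Q_Ad by blast
  finally show "Q (Ad M h y) B = 0" .
qed

lemma mpart_Ad: "h \<in> isotropy M \<Longrightarrow> \<pi> (Ad M h A) = Ad M h (\<pi> A)"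
  by (rule mpart_eqI) (auto simp: Ad_m Ad_h linear_diff[OF linear_Ad, symmetric] hpart_def[symmetric])

lemma h_curve:
  assumes "Y \<in> \<hh>"
  obtains \<gamma> \<epsilon> where "0 < \<epsilon>" "\<gamma> 0 = \<one>" "\<And>s. s \<in> {-\<epsilon><..<\<epsilon>} \<Longrightarrow> \<gamma> s \<in> isotropy M"
    "\<And>s. s \<in> {-\<epsilon><..<\<epsilon>} \<Longrightarrow> \<gamma> s \<in> id_dom M"
    "((\<lambda>s. id_coord M (\<gamma> s)) has_vector_derivative Y) (at 0)"
  using assms unfolding lie_subalgebra_def by blast

text \<open>A curve in the isotropy group with velocity \<open>Y\<close> keeps
  \<open>g \<otimes> \<gamma> s\<close> in one coset. This is the device that turns relations on the
  isotropy group into infinitesimal ones.\<close>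

lemma lderiv_constant_on_H:
  assumes "Y \<in> \<hh>" "lsmooth f UNIV" "\<And>h. h \<in> isotropy M \<Longrightarrow> f (g \<otimes> h) = c"
  shows "lderiv M Y f g = 0"
proof -
  obtain \<gamma> \<epsilon> where c: "0 < \<epsilon>" "\<gamma> 0 = \<one>" "\<And>s. s \<in> {-\<epsilon><..<\<epsilon>} \<Longrightarrow> \<gamma> s \<in> isotropy M"
    "\<And>s. s \<in> {-\<epsilon><..<\<epsilon>} \<Longrightarrow> \<gamma> s \<in> id_dom M"
    "((\<lambda>s. id_coord M (\<gamma> s)) has_vector_derivative Y) (at 0)"
    by (rule h_curve[OF assms(1)], rule that) simp_all
  have "((\<lambda>s. f (g \<otimes> \<gamma> s)) has_vector_derivative lderiv M Y f g) (at 0)"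
    by (rule has_vector_derivative_along_curve[where \<epsilon>=\<epsilon> and \<Omega>=UNIV]) (use assms(2) c in auto)
  moreover have "((\<lambda>s. f (g \<otimes> \<gamma> s)) has_vector_derivative 0) (at 0)"
    by (rule has_vector_derivative_transform_within_open[OF has_vector_derivative_const[of c]
          open_greaterThanLessThan[of "-\<epsilon>" \<epsilon>]]) (use c(1,3) assms(3) in auto)
  ultimately show ?thesis by (rule vector_derivative_unique_at)
qed

text \<open>For \<open>k\<close> in the isotropy group the \<open>h\<close>-part of
  \<open>Ad k X\<close> vanishes, and \<open>hpart M (br Y X)\<close> is the derivative of this
  expression along \<open>Y\<close>.\<close>

lemma bracket_h_m: 
  assumes "Y \<in> \<hh>" "X \<in> \<mm>"
  shows "br Y X \<in> \<mm>"
proof -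
  have bl: "bounded_linear (hpart M)" using linear_hpart linear_conv_bounded_linear by blast
  have "lderiv M Y (\<lambda>k. hpart M (Ad M k X)) \<one> = 0"
    by (rule lderiv_constant_on_H[OF assms(1) lsmooth_bounded_linear[OF bl lsmooth_Ad(1)], where c=0])
      (use Ad_m[OF _ assms(2)] in \<open>simp add: hpart_def\<close>)
  then have "hpart M (br Y X) = 0"
    by (simp add: lderiv_bounded_linear[OF bl lsmooth_Ad(1) UNIV_I] lderiv_Ad)
  then show ?thesis using hpart_plus_mpart[of "br Y X"] mpart_in[of "br Y X"] by simp
qed

section \<open>Vector fields and the curvature of the connections\<close>

lemma vector_field_lsmooth: "vector_field M V \<Longrightarrow> lsmooth V UNIV"
  by (simp add: vector_field_def smooth_map_iff_lsmooth)

text \<open>Equivariance makes \<open>k \<mapsto> Ad k (V (g \<otimes> k))\<close> constant on the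
  isotropy group; the product rule at the identity does the rest.\<close>

lemma vector_field_deriv_h:
  assumes V: "vector_field M V" and Y: "Y \<in> \<hh>"
  shows "lderiv M Y V g = - br Y (V g)"
proof -
  note sm = lsmooth_translate[OF vector_field_lsmooth[OF V], of g]
  \<comment> \<open>\<open>Ad k (V (g \<otimes> k))\<close> expanded over \<open>Basis\<close>,
    since smoothness of \<open>Ad\<close> is available for a fixed argument only.\<close>
  define W where "W k = (\<Sum>b\<in>Basis. (V (g \<otimes> k) \<bullet> b) *\<^sub>R Ad M k b)" for k
  have smb: "lsmooth (\<lambda>k. V (g \<otimes> k) \<bullet> b) UNIV" for b
    by (rule lsmooth_bounded_linear[OF bounded_linear_inner_left sm])
  have t: "lsmooth (\<lambda>k. (V (g \<otimes> k) \<bullet> b) *\<^sub>R Ad M k b) UNIV" for b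
    by (rule lsmooth_bilinear[OF bounded_bilinear_scaleR smb lsmooth_Ad(1)])
  have W: "W k = Ad M k (V (g \<otimes> k))" for k
    unfolding W_def by (rule linear_euclidean_expand[OF linear_Ad, symmetric])
  have "lderiv M Y W \<one> = 0"
  proof (rule lderiv_constant_on_H[OF Y, where c="V g"])
    show "lsmooth W UNIV" unfolding W_def[abs_def] by (intro lsmooth_sum t) auto
    fix h assume "h \<in> isotropy M"
    then show "W (\<one> \<otimes> h) = V g" using V by (simp add: W vector_field_def)
  qed
  also have "lderiv M Y W \<one> = (\<Sum>b\<in>Basis. lderiv M Y (\<lambda>k. (V (g \<otimes> k) \<bullet> b) *\<^sub>R Ad M k b) \<one>)"
    unfolding W_def[abs_def] by (rule lderiv_sum[OF t UNIV_I])
  also have "\<dots> = (\<Sum>b\<in>Basis. (V g \<bullet> b) *\<^sub>R br Y b + (lderiv M Y V g \<bullet> b) *\<^sub>R b)"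
    by (simp add: lderiv_bilinear[OF bounded_bilinear_scaleR smb lsmooth_Ad(1) UNIV_I]
        lderiv_bounded_linear[OF bounded_linear_inner_left sm UNIV_I] lderiv_translate[symmetric]
        lderiv_Ad Ad_one)
  also have "\<dots> = br Y (V g) + lderiv M Y V g"
    by (simp add: sum.distrib euclidean_representation linear_euclidean_expand[OF linear_lie_bracket, of Y "V g"])
  finally show ?thesis by (simp add: eq_neg_iff_add_eq_0 add.commute)
qed

text \<open>The witness is the fundamental vector field of \<open>Ad M g x\<close>: the shift by
  \<open>Ad M g\<close> gives it the value \<open>x\<close> at \<open>g\<close>, and it is
  equivariant because the projection to \<open>m\<close> commutes with \<open>Ad\<close> of the
  isotropy group.\<close>

lemma vector_field_exists:
  assumes "x \<in> \<mm>"
  obtains X where "vector_field M X" "X g = x"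
proof
  have bl: "bounded_linear \<pi>" using linear_mpart linear_conv_bounded_linear by blast
  show "vector_field M (\<lambda>k. \<pi> (Ad M (inv k) (Ad M g x)))"
    unfolding vector_field_def smooth_map_iff_lsmooth
    by (auto simp: inv_mult_group Ad_mult mpart_Ad inv_H intro: lsmooth_bounded_linear[OF bl lsmooth_Ad(2)])
  show "\<pi> (Ad M (inv g) (Ad M g x)) = x" using assms by simp
qed

text \<open>Minus the torsion of the canonical connection.\<close>

definition tor :: "'e \<Rightarrow> 'e \<Rightarrow> 'e" where
  "tor x y = \<pi> (br x y)"

lemma bounded_bilinear_tor: "bounded_bilinear tor"
proof -
  have "bilinear tor"
    unfolding bilinear_def tor_def[abs_def]
    using bilinear_lie_bracket linear_compose[OF _ linear_mpart, unfolded o_def]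
    unfolding bilinear_def by blast
  then show ?thesis using bilinear_conv_bounded_bilinear by blast
qed

text \<open>Derivatives of \<open>X\<close> and \<open>Y\<close> cancel against those in
  \<open>vf_bracket\<close>, and the second derivatives of \<open>V\<close> leave one derivative
  along the bracket. Its \<open>m\<close>-part cancels as well, and on its \<open>h\<close>-part
  equivariance replaces differentiation by \<open>- br\<close>. Hence the result depends on the
  values at \<open>g\<close> alone.\<close>

lemma curvature_op_eq:
  assumes X: "vector_field M X" and Y: "vector_field M Y" and V: "vector_field M V"
  shows "curvature_op M t X Y V g = - br (hpart M (br (X g) (Y g))) (V g)
    - t *\<^sub>R tor (tor (X g) (Y g)) (V g)
    + (t * t) *\<^sub>R (tor (X g) (tor (Y g) (V g)) - tor (Y g) (tor (X g) (V g)))"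
proof -
  interpret T: bounded_bilinear tor by (rule bounded_bilinear_tor)
  note sV = vector_field_lsmooth[OF V]
  have lin: "linear (\<lambda>x. lderiv M x V g)" by (rule lderiv_linear[OF sV UNIV_I])
  have nn: "nabla M t X' (nabla M t Y' V) g
      = lderiv M (X' g) (lderiv M (Y' g) V) g + lderiv M (lderiv M (X' g) Y' g) V g
      + t *\<^sub>R (tor (Y' g) (lderiv M (X' g) V g) + tor (lderiv M (X' g) Y' g) (V g))
      + t *\<^sub>R tor (X' g) (lderiv M (Y' g) V g) + (t * t) *\<^sub>R tor (X' g) (tor (Y' g) (V g))"
    if "vector_field M Y'" for X' Y'
  proof -
    note sY = vector_field_lsmooth[OF that]
    have sT: "lsmooth (\<lambda>k. tor (Y' k) (V k)) UNIV"
      by (rule lsmooth_bilinear[OF bounded_bilinear_tor sY sV])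
    have "nabla M t Y' V = (\<lambda>k. lderiv M (Y' k) V k + t *\<^sub>R tor (Y' k) (V k))"
      by (simp add: nabla_def[abs_def] tor_def)
    then show ?thesis
      by (simp add: nabla_def[of M t X'] tor_def[symmetric] T.add_right T.scaleR_right scaleR_add_right
          lderiv_add[OF lderiv_along_field(2)[OF sY sV]
            lsmooth_bounded_linear[OF bounded_linear_scaleR_right sT] UNIV_I]
          lderiv_along_field(1)[OF sY sV] lderiv_bounded_linear[OF bounded_linear_scaleR_right sT UNIV_I]
          lderiv_bilinear[OF bounded_bilinear_tor sY sV UNIV_I])
  qed
  \<comment> \<open>\<open>X g\<close> and \<open>Y g\<close> are fixed vectors here, so the
    commutator formula for left invariant fields applies.\<close>
  have "lderiv M (X g) (lderiv M (Y g) V) g - lderiv M (Y g) (lderiv M (X g) V) g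
      = lderiv M (hpart M (br (X g) (Y g))) V g + lderiv M (tor (X g) (Y g)) V g"
    unfolding lderiv_commutator[OF sV UNIV_I] tor_def
    by (simp add: linear_add[OF lin, symmetric] hpart_plus_mpart)
  also have "lderiv M (hpart M (br (X g) (Y g))) V g = - br (hpart M (br (X g) (Y g))) (V g)"
    by (rule vector_field_deriv_h[OF V hpart_in])
  finally have c: "lderiv M (X g) (lderiv M (Y g) V) g = lderiv M (Y g) (lderiv M (X g) V) g
      - br (hpart M (br (X g) (Y g))) (V g) + lderiv M (tor (X g) (Y g)) V g"
    by (simp add: algebra_simps)
  have b: "nabla M t (vf_bracket M X Y) V g
      = lderiv M (lderiv M (X g) Y g) V g - lderiv M (lderiv M (Y g) X g) V g + lderiv M (tor (X g) (Y g)) V g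
        + t *\<^sub>R (tor (lderiv M (X g) Y g) (V g) - tor (lderiv M (Y g) X g) (V g) + tor (tor (X g) (Y g)) (V g))"
    by (simp add: nabla_def vf_bracket_def tor_def[symmetric] linear_add[OF lin] linear_diff[OF lin]
        T.add_left T.diff_left)
  show ?thesis
    unfolding curvature_op_def nn[OF X] nn[OF Y] b c
    by (simp add: algebra_simps)
qed

lemma curvature_eq:
  assumes "x \<in> \<mm>" "y \<in> \<mm>" "v \<in> \<mm>"
  shows "curvature M t g x y v = - br (hpart M (br x y)) v - t *\<^sub>R tor (tor x y) v
    + (t * t) *\<^sub>R (tor x (tor y v) - tor y (tor x v))"
  unfolding curvature_def
proof (rule the_equality)
  fix w assume *: "\<forall>X Y V. vector_field M X \<and> vector_field M Y \<and> vector_field M V \<and>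
        X g = x \<and> Y g = y \<and> V g = v \<longrightarrow> curvature_op M t X Y V g = w"
  obtain X Y V where "vector_field M X" "X g = x" "vector_field M Y" "Y g = y" "vector_field M V" "V g = v"
    using vector_field_exists assms by metis
  then show "w = - br (hpart M (br x y)) v - t *\<^sub>R tor (tor x y) v
      + (t * t) *\<^sub>R (tor x (tor y v) - tor y (tor x v))"
    using * curvature_op_eq by metis
qed (use curvature_op_eq in blast)

text \<open>Invariance of \<open>Q\<close> moves a factor across the bracket in each diagonal term:
  the \<open>h\<close>-bracket contributes \<open>Q_h\<close>, the term linear in \<open>t\<close>
  contributes \<open>t * Q_m\<close>, and since \<open>tor y y = 0\<close> only
  \<open>- t * t * Q_m\<close> survives of the quadratic one.\<close>

lemma scal_eq:
  assumes Z: "\<And>i. i \<in> {1..dim \<mm>} \<Longrightarrow> Z i \<in> \<mm>"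
  shows "scal M Z t g = (\<Sum>i=1..dim \<mm>. \<Sum>j=1..dim \<mm>. Q_h M Q (br (Z i) (Z j)) (br (Z i) (Z j)))
    + (t - t * t) * (\<Sum>i=1..dim \<mm>. \<Sum>j=1..dim \<mm>. Q_m M (br (Z i) (Z j)) (br (Z i) (Z j)))"
proof -
  have tor_m: "tor x y \<in> \<mm>" for x y by (simp add: tor_def)
  have tm: "metric M (curvature M t g x y y) x
      = Q_h M Q (br x y) (br x y) + (t - t * t) * Q_m M (br x y) (br x y)"
    if x: "x \<in> \<mm>" and y: "y \<in> \<mm>" for x y
  proof -
    have tt: "tor y y = 0" for y
      by (simp add: tor_def lie_bracket_def linear_0[OF linear_mpart])
    have t1: "Q (br (hpart M (br x y)) y) x = - Q_h M Q (br x y) (br x y)"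
    proof -
      have "Q (br (hpart M (br x y)) y) x = Q (hpart M (br x y)) (br y x)"
        by (rule Q_bracket_assoc)
      also have "\<dots> = - Q (br x y) (hpart M (br x y))"
        using lie_bracket_anti[of y x] by (simp add: Q_simps Q_sym)
      also have "\<dots> = - Q_h M Q (br x y) (br x y)"
        using Q_hpart[OF hpart_in, of "br x y" "br x y"] by (simp add: Q_h_def)
      finally show ?thesis .
    qed
    have torQ: "Q (tor a b) c = Q (br a b) c" if "c \<in> \<mm>" for a b c
      using Q_mpart[OF that, of "br a b"] Q_metric[OF mpart_in that] by (simp add: tor_def)
    have t2: "Q (tor (tor x y) y) x = - Q_m M (br x y) (br x y)"
    proof -
      have "Q (tor (tor x y) y) x = Q (tor x y) (br y x)"
        using torQ[OF x] Q_bracket_assoc by simp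
      also have "\<dots> = - Q (br x y) (tor x y)"
        using lie_bracket_anti[of y x] by (simp add: Q_simps Q_sym)
      also have "\<dots> = - Q_m M (br x y) (br x y)"
        using Q_mpart[OF tor_m, of "br x y"] by (simp add: Q_m_def tor_def)
      finally show ?thesis .
    qed
    have t3: "Q (tor y (tor x y)) x = Q_m M (br x y) (br x y)"
    proof -
      have "tor y (tor x y) = - tor (tor x y) y"
        using lie_bracket_anti[of y "tor x y"] linear_neg[OF linear_mpart] by (simp add: tor_def)
      then show ?thesis using t2 by (simp add: Q_simps)
    qed
    have "curvature M t g x y y \<in> \<mm>"
      unfolding curvature_eq[OF x y y]
      by (intro subspace_add[OF subspace_m] subspace_diff[OF subspace_m] subspace_scale[OF subspace_m]
          subspace_neg[OF subspace_m] bracket_h_m tor_m hpart_in y)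
    then have "metric M (curvature M t g x y y) x = Q (curvature M t g x y y) x"
      using Q_metric x by simp
    also have "\<dots> = Q_h M Q (br x y) (br x y) + (t - t * t) * Q_m M (br x y) (br x y)"
      unfolding curvature_eq[OF x y y] tt
      using bounded_bilinear.zero_right[OF bounded_bilinear_tor, of x]
      by (simp add: Q_simps t1 t2 t3 algebra_simps)
    finally show ?thesis .
  qed
  have "scal M Z t g = (\<Sum>i=1..dim \<mm>. \<Sum>j=1..dim \<mm>.
      Q_h M Q (br (Z i) (Z j)) (br (Z i) (Z j)) + (t - t * t) * Q_m M (br (Z i) (Z j)) (br (Z i) (Z j)))"
    unfolding scal_def ricci_def by (intro sum.cong refl tm Z)
  then show ?thesis by (simp add: sum.distrib sum_distrib_left)
qed

end

section \<open>Cubic elements of Clifford algebras\<close>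

lemma sum3_rot:
  "(\<Sum>i\<in>I. \<Sum>j\<in>I. \<Sum>k\<in>I. f i j k) = (\<Sum>i\<in>I. \<Sum>j\<in>I. \<Sum>k\<in>I. f j k i)"
proof -
  have "(\<Sum>i\<in>I. \<Sum>j\<in>I. \<Sum>k\<in>I. f j k i) = (\<Sum>j\<in>I. \<Sum>i\<in>I. \<Sum>k\<in>I. f j k i)"
    by (rule sum.swap)
  also have "\<dots> = (\<Sum>j\<in>I. \<Sum>k\<in>I. \<Sum>i\<in>I. f j k i)"
    by (intro sum.cong refl sum.swap)
  finally show ?thesis by simp
qed

lemma triple_cancel:
  fixes a b :: "'a::real_vector"
  assumes "a + a + a = b + b + b"
  shows "a = b"
proof -
  have "(1 + 1 + 1 :: real) *\<^sub>R a = (1 + 1 + 1 :: real) *\<^sub>R b"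
    using assms by (simp only: scaleR_add_left scaleR_one)
  then show ?thesis by (simp only: scaleR_cancel_left) simp
qed

lemma double_eqI:
  fixes a :: "'a::ab_group_add"
  assumes "a = - a - (b + c) - d"
  shows "a + a = - (b + d) - c"
proof -
  have "a + a = a + (- a - (b + c) - d)" using assms by simp
  then show ?thesis by simp
qed

text \<open>Only the relations are assumed, not linear independence of the monomials: every identity
  is obtained by reordering products, never by comparing coefficients.\<close>

locale clifford_frame =
  fixes I :: "'i set" and e :: "'i \<Rightarrow> 'c::real_algebra_1"
  assumes fin: "finite I"
    and anticommute: "\<And>i j. i \<in> I \<Longrightarrow> j \<in> I \<Longrightarrow> e i * e j + e j * e i = (if i = j then - 2 *\<^sub>R 1 else 0)"
begin

abbreviation delta :: "'i \<Rightarrow> 'i \<Rightarrow> real" where "delta i j \<equiv> (if i = j then 1 else 0)"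

lemma e_square: "i \<in> I \<Longrightarrow> e i * e i = - 1"
proof -
  assume "i \<in> I"
  then have "(2::real) *\<^sub>R (e i * e i) = (2::real) *\<^sub>R (- 1)"
    using anticommute[of i i] by (simp add: scaleR_2)
  then show ?thesis by (simp only: scaleR_cancel_left) simp
qed

lemma e_swap: "i \<in> I \<Longrightarrow> j \<in> I \<Longrightarrow> e i * e j = - (e j * e i) - (2 * delta i j) *\<^sub>R 1"
  using anticommute[of i j]
  by (cases "i = j") (simp_all add: e_square eq_neg_iff_add_eq_0 scaleR_2)

lemma e_swap_pair:
  assumes "i \<in> I" "j \<in> I" "l \<in> I"
  shows "e i * e j * e l = e l * e i * e j + (2 * delta i l) *\<^sub>R e j - (2 * delta j l) *\<^sub>R e i"
proof -
  have "e i * e j * e l = e i * (- (e l * e j) - (2 * delta j l) *\<^sub>R 1)"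
    using e_swap[of j l] assms by (simp add: mult.assoc)
  also have "\<dots> = - (e i * e l) * e j - (2 * delta j l) *\<^sub>R e i"
    by (simp add: algebra_simps)
  also have "\<dots> = e l * e i * e j + (2 * delta i l) *\<^sub>R e j - (2 * delta j l) *\<^sub>R e i"
    unfolding e_swap[OF assms(1,3)] by (simp add: algebra_simps)
  finally show ?thesis .
qed

lemma e_swap_triple:
  assumes "i \<in> I" "j \<in> I" "k \<in> I" "l \<in> I"
  shows "e l * (e i * e j * e k) + e i * e j * e k * e l
    = - ((2 * delta i l) *\<^sub>R (e j * e k)) + (2 * delta j l) *\<^sub>R (e i * e k) - (2 * delta k l) *\<^sub>R (e i * e j)"
proof -
  have "e i * e j * e k * e l = - (e i * e j * e l * e k) - (2 * delta k l) *\<^sub>R (e i * e j)"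
    using e_swap[of k l] assms by (simp add: mult.assoc) (simp add: algebra_simps)
  also have "e i * e j * e l * e k = (e l * e i * e j + (2 * delta i l) *\<^sub>R e j - (2 * delta j l) *\<^sub>R e i) * e k"
    using e_swap_pair[of i j l] assms by simp
  finally show ?thesis by (simp add: algebra_simps)
qed

text \<open>Interchanging the summation indices and averaging replaces \<open>e i * e j\<close> by
  half of the anticommutator.\<close>

lemma sum_symmetric_e_e:
  assumes "\<And>i j. i \<in> I \<Longrightarrow> j \<in> I \<Longrightarrow> b i j = b j i"
  shows "(\<Sum>i\<in>I. \<Sum>j\<in>I. b i j *\<^sub>R (e i * e j)) = - (\<Sum>i\<in>I. b i i) *\<^sub>R 1"
proof -
  let ?S = "\<Sum>i\<in>I. \<Sum>j\<in>I. b i j *\<^sub>R (e i * e j)"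
  have "?S = (\<Sum>i\<in>I. \<Sum>j\<in>I. b i j *\<^sub>R (e j * e i))"
    by (subst sum.swap) (intro sum.cong refl, simp add: assms)
  then have "?S + ?S = (\<Sum>i\<in>I. \<Sum>j\<in>I. b i j *\<^sub>R (e i * e j + e j * e i))"
    by (simp add: sum.distrib scaleR_add_right)
  also have "\<dots> = (\<Sum>i\<in>I. \<Sum>j\<in>I. (if i = j then (- 2 * b i j) *\<^sub>R 1 else 0))"
    by (intro sum.cong refl) (auto simp: anticommute)
  also have "\<dots> = (\<Sum>i\<in>I. (- 2 * b i i) *\<^sub>R 1)"
    using fin by simp
  also have "\<dots> = (-2 * (\<Sum>i\<in>I. b i i)) *\<^sub>R 1"
    by (simp only: sum_distrib_left scaleR_left.sum)
  finally have "(2::real) *\<^sub>R ?S = (2::real) *\<^sub>R (- (\<Sum>i\<in>I. b i i) *\<^sub>R 1)"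
    by (simp add: scaleR_2)
  then show ?thesis by (simp only: scaleR_cancel_left) simp
qed

text \<open>Bivectors act on vectors as infinitesimal rotations. Of the factor 4, one 2 comes from
  the Clifford relation and another from the antisymmetry of \<open>a\<close>; it is balanced by the
  factor 1/4 in \<open>ad_lift\<close>.\<close>

lemma bivector_commute:
  assumes "\<And>i j. i \<in> I \<Longrightarrow> j \<in> I \<Longrightarrow> a j i = - a i j" and l: "l \<in> I"
  shows "(\<Sum>i\<in>I. \<Sum>j\<in>I. a i j *\<^sub>R (e i * e j)) * e l - e l * (\<Sum>i\<in>I. \<Sum>j\<in>I. a i j *\<^sub>R (e i * e j))
    = 4 *\<^sub>R (\<Sum>j\<in>I. a l j *\<^sub>R e j)"
proof -
  have "(\<Sum>i\<in>I. \<Sum>j\<in>I. a i j *\<^sub>R (e i * e j)) * e l - e l * (\<Sum>i\<in>I. \<Sum>j\<in>I. a i j *\<^sub>R (e i * e j))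
      = (\<Sum>i\<in>I. \<Sum>j\<in>I. a i j *\<^sub>R (e i * e j * e l - e l * e i * e j))"
    by (simp add: sum_distrib_left sum_distrib_right sum_subtractf scaleR_right_diff_distrib mult.assoc)
  also have "\<dots> = (\<Sum>i\<in>I. \<Sum>j\<in>I. (if i = l then (2 * a i j) *\<^sub>R e j else 0)
      - (if j = l then (2 * a i j) *\<^sub>R e i else 0))"
    by (intro sum.cong refl, subst e_swap_pair)
      (use l in \<open>auto simp: scaleR_right_diff_distrib mult.commute\<close>)
  also have "\<dots> = (\<Sum>j\<in>I. (2 * a l j) *\<^sub>R e j) - (\<Sum>i\<in>I. (2 * a i l) *\<^sub>R e i)"
  proof -
    have "(\<Sum>i\<in>I. \<Sum>j\<in>I. if i = l then (2 * a i j) *\<^sub>R e j else 0)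
        = (\<Sum>i\<in>I. if i = l then (\<Sum>j\<in>I. (2 * a i j) *\<^sub>R e j) else 0)"
      by (intro sum.cong refl) simp
    then show ?thesis using fin l by (simp add: sum_subtractf)
  qed
  also have "\<dots> = (\<Sum>j\<in>I. (4 * a l j) *\<^sub>R e j)"
    unfolding sum_subtractf[symmetric]
  proof (intro sum.cong refl)
    fix j assume "j \<in> I"
    then have "2 * a l j - 2 * a j l = 4 * a l j" using assms(1)[OF l, of j] by simp
    then show "(2 * a l j) *\<^sub>R e j - (2 * a j l) *\<^sub>R e j = (4 * a l j) *\<^sub>R e j"
      by (simp only: scaleR_left_diff_distrib[symmetric])
  qed
  finally show ?thesis by (simp add: scaleR_sum_right)
qed

text \<open>The Bianchi identity kills the part of degree four, as in the Lichnerowicz formula.\<close>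

lemma sum_curvature_like:
  assumes anti: "\<And>i j k l. i \<in> I \<Longrightarrow> j \<in> I \<Longrightarrow> k \<in> I \<Longrightarrow> l \<in> I \<Longrightarrow> S j i k l = - S i j k l"
    and pair: "\<And>i j k l. i \<in> I \<Longrightarrow> j \<in> I \<Longrightarrow> k \<in> I \<Longrightarrow> l \<in> I \<Longrightarrow> S k l i j = S i j k l"
    and bianchi: "\<And>i j k l. i \<in> I \<Longrightarrow> j \<in> I \<Longrightarrow> k \<in> I \<Longrightarrow> l \<in> I
      \<Longrightarrow> S i j k l + S j k i l + S k i j l = 0"
  shows "(\<Sum>i\<in>I. \<Sum>j\<in>I. \<Sum>k\<in>I. \<Sum>l\<in>I. S i j k l *\<^sub>R (e i * e j * e k * e l))
    = (-2 * (\<Sum>i\<in>I. \<Sum>j\<in>I. S i j i j)) *\<^sub>R 1"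
proof -
  \<comment> \<open>With the last index frozen the sum is cubic and the Bianchi identity runs over
    exactly its three indices.\<close>
  define X where "X l = (\<Sum>i\<in>I. \<Sum>j\<in>I. \<Sum>k\<in>I. S i j k l *\<^sub>R (e i * e j * e k))" for l
  have X: "X l = (\<Sum>j\<in>I. (2 * (\<Sum>i\<in>I. S i j i l)) *\<^sub>R e j)" if l: "l \<in> I" for l
  proof -
    define f where "f i j k = S i j k l *\<^sub>R (e i * e j * e k)" for i j k
    have zero: "S i i j l = 0" if "i \<in> I" "j \<in> I" for i j
      using anti[of i i j l] that l by simp
    \<comment> \<open>Cyclic averaging: the rotated monomials agree with
      \<open>e i * e j * e k\<close> up to terms of degree one, so the cubic monomial gets the
      coefficient of \<open>bianchi\<close>, which is zero, and only contractions remain.\<close>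
    have "(\<Sum>i\<in>I. \<Sum>j\<in>I. \<Sum>k\<in>I. f i j k + f j k i + f k i j) = X l + X l + X l"
      using sum3_rot[of f I] sum3_rot[of "\<lambda>i j k. f j k i" I]
      by (simp add: sum.distrib X_def f_def)
    moreover have "f i j k + f j k i + f k i j =
        (if i = j then (2 * S j k i l) *\<^sub>R e k else 0) - (if i = k then (2 * S j k i l) *\<^sub>R e j else 0)
        + (if j = k then (2 * S k i j l) *\<^sub>R e i else 0)" if ijk: "i \<in> I" "j \<in> I" "k \<in> I" for i j k
    proof -
      have 1: "e j * e k * e i = e i * e j * e k + (2 * delta i j) *\<^sub>R e k - (2 * delta i k) *\<^sub>R e j"
        using e_swap_pair[of j k i] ijk by (auto simp: algebra_simps)
      have 2: "e k * e i * e j = e i * e j * e k + (2 * delta j k) *\<^sub>R e i - (2 * delta i k) *\<^sub>R e j"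
        using e_swap_pair[of i j k] ijk by (auto simp: algebra_simps)
      have "f i j k + f j k i + f k i j = (S i j k l + S j k i l + S k i j l) *\<^sub>R (e i * e j * e k)
          + S j k i l *\<^sub>R ((2 * delta i j) *\<^sub>R e k - (2 * delta i k) *\<^sub>R e j)
          + S k i j l *\<^sub>R ((2 * delta j k) *\<^sub>R e i - (2 * delta i k) *\<^sub>R e j)"
        unfolding f_def 1 2 by (simp add: algebra_simps)
      also have "S i j k l + S j k i l + S k i j l = 0"
        using bianchi ijk l by blast
      finally show ?thesis
        using zero[of i j] zero[of i k] ijk
        by (cases "i = j"; cases "i = k"; cases "j = k")
          (simp_all add: scaleR_right_diff_distrib mult.commute)
    qed
    ultimately have "X l + X l + X l = (\<Sum>i\<in>I. \<Sum>j\<in>I. \<Sum>k\<in>I.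
        (if i = j then (2 * S j k i l) *\<^sub>R e k else 0) - (if i = k then (2 * S j k i l) *\<^sub>R e j else 0)
        + (if j = k then (2 * S k i j l) *\<^sub>R e i else 0))"
      by (simp cong: sum.cong)
    also have "\<dots> = (\<Sum>i\<in>I. \<Sum>j\<in>I. \<Sum>k\<in>I. if i = j then (2 * S j k i l) *\<^sub>R e k else 0)
       - (\<Sum>i\<in>I. \<Sum>j\<in>I. \<Sum>k\<in>I. if i = k then (2 * S j k i l) *\<^sub>R e j else 0)
       + (\<Sum>i\<in>I. \<Sum>j\<in>I. \<Sum>k\<in>I. if j = k then (2 * S k i j l) *\<^sub>R e i else 0)"
      by (simp only: sum.distrib sum_subtractf)
    also have "(\<Sum>i\<in>I. \<Sum>j\<in>I. \<Sum>k\<in>I. if i = j then (2 * S j k i l) *\<^sub>R e k else 0)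
        = (\<Sum>j\<in>I. \<Sum>i\<in>I. (2 * S i j i l) *\<^sub>R e j)"
    proof -
      have "(\<Sum>i\<in>I. \<Sum>j\<in>I. \<Sum>k\<in>I. if i = j then (2 * S j k i l) *\<^sub>R e k else 0)
          = (\<Sum>i\<in>I. \<Sum>j\<in>I. if i = j then (\<Sum>k\<in>I. (2 * S j k i l) *\<^sub>R e k) else 0)"
        by (intro sum.cong refl) simp
      also have "\<dots> = (\<Sum>i\<in>I. \<Sum>k\<in>I. (2 * S i k i l) *\<^sub>R e k)" using fin by simp
      also have "\<dots> = (\<Sum>j\<in>I. \<Sum>i\<in>I. (2 * S i j i l) *\<^sub>R e j)" by (rule sum.swap)
      finally show ?thesis .
    qed
    also have "(\<Sum>i\<in>I. \<Sum>j\<in>I. \<Sum>k\<in>I. if i = k then (2 * S j k i l) *\<^sub>R e j else 0)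
        = - (\<Sum>j\<in>I. \<Sum>i\<in>I. (2 * S i j i l) *\<^sub>R e j)"
    proof -
      have "(\<Sum>i\<in>I. \<Sum>j\<in>I. \<Sum>k\<in>I. if i = k then (2 * S j k i l) *\<^sub>R e j else 0)
         = (\<Sum>i\<in>I. \<Sum>j\<in>I. (2 * S j i i l) *\<^sub>R e j)" using fin by simp
      also have "\<dots> = (\<Sum>j\<in>I. \<Sum>i\<in>I. (2 * S j i i l) *\<^sub>R e j)" by (rule sum.swap)
      also have "\<dots> = (\<Sum>j\<in>I. \<Sum>i\<in>I. - ((2 * S i j i l) *\<^sub>R e j))"
        by (intro sum.cong refl) (metis (no_types) anti l mult_minus_right scaleR_minus_left)
      finally show ?thesis by (simp only: sum_negf)
    qed
    also have "(\<Sum>i\<in>I. \<Sum>j\<in>I. \<Sum>k\<in>I. if j = k then (2 * S k i j l) *\<^sub>R e i else 0)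
        = (\<Sum>j\<in>I. \<Sum>i\<in>I. (2 * S i j i l) *\<^sub>R e j)" using fin by simp
    finally have "X l = (\<Sum>j\<in>I. \<Sum>i\<in>I. (2 * S i j i l) *\<^sub>R e j)"
      by - (rule triple_cancel, simp)
    then show ?thesis
      by (simp only: sum_distrib_left scaleR_left.sum)
  qed
  have "(\<Sum>i\<in>I. \<Sum>j\<in>I. \<Sum>k\<in>I. \<Sum>l\<in>I. S i j k l *\<^sub>R (e i * e j * e k * e l)) = (\<Sum>l\<in>I. X l * e l)"
  proof -
    have "(\<Sum>i\<in>I. \<Sum>j\<in>I. \<Sum>k\<in>I. \<Sum>l\<in>I. S i j k l *\<^sub>R (e i * e j * e k * e l))
       = (\<Sum>i\<in>I. \<Sum>j\<in>I. \<Sum>l\<in>I. \<Sum>k\<in>I. S i j k l *\<^sub>R (e i * e j * e k * e l))"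
      by (intro sum.cong refl sum.swap)
    also have "\<dots> = (\<Sum>i\<in>I. \<Sum>l\<in>I. \<Sum>j\<in>I. \<Sum>k\<in>I. S i j k l *\<^sub>R (e i * e j * e k * e l))"
      by (intro sum.cong refl sum.swap)
    also have "\<dots> = (\<Sum>l\<in>I. \<Sum>i\<in>I. \<Sum>j\<in>I. \<Sum>k\<in>I. S i j k l *\<^sub>R (e i * e j * e k * e l))"
      by (rule sum.swap)
    finally show ?thesis by (simp add: X_def sum_distrib_right)
  qed
  also have "\<dots> = (\<Sum>l\<in>I. \<Sum>j\<in>I. (2 * (\<Sum>i\<in>I. S i j i l)) *\<^sub>R (e j * e l))"
    by (intro sum.cong refl) (simp add: X sum_distrib_right)
  also have "\<dots> = (\<Sum>j\<in>I. \<Sum>l\<in>I. (2 * (\<Sum>i\<in>I. S i j i l)) *\<^sub>R (e j * e l))"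
    by (rule sum.swap)
  \<comment> \<open>Pair symmetry makes the contraction \<open>\<Sum>i\<in>I. S i j i l\<close>
    symmetric in \<open>j\<close> and \<open>l\<close>.\<close>
  also have "\<dots> = - (\<Sum>j\<in>I. 2 * (\<Sum>i\<in>I. S i j i j)) *\<^sub>R 1"
    by (rule sum_symmetric_e_e) (auto intro!: sum.cong pair)
  also have "(\<Sum>j\<in>I. 2 * (\<Sum>i\<in>I. S i j i j)) = 2 * (\<Sum>i\<in>I. \<Sum>j\<in>I. S i j i j)"
    using sum.swap[of "\<lambda>i j. S i j i j" I I] by (simp only: sum_distrib_left[symmetric])
  finally show ?thesis by simp
qed

end

section \<open>The cubic element of a 3-form and its square\<close>

locale clifford_frame_3form = clifford_frame I e
  for I :: "'i set" and e :: "'i \<Rightarrow> 'c::real_algebra_1" +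
  fixes c :: "'i \<Rightarrow> 'i \<Rightarrow> 'i \<Rightarrow> real"
  assumes c_swap12: "\<And>i j k. i \<in> I \<Longrightarrow> j \<in> I \<Longrightarrow> k \<in> I \<Longrightarrow> c j i k = - c i j k"
    and c_swap23: "\<And>i j k. i \<in> I \<Longrightarrow> j \<in> I \<Longrightarrow> k \<in> I \<Longrightarrow> c i k j = - c i j k"
begin

lemma c_rot: "i \<in> I \<Longrightarrow> j \<in> I \<Longrightarrow> k \<in> I \<Longrightarrow> c j k i = c i j k"
  using c_swap12[of i j k] c_swap23[of j i k] by simp

lemma c_rot': "i \<in> I \<Longrightarrow> j \<in> I \<Longrightarrow> k \<in> I \<Longrightarrow> c k i j = c i j k"
  using c_rot by simp

definition A :: "'i \<Rightarrow> 'c" where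
  "A p = (\<Sum>i\<in>I. \<Sum>j\<in>I. c i j p *\<^sub>R (e i * e j))"

definition H :: 'c where
  "H = (1/4) *\<^sub>R (\<Sum>i\<in>I. \<Sum>j\<in>I. \<Sum>k\<in>I. c i j k *\<^sub>R (e i * e j * e k))"

definition N :: real where
  "N = (\<Sum>i\<in>I. \<Sum>j\<in>I. \<Sum>k\<in>I. c i j k * c i j k)"

definition B :: "'i \<Rightarrow> 'i \<Rightarrow> real" where
  "B p q = (\<Sum>i\<in>I. \<Sum>j\<in>I. c i j p * c i j q)"

lemma sum_B: "(\<Sum>p\<in>I. \<Sum>q\<in>I. B p q *\<^sub>R (e p * e q)) = - N *\<^sub>R 1"
proof -
  have "(\<Sum>p\<in>I. \<Sum>q\<in>I. B p q *\<^sub>R (e p * e q)) = - (\<Sum>p\<in>I. B p p) *\<^sub>R 1"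
    by (rule sum_symmetric_e_e) (simp add: B_def mult.commute)
  also have "(\<Sum>p\<in>I. B p p) = N"
    unfolding B_def N_def by (rule sum3_rot[symmetric])
  finally show ?thesis .
qed

lemma H_eq: "H = (1/4) *\<^sub>R (\<Sum>p\<in>I. A p * e p)"
proof -
  have "(\<Sum>i\<in>I. \<Sum>j\<in>I. \<Sum>k\<in>I. c i j k *\<^sub>R (e i * e j * e k))
      = (\<Sum>k\<in>I. \<Sum>i\<in>I. \<Sum>j\<in>I. c i j k *\<^sub>R (e i * e j * e k))"
    by (rule sum3_rot)
  then show ?thesis
    by (simp add: H_def A_def sum_distrib_right)
qed

lemma A_commute:
  assumes "p \<in> I" "l \<in> I"
  shows "A p * e l = e l * A p + 4 *\<^sub>R (\<Sum>j\<in>I. c p l j *\<^sub>R e j)"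
proof -
  have "A p * e l - e l * A p = 4 *\<^sub>R (\<Sum>j\<in>I. c l j p *\<^sub>R e j)"
    unfolding A_def
    by (rule bivector_commute[where a="\<lambda>i j. c i j p", OF c_swap12[OF _ _ assms(1)] assms(2)])
  also have "(\<Sum>j\<in>I. c l j p *\<^sub>R e j) = (\<Sum>j\<in>I. c p l j *\<^sub>R e j)"
  proof (intro sum.cong refl)
    fix j assume "j \<in> I"
    with assms show "c l j p *\<^sub>R e j = c p l j *\<^sub>R e j" by (simp add: c_rot[of p l j])
  qed
  finally show ?thesis by (simp add: algebra_simps)
qed

text \<open>Carrying \<open>e l\<close> through three generators changes the sign three times, so in
  the anticommutator only the three contractions survive. By total antisymmetry each of them is
  \<open>- 2 *\<^sub>R A l\<close>, and the factor 1/4 in \<open>H\<close> makes -3/2 of the total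
  -6.\<close>

lemma H_anticommute:
  assumes l: "l \<in> I"
  shows "e l * H + H * e l = - (3/2) *\<^sub>R A l"
proof -
  have "e l * H + H * e l = (1/4) *\<^sub>R (\<Sum>i\<in>I. \<Sum>j\<in>I. \<Sum>k\<in>I.
      c i j k *\<^sub>R (e l * (e i * e j * e k) + e i * e j * e k * e l))"
    by (simp add: H_def sum_distrib_left sum_distrib_right sum.distrib scaleR_add_right)
  also have "(\<Sum>i\<in>I. \<Sum>j\<in>I. \<Sum>k\<in>I. c i j k *\<^sub>R (e l * (e i * e j * e k) + e i * e j * e k * e l))
      = (\<Sum>i\<in>I. \<Sum>j\<in>I. \<Sum>k\<in>I. (if j = l then (2 * c i j k) *\<^sub>R (e i * e k) else 0)
        - (if i = l then (2 * c i j k) *\<^sub>R (e j * e k) else 0)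
        - (if k = l then (2 * c i j k) *\<^sub>R (e i * e j) else 0))"
    by (intro sum.cong refl, subst e_swap_triple)
      (use l in \<open>auto simp: scaleR_right_diff_distrib scaleR_add_right mult.commute\<close>)
  also have "\<dots> = (\<Sum>i\<in>I. \<Sum>k\<in>I. (2 * c i l k) *\<^sub>R (e i * e k))
      - (\<Sum>j\<in>I. \<Sum>k\<in>I. (2 * c l j k) *\<^sub>R (e j * e k))
      - (\<Sum>i\<in>I. \<Sum>j\<in>I. (2 * c i j l) *\<^sub>R (e i * e j))"
  proof -
    have "(\<Sum>i\<in>I. \<Sum>j\<in>I. \<Sum>k\<in>I. if j = l then (2 * c i j k) *\<^sub>R (e i * e k) else 0)
        = (\<Sum>i\<in>I. \<Sum>j\<in>I. if j = l then (\<Sum>k\<in>I. (2 * c i j k) *\<^sub>R (e i * e k)) else 0)"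
      by (intro sum.cong refl) simp
    moreover have "(\<Sum>i\<in>I. \<Sum>j\<in>I. \<Sum>k\<in>I. if i = l then (2 * c i j k) *\<^sub>R (e j * e k) else 0)
        = (\<Sum>i\<in>I. if i = l then (\<Sum>j\<in>I. \<Sum>k\<in>I. (2 * c i j k) *\<^sub>R (e j * e k)) else 0)"
      by (intro sum.cong refl) simp
    ultimately show ?thesis using fin l by (simp add: sum_subtractf)
  qed
  also have "\<dots> = (\<Sum>i\<in>I. \<Sum>j\<in>I. (- 6 * c i j l) *\<^sub>R (e i * e j))"
    unfolding sum_subtractf[symmetric]
  proof (intro sum.cong refl)
    fix i j assume "i \<in> I" "j \<in> I"
    then have "2 * c i l j - 2 * c l i j - 2 * c i j l = - 6 * c i j l"
      using l c_swap23[of i j l] c_rot'[of i j l] by simp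
    then show "(2 * c i l j) *\<^sub>R (e i * e j) - (2 * c l i j) *\<^sub>R (e i * e j) - (2 * c i j l) *\<^sub>R (e i * e j)
        = (- 6 * c i j l) *\<^sub>R (e i * e j)"
      by (simp only: scaleR_left_diff_distrib[symmetric])
  qed
  also have "\<dots> = - 6 *\<^sub>R A l"
    by (simp add: A_def scaleR_sum_right)
  finally show ?thesis by simp
qed

text \<open>The commutator with \<open>A p\<close> is a derivation, so it hits the three factors of
  the monomials in \<open>H\<close> one at a time. Each of the three sums becomes
  \<open>\<Sum>p\<in>I. A p * A p\<close> once an \<open>A\<close> is assembled on the left; they
  differ only in the scalar paid for the reordering, namely \<open>4 * N\<close>,
  \<open>2 * N\<close> and 0.\<close>

lemma sum_commutator_A_H:
  "(\<Sum>p\<in>I. (A p * H - H * A p) * e p) = 3 *\<^sub>R (\<Sum>p\<in>I. A p * A p) + (6 * N) *\<^sub>R 1"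
proof -
  \<comment> \<open>By \<open>A_commute\<close>, \<open>4 *\<^sub>R d p i\<close> is the commutator
    of \<open>A p\<close> with \<open>e i\<close>; \<open>sum_d\<close> says that these vectors
    reassemble the bivectors.\<close>
  define d where "d p i = (\<Sum>q\<in>I. c p i q *\<^sub>R e q)" for p i
  have Ad: "A p * e i = e i * A p + 4 *\<^sub>R d p i" if "p \<in> I" "i \<in> I" for p i
    using A_commute[OF that] by (simp add: d_def)
  have sum_d: "(\<Sum>p\<in>I. d p k * e p) = A k" if "k \<in> I" for k
  proof -
    have "A k = (\<Sum>p\<in>I. \<Sum>q\<in>I. c q p k *\<^sub>R (e q * e p))"
      unfolding A_def by (rule sum.swap)
    also have "\<dots> = (\<Sum>p\<in>I. \<Sum>q\<in>I. c p k q *\<^sub>R (e q * e p))"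
      by (intro sum.cong refl) (use c_rot that in metis)
    finally show ?thesis by (simp add: d_def sum_distrib_right)
  qed
  have A_rot: "(\<Sum>j\<in>I. \<Sum>k\<in>I. c i j k *\<^sub>R (e j * e k)) = A i" if "i \<in> I" for i
    unfolding A_def by (intro sum.cong refl) (use c_rot that in metis)
  define T where "T p i j k = c i j k *\<^sub>R (d p i * e j * e k * e p) + c i j k *\<^sub>R (e i * d p j * e k * e p)
    + c i j k *\<^sub>R (e i * e j * d p k * e p)" for p i j k
  have comm: "A p * (e i * e j * e k) - e i * e j * e k * A p
      = 4 *\<^sub>R (d p i * e j * e k + e i * d p j * e k + e i * e j * d p k)"
    if "p \<in> I" "i \<in> I" "j \<in> I" "k \<in> I" for p i j k
  proof -
    have "A p * (e i * e j * e k) = (A p * e i) * e j * e k" by (simp add: mult.assoc)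
    also have "\<dots> = e i * (A p * e j) * e k + 4 *\<^sub>R (d p i * e j * e k)"
      using that by (simp add: Ad algebra_simps)
    also have "e i * (A p * e j) * e k = e i * e j * (A p * e k) + 4 *\<^sub>R (e i * d p j * e k)"
      using that by (simp add: Ad algebra_simps)
    also have "e i * e j * (A p * e k) = e i * e j * e k * A p + 4 *\<^sub>R (e i * e j * d p k)"
      using that by (simp add: Ad algebra_simps)
    finally show ?thesis by (simp add: scaleR_add_right)
  qed
  have "(A p * H - H * A p) * e p = (\<Sum>i\<in>I. \<Sum>j\<in>I. \<Sum>k\<in>I. T p i j k)" if "p \<in> I" for p
  proof -
    have "(A p * H - H * A p) * e p = (1/4) *\<^sub>R (\<Sum>i\<in>I. \<Sum>j\<in>I. \<Sum>k\<in>I.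
        c i j k *\<^sub>R ((A p * (e i * e j * e k) - e i * e j * e k * A p) * e p))"
      by (simp add: H_def sum_distrib_left sum_distrib_right sum_subtractf scaleR_right_diff_distrib
          left_diff_distrib scaleR_sum_right)
    also have "\<dots> = (\<Sum>i\<in>I. \<Sum>j\<in>I. \<Sum>k\<in>I. T p i j k)"
      unfolding scaleR_sum_right
      by (intro sum.cong refl) (simp add: comm that T_def scaleR_add_right distrib_right)
    finally show ?thesis .
  qed
  then have "(\<Sum>p\<in>I. (A p * H - H * A p) * e p) = (\<Sum>p\<in>I. \<Sum>i\<in>I. \<Sum>j\<in>I. \<Sum>k\<in>I. T p i j k)"
    by simp
  also have "\<dots> = (\<Sum>p\<in>I. \<Sum>i\<in>I. \<Sum>j\<in>I. \<Sum>k\<in>I. c i j k *\<^sub>R (d p i * e j * e k * e p))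
     + (\<Sum>p\<in>I. \<Sum>i\<in>I. \<Sum>j\<in>I. \<Sum>k\<in>I. c i j k *\<^sub>R (e i * d p j * e k * e p))
     + (\<Sum>p\<in>I. \<Sum>i\<in>I. \<Sum>j\<in>I. \<Sum>k\<in>I. c i j k *\<^sub>R (e i * e j * d p k * e p))"
    (is "_ = ?T1 + ?T2 + ?T3") unfolding T_def by (simp only: sum.distrib)
  also have "?T3 = (\<Sum>p\<in>I. A p * A p)"
  proof -
    have "(\<Sum>i\<in>I. \<Sum>j\<in>I. \<Sum>k\<in>I. c i j k *\<^sub>R (e i * e j * d p k * e p)) = (\<Sum>k\<in>I. A k * (d p k * e p))" for p
    proof -
      have "(\<Sum>i\<in>I. \<Sum>j\<in>I. \<Sum>k\<in>I. c i j k *\<^sub>R (e i * e j * d p k * e p))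
          = (\<Sum>k\<in>I. \<Sum>i\<in>I. \<Sum>j\<in>I. c i j k *\<^sub>R (e i * e j * d p k * e p))"
        by (rule sum3_rot)
      then show ?thesis by (simp add: A_def sum_distrib_right mult.assoc)
    qed
    then have "?T3 = (\<Sum>p\<in>I. \<Sum>k\<in>I. A k * (d p k * e p))" by simp
    also have "\<dots> = (\<Sum>k\<in>I. A k * (\<Sum>p\<in>I. d p k * e p))"
      by (subst sum.swap) (simp add: sum_distrib_left)
    also have "\<dots> = (\<Sum>k\<in>I. A k * A k)"
      by (simp add: sum_d)
    finally show ?thesis .
  qed
  \<comment> \<open>Here \<open>A i\<close> is assembled to the right of \<open>d p i\<close>.
    Moving it to the left costs a contraction that sums to \<open>B\<close>, and
    \<open>sum_B\<close> evaluates it to \<open>- N\<close>.\<close>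
  also have "?T1 = (\<Sum>p\<in>I. A p * A p) + (4 * N) *\<^sub>R 1"
  proof -
    have "?T1 = (\<Sum>p\<in>I. \<Sum>i\<in>I. d p i * (\<Sum>j\<in>I. \<Sum>k\<in>I. c i j k *\<^sub>R (e j * e k)) * e p)"
      by (simp add: sum_distrib_left sum_distrib_right mult.assoc)
    also have "\<dots> = (\<Sum>p\<in>I. \<Sum>i\<in>I. d p i * A i * e p)"
      by (intro sum.cong refl) (simp add: A_rot)
    also have "\<dots> = (\<Sum>p\<in>I. \<Sum>i\<in>I. A i * (d p i * e p) - 4 *\<^sub>R (\<Sum>q\<in>I. c p i q *\<^sub>R (d i q * e p)))"
    proof (intro sum.cong refl)
      fix p i assume pi: "p \<in> I" "i \<in> I"
      have "A i * d p i = (\<Sum>q\<in>I. c p i q *\<^sub>R (A i * e q))"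
        by (simp add: d_def sum_distrib_left)
      also have "\<dots> = (\<Sum>q\<in>I. c p i q *\<^sub>R (e q * A i + 4 *\<^sub>R d i q))"
        by (intro sum.cong refl) (simp add: Ad pi)
      also have "\<dots> = d p i * A i + 4 *\<^sub>R (\<Sum>q\<in>I. c p i q *\<^sub>R d i q)"
        by (simp add: d_def[of p] sum.distrib scaleR_add_right sum_distrib_right scaleR_sum_right mult.commute)
      finally have "d p i * A i = A i * d p i - 4 *\<^sub>R (\<Sum>q\<in>I. c p i q *\<^sub>R d i q)" by simp
      then show "d p i * A i * e p = A i * (d p i * e p) - 4 *\<^sub>R (\<Sum>q\<in>I. c p i q *\<^sub>R (d i q * e p))"
        by (simp add: left_diff_distrib mult.assoc sum_distrib_right)
    qed
    also have "\<dots> = (\<Sum>p\<in>I. \<Sum>i\<in>I. A i * (d p i * e p))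
        - 4 *\<^sub>R (\<Sum>p\<in>I. \<Sum>i\<in>I. \<Sum>q\<in>I. c p i q *\<^sub>R (d i q * e p))"
      by (simp only: sum_subtractf scaleR_sum_right)
    also have "(\<Sum>p\<in>I. \<Sum>i\<in>I. A i * (d p i * e p)) = (\<Sum>i\<in>I. A i * (\<Sum>p\<in>I. d p i * e p))"
      by (subst sum.swap) (simp add: sum_distrib_left)
    also have "\<dots> = (\<Sum>i\<in>I. A i * A i)" by (simp add: sum_d)
    also have "(\<Sum>p\<in>I. \<Sum>i\<in>I. \<Sum>q\<in>I. c p i q *\<^sub>R (d i q * e p))
        = (\<Sum>p\<in>I. \<Sum>m\<in>I. B m p *\<^sub>R (e m * e p))"
    proof (rule sum.cong[OF refl])
      fix p assume p: "p \<in> I"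
      have "(\<Sum>i\<in>I. \<Sum>q\<in>I. c p i q *\<^sub>R (d i q * e p))
          = (\<Sum>i\<in>I. \<Sum>q\<in>I. \<Sum>m\<in>I. (c i q m * c i q p) *\<^sub>R (e m * e p))"
        unfolding d_def sum_distrib_right scaleR_sum_right
      proof (intro sum.cong refl)
        fix i q m assume "i \<in> I" "q \<in> I"
        then have "c p i q = c i q p" using c_rot[of p i q] p by simp
        then show "c p i q *\<^sub>R (c i q m *\<^sub>R e m * e p) = (c i q m * c i q p) *\<^sub>R (e m * e p)"
          by simp
      qed
      also have "\<dots> = (\<Sum>m\<in>I. \<Sum>i\<in>I. \<Sum>q\<in>I. (c i q m * c i q p) *\<^sub>R (e m * e p))"
        by (rule sum3_rot)
      also have "\<dots> = (\<Sum>m\<in>I. B m p *\<^sub>R (e m * e p))"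
        by (simp add: B_def scaleR_sum_left)
      finally show "(\<Sum>i\<in>I. \<Sum>q\<in>I. c p i q *\<^sub>R (d i q * e p)) = (\<Sum>m\<in>I. B m p *\<^sub>R (e m * e p))" .
    qed
    also have "\<dots> = - N *\<^sub>R 1"
      using sum_B by (subst sum.swap)
    finally show ?thesis by simp
  qed
  \<comment> \<open>Exchanging \<open>d p j\<close> with \<open>e k\<close> costs a sign, absorbed
    by the antisymmetry of \<open>c\<close> when \<open>A j\<close> is assembled, and a contraction
    whose sum is \<open>- 2\<close> times the one in \<open>sum_B\<close>.\<close>
  also have "?T2 = (\<Sum>p\<in>I. A p * A p) + (2 * N) *\<^sub>R 1"
  proof -
    have "?T2 = (\<Sum>p\<in>I. \<Sum>i\<in>I. \<Sum>j\<in>I. - (\<Sum>k\<in>I. c i j k *\<^sub>R (e i * e k) * (d p j * e p))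
        - (2 * (\<Sum>k\<in>I. c i j k * c p j k)) *\<^sub>R (e i * e p))"
    proof (intro sum.cong refl)
      fix p i j assume pij: "p \<in> I" "i \<in> I" "j \<in> I"
      have dk: "d p j * e k = - (e k * d p j) - (2 * c p j k) *\<^sub>R 1" if k: "k \<in> I" for k
      proof -
        have "d p j * e k = (\<Sum>q\<in>I. - (c p j q *\<^sub>R (e k * e q)) - (if q = k then (2 * c p j q) *\<^sub>R 1 else 0))"
          unfolding d_def sum_distrib_right
          by (intro sum.cong refl) (simp add: e_swap[of _ k] k scaleR_right_diff_distrib mult.commute)
        then show ?thesis
          using fin k by (simp add: sum_subtractf sum_negf d_def sum_distrib_left)
      qed
      have "c i j k *\<^sub>R (e i * d p j * e k * e p) = - (c i j k *\<^sub>R (e i * e k) * (d p j * e p))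
          - (2 * (c i j k * c p j k)) *\<^sub>R (e i * e p)" if k: "k \<in> I" for k
      proof -
        have "e i * d p j * e k * e p = e i * (d p j * e k) * e p" by (simp add: mult.assoc)
        also have "\<dots> = - (e i * e k * (d p j * e p)) - (2 * c p j k) *\<^sub>R (e i * e p)"
          unfolding dk[OF k] by (simp add: algebra_simps)
        finally show ?thesis by (simp add: scaleR_right_diff_distrib mult.left_commute)
      qed
      then show "(\<Sum>k\<in>I. c i j k *\<^sub>R (e i * d p j * e k * e p))
          = - (\<Sum>k\<in>I. c i j k *\<^sub>R (e i * e k) * (d p j * e p))
            - (2 * (\<Sum>k\<in>I. c i j k * c p j k)) *\<^sub>R (e i * e p)"
        by (simp add: sum_subtractf sum_negf sum_distrib_left scaleR_sum_left)
    qed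
    also have "\<dots> = (\<Sum>p\<in>I. \<Sum>i\<in>I. \<Sum>j\<in>I. - (\<Sum>k\<in>I. c i j k *\<^sub>R (e i * e k) * (d p j * e p)))
       - (\<Sum>p\<in>I. \<Sum>i\<in>I. \<Sum>j\<in>I. (2 * (\<Sum>k\<in>I. c i j k * c p j k)) *\<^sub>R (e i * e p))"
      by (simp only: sum_subtractf)
    also have "(\<Sum>p\<in>I. \<Sum>i\<in>I. \<Sum>j\<in>I. - (\<Sum>k\<in>I. c i j k *\<^sub>R (e i * e k) * (d p j * e p)))
        = (\<Sum>p\<in>I. \<Sum>j\<in>I. A j * (d p j * e p))"
    proof (rule sum.cong[OF refl])
      fix p assume p: "p \<in> I"
      have "(\<Sum>i\<in>I. \<Sum>j\<in>I. - (\<Sum>k\<in>I. c i j k *\<^sub>R (e i * e k) * (d p j * e p)))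
          = (\<Sum>j\<in>I. \<Sum>i\<in>I. - (\<Sum>k\<in>I. c i j k *\<^sub>R (e i * e k) * (d p j * e p)))"
        by (rule sum.swap)
      also have "\<dots> = (\<Sum>j\<in>I. \<Sum>i\<in>I. \<Sum>k\<in>I. c i k j *\<^sub>R (e i * e k) * (d p j * e p))"
        unfolding sum_negf[symmetric]
        by (intro sum.cong refl) (metis c_swap23 mult_minus_left scaleR_minus_left)
      finally show "(\<Sum>i\<in>I. \<Sum>j\<in>I. - (\<Sum>k\<in>I. c i j k *\<^sub>R (e i * e k) * (d p j * e p)))
          = (\<Sum>j\<in>I. A j * (d p j * e p))"
        by (simp add: A_def sum_distrib_right)
    qed
    also have "\<dots> = (\<Sum>j\<in>I. A j * (\<Sum>p\<in>I. d p j * e p))"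
      by (subst sum.swap) (simp add: sum_distrib_left)
    also have "\<dots> = (\<Sum>j\<in>I. A j * A j)" by (simp add: sum_d)
    also have "(\<Sum>p\<in>I. \<Sum>i\<in>I. \<Sum>j\<in>I. (2 * (\<Sum>k\<in>I. c i j k * c p j k)) *\<^sub>R (e i * e p))
        = (\<Sum>p\<in>I. \<Sum>i\<in>I. (2 * B i p) *\<^sub>R (e i * e p))"
    proof (intro sum.cong refl)
      fix p i assume pi: "p \<in> I" "i \<in> I"
      have "(\<Sum>j\<in>I. \<Sum>k\<in>I. c i j k * c p j k) = B i p"
        unfolding B_def by (intro sum.cong refl) (use c_rot pi in metis)
      then show "(\<Sum>j\<in>I. (2 * (\<Sum>k\<in>I. c i j k * c p j k)) *\<^sub>R (e i * e p)) = (2 * B i p) *\<^sub>R (e i * e p)"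
        by (simp only: scaleR_sum_left[symmetric] sum_distrib_left[symmetric])
    qed
    also have "\<dots> = (\<Sum>i\<in>I. \<Sum>p\<in>I. (2 * B i p) *\<^sub>R (e i * e p))" by (rule sum.swap)
    also have "\<dots> = 2 *\<^sub>R (- N *\<^sub>R 1)"
      by (simp only: sum_B[symmetric] scaleR_sum_right scaleR_scaleR)
    finally show ?thesis by simp
  qed
  finally have "(\<Sum>p\<in>I. (A p * H - H * A p) * e p)
      = ((\<Sum>p\<in>I. A p * A p) + (4 * N) *\<^sub>R 1) + ((\<Sum>p\<in>I. A p * A p) + (2 * N) *\<^sub>R 1) + (\<Sum>p\<in>I. A p * A p)" .
  also have "\<dots> = (1 + 1 + 1) *\<^sub>R (\<Sum>p\<in>I. A p * A p) + (4 * N + 2 * N) *\<^sub>R 1"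
    by (simp only: scaleR_left_distrib scaleR_one add.assoc add.left_commute add.commute)
  finally show ?thesis by simp
qed

text \<open>In \<open>4 *\<^sub>R H = \<Sum>p\<in>I. A p * e p\<close>, multiplied by
  \<open>H\<close> on the right, \<open>H\<close> is carried to the left: past \<open>e p\<close> by
  anticommutation, past \<open>A p\<close> by the commutator sum. It returns as
  \<open>- (4 *\<^sub>R (H * H))\<close>, so the equation can be solved for \<open>H * H\<close>:
  the coefficients are -(3 + 3/2)/8 and -6/8.\<close>

lemma H_square: "H * H = - (9/16) *\<^sub>R (\<Sum>p\<in>I. A p * A p) - (3/4 * N) *\<^sub>R 1"
proof -
  let ?a = "\<Sum>p\<in>I. A p * A p"
  have 4: "4 *\<^sub>R H = (\<Sum>p\<in>I. A p * e p)" by (simp add: H_eq)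
  have "4 *\<^sub>R (H * H) = (\<Sum>p\<in>I. A p * (e p * H))"
    using arg_cong[OF 4, of "\<lambda>x. x * H"] by (simp add: sum_distrib_right mult.assoc)
  also have "\<dots> = (\<Sum>p\<in>I. - (H * (A p * e p)) - (A p * H - H * A p) * e p - (3/2) *\<^sub>R (A p * A p))"
  proof (intro sum.cong refl)
    fix p assume "p \<in> I"
    then have "e p * H = - (H * e p) - (3/2) *\<^sub>R A p"
      using H_anticommute[of p] by (simp add: eq_diff_eq eq_neg_iff_add_eq_0 add.commute add.left_commute)
    then show "A p * (e p * H) = - (H * (A p * e p)) - (A p * H - H * A p) * e p - (3/2) *\<^sub>R (A p * A p)"
      by (simp add: right_diff_distrib left_diff_distrib mult.assoc)
  qed
  also have "\<dots> = - (H * (\<Sum>p\<in>I. A p * e p)) - (\<Sum>p\<in>I. (A p * H - H * A p) * e p) - (3/2) *\<^sub>R ?a"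
    by (simp add: sum_subtractf sum_negf sum_distrib_left scaleR_sum_right)
  also have "\<dots> = - (4 *\<^sub>R (H * H)) - (3 *\<^sub>R ?a + (6 * N) *\<^sub>R 1) - (3/2) *\<^sub>R ?a"
    unfolding sum_commutator_A_H 4[symmetric] by simp
  finally have "4 *\<^sub>R (H * H) + 4 *\<^sub>R (H * H) = - (3 *\<^sub>R ?a + (3/2) *\<^sub>R ?a) - (6 * N) *\<^sub>R 1"
    by (rule double_eqI)
  then have "4 *\<^sub>R (H * H) + 4 *\<^sub>R (H * H) = - ((3 + 3/2) *\<^sub>R ?a) - (6 * N) *\<^sub>R 1"
    by (simp only: scaleR_left_distrib)
  then have "(4 + 4) *\<^sub>R (H * H) = - ((3 + 3/2) *\<^sub>R ?a) - (6 * N) *\<^sub>R 1"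
    by (simp only: scaleR_left_distrib)
  then have "(1/8) *\<^sub>R (8 *\<^sub>R (H * H)) = (1/8) *\<^sub>R (- ((9/2) *\<^sub>R ?a) - (6 * N) *\<^sub>R 1)" by simp
  then show ?thesis by (simp add: scaleR_right_diff_distrib)
qed

text \<open>Since 1/9 times -9/16 is -1/16, the quadratic sum in \<open>H * H\<close> completes
  \<open>R\<close> to \<open>S\<close>, whose quartic sum is a scalar. Its trace contributes 1/8 of
  the trace of \<open>R\<close> plus \<open>N / 8\<close>, and \<open>H * H\<close> contributes
  \<open>- N / 12\<close>; together they leave \<open>N / 24\<close>.\<close>

theorem casimir_plus_H_square:
  fixes R :: "'i \<Rightarrow> 'i \<Rightarrow> 'i \<Rightarrow> 'i \<Rightarrow> real"
  defines "S i j k l \<equiv> R i j k l + (\<Sum>p\<in>I. c i j p * c k l p)"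
  assumes anti: "\<And>i j k l. i \<in> I \<Longrightarrow> j \<in> I \<Longrightarrow> k \<in> I \<Longrightarrow> l \<in> I \<Longrightarrow> R j i k l = - R i j k l"
    and pair: "\<And>i j k l. i \<in> I \<Longrightarrow> j \<in> I \<Longrightarrow> k \<in> I \<Longrightarrow> l \<in> I \<Longrightarrow> R k l i j = R i j k l"
    and bianchi: "\<And>i j k l. i \<in> I \<Longrightarrow> j \<in> I \<Longrightarrow> k \<in> I \<Longrightarrow> l \<in> I
      \<Longrightarrow> S i j k l + S j k i l + S k i j l = 0"
  shows "- (1/16) *\<^sub>R (\<Sum>i\<in>I. \<Sum>j\<in>I. \<Sum>k\<in>I. \<Sum>l\<in>I. R i j k l *\<^sub>R (e i * e j * e k * e l))
      + (1/9) *\<^sub>R (H * H)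
    = (1/8 * ((\<Sum>i\<in>I. \<Sum>j\<in>I. R i j i j) + 1/3 * N)) *\<^sub>R 1"
proof -
  let ?R = "\<Sum>i\<in>I. \<Sum>j\<in>I. \<Sum>k\<in>I. \<Sum>l\<in>I. R i j k l *\<^sub>R (e i * e j * e k * e l)"
  let ?a = "\<Sum>p\<in>I. A p * A p"
  have "(\<Sum>i\<in>I. \<Sum>j\<in>I. \<Sum>k\<in>I. \<Sum>l\<in>I. S i j k l *\<^sub>R (e i * e j * e k * e l))
    = (-2 * (\<Sum>i\<in>I. \<Sum>j\<in>I. S i j i j)) *\<^sub>R 1"
  proof (rule sum_curvature_like[OF _ _ bianchi])
    fix i j k l assume "i \<in> I" "j \<in> I" "k \<in> I" "l \<in> I"
    then show "S j i k l = - S i j k l" "S k l i j = S i j k l"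
      using anti[of i j k l] pair[of i j k l]
      by (simp_all add: S_def sum_negf[symmetric] mult.commute c_swap12[of i j])
  qed
  moreover have "(\<Sum>i\<in>I. \<Sum>j\<in>I. S i j i j) = (\<Sum>i\<in>I. \<Sum>j\<in>I. R i j i j) + N"
    by (simp add: S_def sum.distrib N_def)
  moreover have "(\<Sum>i\<in>I. \<Sum>j\<in>I. \<Sum>k\<in>I. \<Sum>l\<in>I. S i j k l *\<^sub>R (e i * e j * e k * e l)) = ?R + ?a"
  proof -
    have "(\<Sum>i\<in>I. \<Sum>j\<in>I. \<Sum>k\<in>I. \<Sum>l\<in>I. (\<Sum>p\<in>I. c i j p * c k l p) *\<^sub>R (e i * e j * e k * e l)) = ?a"
    proof -
      have "?a = (\<Sum>p\<in>I. \<Sum>i\<in>I. \<Sum>j\<in>I. \<Sum>k\<in>I. \<Sum>l\<in>I. (c i j p * c k l p) *\<^sub>R (e i * e j * e k * e l))"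
        unfolding A_def sum_distrib_right unfolding sum_distrib_left
        by (intro sum.cong refl) (simp add: mult.assoc mult.commute[where 'a=real])
      also have "\<dots> = (\<Sum>i\<in>I. \<Sum>j\<in>I. \<Sum>p\<in>I. \<Sum>k\<in>I. \<Sum>l\<in>I. (c i j p * c k l p) *\<^sub>R (e i * e j * e k * e l))"
        by (rule sum3_rot[symmetric])
      also have "\<dots> = (\<Sum>i\<in>I. \<Sum>j\<in>I. \<Sum>k\<in>I. \<Sum>l\<in>I. \<Sum>p\<in>I. (c i j p * c k l p) *\<^sub>R (e i * e j * e k * e l))"
        by (intro sum.cong refl sum3_rot[symmetric])
      finally show ?thesis by (simp add: scaleR_sum_left)
    qed
    then show ?thesis by (simp add: S_def sum.distrib scaleR_add_left)
  qed
  ultimately have R: "?R = (-2 * ((\<Sum>i\<in>I. \<Sum>j\<in>I. R i j i j) + N)) *\<^sub>R 1 - ?a"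
    by (simp add: eq_diff_eq)
  show ?thesis unfolding R H_square
    by (simp add: scaleR_right_diff_distrib,
        simp only: scaleR_minus_left[symmetric] scaleR_left_diff_distrib[symmetric])
      (simp add: field_simps)
qed

end

section \<open>Differentiating curves in the spin group\<close>

lemma has_vector_derivative_at_0_iff:
  fixes f :: "real \<Rightarrow> 'a::real_normed_vector"
  shows "(f has_vector_derivative D) (at 0) \<longleftrightarrow> ((\<lambda>u. (1 / u) *\<^sub>R (f u - f 0)) \<longlongrightarrow> D) (at 0)"
proof -
  have "(f has_vector_derivative D) (at 0)
      \<longleftrightarrow> ((\<lambda>u. (1 / norm u) *\<^sub>R (f u - (f 0 + u *\<^sub>R D))) \<longlongrightarrow> 0) (at 0)"
    by (simp add: has_vector_derivative_def has_derivative_within bounded_linear_scaleR_left)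
  also have "\<dots> \<longleftrightarrow> ((\<lambda>u. norm ((1 / norm u) *\<^sub>R (f u - (f 0 + u *\<^sub>R D)))) \<longlongrightarrow> 0) (at 0)"
    by (rule tendsto_norm_zero_iff[symmetric])
  also have "\<dots> \<longleftrightarrow> ((\<lambda>u. norm ((1 / u) *\<^sub>R (f u - f 0) - D)) \<longlongrightarrow> 0) (at 0)"
  proof (rule tendsto_cong, rule eventually_at_ball'[OF zero_less_one, THEN eventually_mono])
    fix u :: real assume u: "u \<in> ball 0 1 \<and> u \<noteq> 0 \<and> u \<in> UNIV"
    have "(1 / u) *\<^sub>R (f u - f 0) - D = (1 / u) *\<^sub>R (f u - (f 0 + u *\<^sub>R D))"
      using u by (simp add: algebra_simps)
    then show "norm ((1 / norm u) *\<^sub>R (f u - (f 0 + u *\<^sub>R D))) = norm ((1 / u) *\<^sub>R (f u - f 0) - D)"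
      by simp
  qed
  also have "\<dots> \<longleftrightarrow> ((\<lambda>u. (1 / u) *\<^sub>R (f u - f 0)) \<longlongrightarrow> D) (at 0)"
    by (simp only: tendsto_norm_zero_iff Lim_null[symmetric])
  finally show ?thesis .
qed

lemma bounded_bilinear_mult_algebra:
  "bounded_bilinear ((*) :: 'c::{euclidean_space,real_algebra_1} \<Rightarrow> 'c \<Rightarrow> 'c)"
proof -
  have "bilinear ((*) :: 'c \<Rightarrow> 'c \<Rightarrow> 'c)"
    by (auto simp: bilinear_def intro!: linearI simp: algebra_simps)
  then show ?thesis using bilinear_conv_bounded_bilinear by blast
qed

locale euclidean_clifford_frame = clifford_frame "{1..n}" e
  for n :: nat and e :: "nat \<Rightarrow> 'c::{euclidean_space,real_algebra_1}"
begin

sublocale cm: bounded_bilinear "(*) :: 'c \<Rightarrow> 'c \<Rightarrow> 'c"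
  by (rule bounded_bilinear_mult_algebra)

text \<open>\<open>graded k True\<close> and \<open>graded k False\<close> are the even and the odd part of the subalgebra generated
  by \<open>e 1, \<dots>, e k\<close>.\<close>

primrec graded :: "nat \<Rightarrow> bool \<Rightarrow> 'c set" where
  "graded 0 s = (if s then range (\<lambda>r. r *\<^sub>R 1) else {0})"
| "graded (Suc k) s = {x + y * e (Suc k) |x y. x \<in> graded k s \<and> y \<in> graded k (\<not> s)}"

lemma graded_SucI: "x \<in> graded k s \<Longrightarrow> y \<in> graded k (\<not> s) \<Longrightarrow> x + y * e (Suc k) \<in> graded (Suc k) s"
  by auto

lemma subspace_graded: "subspace (graded k s)"
proof (induction k arbitrary: s)
  case 0
  have "range (\<lambda>r::real. r *\<^sub>R (1::'c)) = span {1}" by (simp add: span_singleton)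
  then show ?case by (simp add: subspace_span)
next
  case (Suc k)
  note S = Suc.IH[of s] Suc.IH[of "\<not> s"]
  show ?case
  proof (rule subspaceI)
    show "0 \<in> graded (Suc k) s"
      using graded_SucI[OF subspace_0[OF S(1)] subspace_0[OF S(2)]] by simp
  next
    fix a b assume "a \<in> graded (Suc k) s" "b \<in> graded (Suc k) s"
    then obtain x y x' y' where *: "x \<in> graded k s" "y \<in> graded k (\<not> s)" "x' \<in> graded k s" "y' \<in> graded k (\<not> s)"
      "a = x + y * e (Suc k)" "b = x' + y' * e (Suc k)" by auto
    have "a + b = (x + x') + (y + y') * e (Suc k)" by (simp add: * algebra_simps)
    then show "a + b \<in> graded (Suc k) s"
      using graded_SucI[OF subspace_add[OF S(1) *(1,3)] subspace_add[OF S(2) *(2,4)]] by simp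
  next
    fix r a assume "a \<in> graded (Suc k) s"
    then obtain x y where *: "x \<in> graded k s" "y \<in> graded k (\<not> s)" "a = x + y * e (Suc k)" by auto
    have "r *\<^sub>R a = r *\<^sub>R x + (r *\<^sub>R y) * e (Suc k)" by (simp add: * algebra_simps)
    then show "r *\<^sub>R a \<in> graded (Suc k) s"
      using graded_SucI[OF subspace_scale[OF S(1) *(1)] subspace_scale[OF S(2) *(2)]] by simp
  qed
qed

text \<open>\<open>e j\<close> anticommutes with each of \<open>e 1, ..., e k\<close>, so only the
  parity of the degree decides the sign.\<close>

lemma graded_commute:
  "x \<in> graded k s \<Longrightarrow> k < j \<Longrightarrow> j \<le> n \<Longrightarrow> e j * x = (if s then 1 else - 1) *\<^sub>R (x * e j)"
proof (induction k arbitrary: s x)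
  case 0
  then show ?case by (auto split: if_splits)
next
  case (Suc k)
  obtain a b where ab: "a \<in> graded k s" "b \<in> graded k (\<not> s)" "x = a + b * e (Suc k)"
    using Suc.prems by auto
  have sw: "e (Suc k) * e j = - (e j * e (Suc k))"
    using e_swap[of "Suc k" j] Suc.prems by simp
  have "e j * x = e j * a + (e j * b) * e (Suc k)" by (simp add: ab algebra_simps)
  also have "\<dots> = (if s then 1 else - 1) *\<^sub>R (a * e j) + (if \<not> s then 1 else - 1) *\<^sub>R (b * (e j * e (Suc k)))"
    using Suc.IH[OF ab(1)] Suc.IH[OF ab(2)] Suc.prems by (simp add: mult.assoc)
  also have "\<dots> = (if s then 1 else - 1) *\<^sub>R (x * e j)"
    by (simp add: ab distrib_right mult.assoc sw scaleR_add_right)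
  finally show ?case .
qed

lemma graded_mult_e: "x \<in> graded k s \<Longrightarrow> j \<in> {1..k} \<Longrightarrow> k \<le> n \<Longrightarrow> x * e j \<in> graded k (\<not> s)"
proof (induction k arbitrary: s x)
  case (Suc k)
  obtain a b where ab: "a \<in> graded k s" "b \<in> graded k (\<not> s)" "x = a + b * e (Suc k)"
    using Suc.prems by auto
  show ?case
  proof (cases "j = Suc k")
    case True
    have "x * e j = - b + a * e (Suc k)"
      using e_square[of "Suc k"] Suc.prems by (simp add: ab True distrib_right mult.assoc)
    then show ?thesis
      using graded_SucI[of "- b" k "\<not> s" a] ab subspace_neg[OF subspace_graded] by simp
  next
    case False
    then have j: "j \<in> {1..k}" using Suc.prems by auto
    have sw: "e (Suc k) * e j = - (e j * e (Suc k))"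
      using e_swap[of "Suc k" j] Suc.prems False by simp
    have "x * e j = a * e j + (- (b * e j)) * e (Suc k)"
      by (simp add: ab distrib_right mult.assoc sw)
    moreover have "a * e j \<in> graded k (\<not> s)" "b * e j \<in> graded k s"
      using Suc.IH[OF ab(1) j] Suc.IH[OF ab(2) j] Suc.prems by auto
    ultimately show ?thesis
      using graded_SucI[of "a * e j" k "\<not> s" "- (b * e j)"] subspace_neg[OF subspace_graded] by simp
  qed
qed simp

lemma one_graded: "1 \<in> graded k True"
proof (induction k)
  case 0
  then show ?case using rangeI[of "\<lambda>r::real. r *\<^sub>R (1::'c)" 1] by simp
next
  case (Suc k)
  then show ?case using graded_SucI[of 1 k True 0] subspace_0[OF subspace_graded] by simp
qed

text \<open>The map \<open>x \<mapsto> (x - e k * x * e k) / 2\<close> kills the component of even degree that contains \<open>e k\<close>.\<close>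

lemma almost_central_even:
  fixes F :: "'u filter"
  assumes "k \<le> n" "eventually (\<lambda>u. x u \<in> graded k True) F"
    and "\<And>j. j \<in> {1..k} \<Longrightarrow> ((\<lambda>u. x u * e j - e j * x u) \<longlongrightarrow> 0) F"
  shows "\<exists>r. ((\<lambda>u. x u - r u *\<^sub>R 1) \<longlongrightarrow> 0) F"
  using assms
proof (induction k arbitrary: x)
  case 0
  define r where "r u = (SOME r. x u = r *\<^sub>R 1)" for u
  have "eventually (\<lambda>u. x u - r u *\<^sub>R 1 = 0) F"
    using 0(2)
  proof (rule eventually_mono)
    fix u assume "x u \<in> graded 0 True"
    then have "\<exists>r. x u = r *\<^sub>R 1" by auto
    then have "x u = r u *\<^sub>R 1" unfolding r_def by (rule someI_ex)
    then show "x u - r u *\<^sub>R 1 = 0" by simp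
  qed
  then show ?case by (intro exI[of _ r]) (rule tendsto_eventually)
next
  case (Suc k)
  define y where "y u = (1/2) *\<^sub>R (x u - e (Suc k) * x u * e (Suc k))" for u
  have sq: "e (Suc k) * e (Suc k) = - 1" using e_square Suc.prems(1) by simp
  \<comment> \<open>\<open>x - y\<close> is a multiple of the commutator of \<open>x\<close> with
    \<open>e (Suc k)\<close>, hence tends to zero, while \<open>y\<close> no longer involves
    \<open>e (Suc k)\<close> and falls under the induction hypothesis.\<close>
  have diff: "x u - y u = - (1/2) *\<^sub>R ((x u * e (Suc k) - e (Suc k) * x u) * e (Suc k))" for u
  proof -
    have "2 *\<^sub>R (x u - y u) = x u + e (Suc k) * x u * e (Suc k)"
      by (simp add: y_def scaleR_right_diff_distrib scaleR_2)
    also have "\<dots> = - ((x u * e (Suc k) - e (Suc k) * x u) * e (Suc k))"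
      by (simp add: left_diff_distrib mult.assoc sq)
    finally have "(1/2) *\<^sub>R (2 *\<^sub>R (x u - y u)) = (1/2) *\<^sub>R (- ((x u * e (Suc k) - e (Suc k) * x u) * e (Suc k)))"
      by simp
    then show ?thesis by simp
  qed
  have xy: "((\<lambda>u. x u - y u) \<longlongrightarrow> 0) F"
  proof -
    have "((\<lambda>u. (x u * e (Suc k) - e (Suc k) * x u) * e (Suc k)) \<longlongrightarrow> 0 * e (Suc k)) F"
      by (intro cm.tendsto Suc.prems(3) tendsto_const) simp
    from tendsto_scaleR[OF tendsto_const this, of "- (1/2)"] show ?thesis
      by (simp add: diff)
  qed
  have "\<exists>r. ((\<lambda>u. y u - r u *\<^sub>R 1) \<longlongrightarrow> 0) F"
  proof (rule Suc.IH)
    show "k \<le> n" using Suc.prems by simp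
    show "eventually (\<lambda>u. y u \<in> graded k True) F"
      using Suc.prems(2)
    proof (rule eventually_mono)
      fix u assume "x u \<in> graded (Suc k) True"
      then obtain a b where ab: "a \<in> graded k True" "b \<in> graded k False" "x u = a + b * e (Suc k)" by auto
      have "e (Suc k) * x u * e (Suc k) = (e (Suc k) * a) * e (Suc k) + (e (Suc k) * b) * (e (Suc k) * e (Suc k))"
        by (simp add: ab algebra_simps)
      also have "\<dots> = - a + b * e (Suc k)"
        using graded_commute[OF ab(1), of "Suc k"] graded_commute[OF ab(2), of "Suc k"] Suc.prems(1)
        by (simp add: mult.assoc sq)
      finally have "y u = (1/2) *\<^sub>R (a + a)" by (simp add: y_def ab)
      then have "y u = a" by (simp add: scaleR_2[symmetric])
      then show "y u \<in> graded k True" using ab by simp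
    qed
    fix j assume j: "j \<in> {1..k}"
    have "((\<lambda>u. (x u * e j - e j * x u) - ((x u - y u) * e j - e j * (x u - y u))) \<longlongrightarrow>
        0 - (0 * e j - e j * 0)) F"
      by (intro tendsto_diff cm.tendsto xy tendsto_const Suc.prems(3)) (use j in auto)
    then show "((\<lambda>u. y u * e j - e j * y u) \<longlongrightarrow> 0) F"
      by (simp add: algebra_simps)
  qed
  then obtain r where "((\<lambda>u. y u - r u *\<^sub>R 1) \<longlongrightarrow> 0) F" by blast
  from tendsto_add[OF xy this] show ?case by auto
qed

text \<open>Averaging over the finite group generated by the \<open>e j\<close>, one generator at a
  time. Left multiplication by \<open>e (Suc k)\<close> squares to -1 and so swaps the two summands
  of \<open>B'\<close>; invariance under the earlier generators survives because they anticommute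
  with it. The spin group will act by isometries of this form.\<close>

lemma invariant_inner_product:
  "k \<le> n \<Longrightarrow> \<exists>B. bilinear B \<and> (\<forall>x y. B x y = B y x) \<and> (\<forall>x::'c. x \<noteq> 0 \<longrightarrow> 0 < (B x x::real)) \<and>
    (\<forall>j\<in>{1..k}. \<forall>x y. B (e j * x) (e j * y) = B x y)"
proof (induction k)
  case 0
  show ?case
    by (rule exI[of _ inner])
      (auto simp: inner_commute bilinear_conv_bounded_bilinear bounded_bilinear_inner)
next
  case (Suc k)
  then obtain B where B: "bilinear B" "\<And>x y. B x y = B y x" "\<And>x::'c. x \<noteq> 0 \<Longrightarrow> 0 < (B x x::real)"
    "\<And>j x y. j \<in> {1..k} \<Longrightarrow> B (e j * x) (e j * y) = B x y"
    by auto
  define B' where "B' x y = B x y + B (e (Suc k) * x) (e (Suc k) * y)" for x y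
  have sq: "e (Suc k) * e (Suc k) = - 1" using e_square Suc.prems(1) by simp
  show ?case
  proof (intro exI[of _ B'] conjI allI impI ballI)
    note S = bilinear_ladd[OF B(1)] bilinear_radd[OF B(1)] bilinear_lmul[OF B(1)] bilinear_rmul[OF B(1)]
      bilinear_lneg[OF B(1)] bilinear_rneg[OF B(1)]
    show "bilinear B'"
      by (auto simp: bilinear_def B'_def S algebra_simps intro!: linearI)
    show "B' x y = B' y x" for x y unfolding B'_def using B(2) by metis
    show "0 < B' x x" if "x \<noteq> 0" for x
    proof -
      have "e (Suc k) * x \<noteq> 0"
        using that sq mult.assoc[of "e (Suc k)" "e (Suc k)" x] by auto
      then show ?thesis unfolding B'_def using B(3) that by (simp add: add_pos_pos)
    qed
    fix j x y assume j: "j \<in> {1..Suc k}"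
    show "B' (e j * x) (e j * y) = B' x y"
    proof (cases "j = Suc k")
      case True
      have "e (Suc k) * (e (Suc k) * z) = - z" for z using sq mult.assoc[of "e (Suc k)" "e (Suc k)" z] by simp
      then show ?thesis by (simp add: B'_def True S)
    next
      case False
      then have "e (Suc k) * (e j * z) = - (e j * (e (Suc k) * z))" for z
        using e_swap[of "Suc k" j] j Suc.prems mult.assoc[of "e (Suc k)" "e j" z] by (simp add: mult.assoc)
      moreover have "j \<in> {1..k}" using False j by auto
      ultimately show ?thesis by (simp add: B'_def S B(4))
    qed
  qed
qed

text \<open>Commutators with the generators see the derivative of \<open>s\<close> only up to
  scalars, since even elements that almost commute with all of them are almost scalar. The scalar
  part is pinned down by the constant length \<open>B (s u) (s u)\<close> together with
  \<open>B 1 \<omega> = 0\<close>.\<close>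

lemma has_vector_derivative_even:
  fixes s :: "real \<Rightarrow> 'c" and \<omega> :: 'c and B :: "'c \<Rightarrow> 'c \<Rightarrow> real"
  assumes even: "eventually (\<lambda>u. s u \<in> graded n True) (at 0)"
    and B: "bilinear B" "0 < B 1 1" "\<And>x y. B x y = B y x"
    and iso: "eventually (\<lambda>u. B (s u) (s u) = B 1 1) (at 0)"
    and cont: "(s \<longlongrightarrow> 1) (at 0)" and s0: "s 0 = 1"
    and \<omega>: "\<omega> \<in> graded n True" "B 1 \<omega> = 0"
    and comm: "\<And>j. j \<in> {1..n} \<Longrightarrow>
      ((\<lambda>u. (1 / u) *\<^sub>R (s u * e j - e j * s u)) \<longlongrightarrow> \<omega> * e j - e j * \<omega>) (at 0)"
  shows "(s has_vector_derivative \<omega>) (at 0)"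
proof -
  interpret B: bounded_bilinear B using B(1) bilinear_conv_bounded_bilinear by blast
  have nz: "eventually (\<lambda>u::real. u \<noteq> 0) (at 0)" by (simp add: eventually_at_filter)
  have idz: "((\<lambda>u::real. u) \<longlongrightarrow> 0) (at 0)" by (rule tendsto_ident_at)
  \<comment> \<open>Error of the difference quotient against \<open>\<omega>\<close>; up to a
    vanishing term it is a scalar \<open>r u\<close>, which remains to be shown to tend to
    zero.\<close>
  define x where "x u = (1 / u) *\<^sub>R (s u - 1) - \<omega>" for u
  have "\<exists>r. ((\<lambda>u. x u - r u *\<^sub>R 1) \<longlongrightarrow> 0) (at 0)"
  proof (rule almost_central_even[OF order_refl])
    show "eventually (\<lambda>u. x u \<in> graded n True) (at 0)"
      using even
      by (rule eventually_mono)
        (auto simp: x_def intro!: subspace_diff[OF subspace_graded] subspace_scale[OF subspace_graded] one_graded \<omega>)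
    fix j assume "j \<in> {1..n}"
    from tendsto_diff[OF comm[OF this] tendsto_const[of "\<omega> * e j - e j * \<omega>"]]
    show "((\<lambda>u. x u * e j - e j * x u) \<longlongrightarrow> 0) (at 0)"
      by (simp add: x_def algebra_simps)
  qed
  then obtain r where r: "((\<lambda>u. x u - r u *\<^sub>R 1) \<longlongrightarrow> 0) (at 0)" by blast
  define w where "w u = \<omega> + (x u - r u *\<^sub>R 1)" for u
  have w: "(w \<longlongrightarrow> \<omega>) (at 0)"
    using tendsto_add[OF tendsto_const[of \<omega>] r] by (simp add: w_def[abs_def])
  have s_eq: "s u = (1 + u * r u) *\<^sub>R 1 + u *\<^sub>R w u" if "u \<noteq> 0" for u
    using that by (simp add: w_def x_def algebra_simps)
  \<comment> \<open>Continuity of \<open>s\<close> gives only that \<open>u * r u\<close> tends to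
    zero. This suffices to keep the denominator \<open>(2 + u * r u) * B 1 1\<close> away from zero
    below.\<close>
  have "((\<lambda>u. s u - 1 - u *\<^sub>R w u) \<longlongrightarrow> 1 - 1 - 0 *\<^sub>R \<omega>) (at 0)"
    by (intro tendsto_diff tendsto_scaleR cont w idz tendsto_const)
  then have "((\<lambda>u. s u - 1 - u *\<^sub>R w u) \<longlongrightarrow> 0) (at 0)" by simp
  moreover have "eventually (\<lambda>u. s u - 1 - u *\<^sub>R w u = (u * r u) *\<^sub>R 1) (at 0)"
    using nz by (rule eventually_mono) (simp add: s_eq scaleR_left_distrib)
  ultimately have "((\<lambda>u. (u * r u) *\<^sub>R (1::'c)) \<longlongrightarrow> 0) (at 0)"
    by (rule Lim_transform_eventually)
  then have "((\<lambda>u. B ((u * r u) *\<^sub>R 1) 1) \<longlongrightarrow> B 0 1) (at 0)"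
    by (intro B.tendsto tendsto_const)
  then have "((\<lambda>u. (u * r u * B 1 1) / B 1 1) \<longlongrightarrow> 0 / B 1 1) (at 0)"
    by (intro tendsto_divide tendsto_const) (use B(2) in \<open>auto simp: B.scaleR_left B.zero_left\<close>)
  then have \<sigma>: "((\<lambda>u. u * r u) \<longlongrightarrow> 0) (at 0)" using B(2) by simp
  \<comment> \<open>The quotient is \<open>r u\<close> solved from
    \<open>B (s u) (s u) = B 1 1\<close> with
    \<open>s u = (1 + u * r u) *\<^sub>R 1 + u *\<^sub>R w u\<close>, after division by
    \<open>u\<close>. Its limit vanishes because \<open>B 1 \<omega> = 0\<close>.\<close>
  have lim: "((\<lambda>u. - (2 * (1 + u * r u) * B 1 (w u) + u * B (w u) (w u)) / ((2 + u * r u) * B 1 1)) \<longlongrightarrow>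
      - (2 * (1 + 0) * B 1 \<omega> + 0 * B \<omega> \<omega>) / ((2 + 0) * B 1 1)) (at 0)"
    by (intro tendsto_intros B.tendsto w \<sigma> idz) (use B(2) in auto)
  have "eventually (\<lambda>u. u * r u \<in> {-1<..<1}) (at 0)"
    using \<sigma> by (rule topological_tendstoD) auto
  with nz iso have "eventually (\<lambda>u. - (2 * (1 + u * r u) * B 1 (w u) + u * B (w u) (w u)) / ((2 + u * r u) * B 1 1) = r u) (at 0)"
  proof eventually_elim
    case (elim u)
    let ?t = "u * r u"
    have "B (s u) (s u) = (1 + ?t) * (1 + ?t) * B 1 1 + 2 * u * (1 + ?t) * B 1 (w u) + u * u * B (w u) (w u)"
      unfolding s_eq[OF elim(1)]
      by (simp only: B.add_left B.add_right B.scaleR_left B.scaleR_right B(3)[of "w u" 1])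
        (simp add: algebra_simps)
    then have "u * (r u * ((2 + ?t) * B 1 1) + 2 * (1 + ?t) * B 1 (w u) + u * B (w u) (w u)) = 0"
      using elim(2) by (simp add: algebra_simps)
    then have "r u * ((2 + ?t) * B 1 1) = - (2 * (1 + ?t) * B 1 (w u) + u * B (w u) (w u))"
      using elim(1) by simp
    moreover have "(2 + ?t) * B 1 1 \<noteq> 0" using elim(3) B(2) by auto
    ultimately show ?case by (metis nonzero_mult_div_cancel_right)
  qed
  from Lim_transform_eventually[OF lim this] have "(r \<longlongrightarrow> 0) (at 0)"
    by (simp add: \<omega>(2))
  then have "((\<lambda>u. \<omega> + (x u - r u *\<^sub>R 1) + r u *\<^sub>R 1) \<longlongrightarrow> \<omega> + 0 + 0 *\<^sub>R 1) (at 0)"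
    by (intro tendsto_add tendsto_scaleR tendsto_const r)
  then show ?thesis
    unfolding has_vector_derivative_at_0_iff s0 by (simp add: x_def)
qed

end

section \<open>Spinors on homogeneous spaces\<close>

locale spin_homogeneous =
  fixes M :: "('g::{t2_space,second_countable_topology}, 'e::euclidean_space,
      'c::{euclidean_space,real_algebra_1}, 'k::finite, 'z) spin_space_scheme" (structure)
    and Q :: "'e \<Rightarrow> 'e \<Rightarrow> real"
    and Z :: "nat \<Rightarrow> 'e"
  assumes nat_red: "naturally_reductive M" and inv_form: "invariant_form M Q"
    and spin: "homogeneous_spin_structure M" and onb: "orthonormal_basis_m M Z"
begin

sublocale reductive M Q
  by unfold_locales (rule nat_red inv_form)+

abbreviation "n \<equiv> dim \<mm>"
abbreviation "e i \<equiv> cliff M (Z i)"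

lemma cliff_anticommute:
  "v \<in> \<mm> \<Longrightarrow> w \<in> \<mm> \<Longrightarrow> cliff M v * cliff M w + cliff M w * cliff M v = (- 2 * metric M v w) *\<^sub>R 1"
  and cliff_linear: "linear_on_set \<mm> (cliff M)"
  using spin by (simp_all add: homogeneous_spin_structure_def clifford_algebra_def)

lemma Z_m: "i \<in> {1..n} \<Longrightarrow> Z i \<in> \<mm>"
  and Z_on: "i \<in> {1..n} \<Longrightarrow> j \<in> {1..n} \<Longrightarrow> metric M (Z i) (Z j) = (if i = j then 1 else 0)"
  and Z_span: "span (Z ` {1..n}) = \<mm>"
  using onb span_base[of _ "Z ` {1..n}"] unfolding orthonormal_basis_m_def by blast+

sublocale euclidean_clifford_frame n e
proof unfold_locales
  fix i j assume ij: "i \<in> {1..n}" "j \<in> {1..n}"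
  show "e i * e j + e j * e i = (if i = j then - 2 *\<^sub>R 1 else 0)"
    unfolding cliff_anticommute[OF Z_m[OF ij(1)] Z_m[OF ij(2)]] Z_on[OF ij] by simp
qed simp

lemma Q_sum_left: "Q (\<Sum>a\<in>S. f a) y = (\<Sum>a\<in>S. Q (f a) y)"
  using bilinear_Q by (simp add: bilinear_def linear_sum[of "\<lambda>x. Q x y"])

lemma span_eqI:
  assumes "linear f" "x \<in> span S" "\<And>y. y \<in> S \<Longrightarrow> f y = y"
  shows "f x = (x :: 'e)"
  using linear_eq_on_span[OF assms(1) linear_ident _ assms(2)] assms(3) by simp

lemma m_expand:
  assumes "x \<in> \<mm>"
  shows "x = (\<Sum>i=1..n. Q x (Z i) *\<^sub>R Z i)"
proof (rule span_eqI[symmetric])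
  show "linear (\<lambda>x. \<Sum>i=1..n. Q x (Z i) *\<^sub>R Z i)"
    by (rule linearI) (simp_all add: Q_simps scaleR_add_left sum.distrib scaleR_sum_right)
  show "x \<in> span (Z ` {1..n})" using assms by (simp only: Z_span)
  fix y assume "y \<in> Z ` {1..n}"
  then obtain j where j: "j \<in> {1..n}" "y = Z j" by blast
  have "(\<Sum>i=1..n. Q y (Z i) *\<^sub>R Z i) = (\<Sum>i=1..n. if j = i then Z i else 0)"
    by (intro sum.cong refl) (use j in \<open>simp add: Q_metric Z_m Z_on\<close>)
  then show "(\<Sum>i=1..n. Q y (Z i) *\<^sub>R Z i) = y" using j by simp
qed

lemma metric_expand:
  assumes "x \<in> \<mm>" "y \<in> \<mm>"
  shows "metric M x y = (\<Sum>i=1..n. Q x (Z i) * Q y (Z i))"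
proof -
  have "metric M x y = Q (\<Sum>i=1..n. Q x (Z i) *\<^sub>R Z i) y"
    using m_expand[OF assms(1)] Q_metric[OF assms] by simp
  also have "\<dots> = (\<Sum>i=1..n. Q x (Z i) * Q y (Z i))"
    by (simp add: Q_sum_left Q_simps Q_sym[of y])
  finally show ?thesis .
qed

text \<open>\<open>cliff\<close> is linear on \<open>m\<close> only; composing with the projection
  gives a map that is linear, hence continuous, on the whole Lie algebra.\<close>

definition cl :: "'e \<Rightarrow> 'c" where "cl x = cliff M (\<pi> x)"

lemma linear_cl: "linear cl"
proof (rule linearI)
  fix x y :: 'e and r :: real
  show "cl (x + y) = cl x + cl y"
    using cliff_linear[unfolded linear_on_set_def, rule_format, of "\<pi> x" "\<pi> y" 1 1]
    by (simp add: cl_def linear_add[OF linear_mpart])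
  show "cl (r *\<^sub>R x) = r *\<^sub>R cl x"
    using cliff_linear[unfolded linear_on_set_def, rule_format, of "\<pi> x" "\<pi> x" r 0]
    by (simp add: cl_def linear_scale[OF linear_mpart])
qed

lemma bounded_linear_cl: "bounded_linear cl"
  using linear_cl linear_conv_bounded_linear by blast

lemma cl_m: "x \<in> \<mm> \<Longrightarrow> cl x = cliff M x"
  by (simp add: cl_def)

lemma cliff_expand:
  assumes "x \<in> \<mm>"
  shows "cliff M x = (\<Sum>i=1..n. Q x (Z i) *\<^sub>R e i)"
proof -
  have "cl x = cl (\<Sum>i=1..n. Q x (Z i) *\<^sub>R Z i)" using m_expand[OF assms] by simp
  also have "\<dots> = (\<Sum>i=1..n. Q x (Z i) *\<^sub>R cl (Z i))"
    by (simp add: linear_sum[OF linear_cl] linear_scale[OF linear_cl])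
  finally show ?thesis using assms by (simp add: cl_m Z_m)
qed

lemma graded_mult_cliff:
  assumes "x \<in> graded n s" "v \<in> \<mm>"
  shows "x * cliff M v \<in> graded n (\<not> s)"
proof -
  have "x * cliff M v = (\<Sum>i=1..n. Q v (Z i) *\<^sub>R (x * e i))"
    by (simp add: cliff_expand[OF assms(2)] sum_distrib_left)
  also have "\<dots> \<in> graded n (\<not> s)"
    by (intro subspace_sum[OF subspace_graded] subspace_scale[OF subspace_graded] graded_mult_e assms) auto
  finally show ?thesis .
qed

lemma graded_mult_prod_list:
  "x \<in> graded n s \<Longrightarrow> set vs \<subseteq> \<mm> \<Longrightarrow>
    x * prod_list (map (cliff M) vs) \<in> graded n (if even (length vs) then s else \<not> s)"
proof (induction vs arbitrary: x s)
  case (Cons v vs)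
  then show ?case
    using Cons.IH[OF graded_mult_cliff[OF Cons.prems(1), of v]] by (auto simp: mult.assoc)
qed simp

section \<open>The spin group and the derivative of the lift\<close>

lemma spin_group_even: "a \<in> spin_group M \<Longrightarrow> a \<in> graded n True"
  unfolding spin_group_def using graded_mult_prod_list[OF one_graded] by fastforce

lemma cliff_unit_square: "v \<in> \<mm> \<Longrightarrow> metric M v v = 1 \<Longrightarrow> cliff M v * cliff M v = - 1"
proof -
  assume "v \<in> \<mm>" "metric M v v = 1"
  then have "2 *\<^sub>R (cliff M v * cliff M v) = 2 *\<^sub>R (- 1)"
    using cliff_anticommute[of v v] by (simp add: scaleR_2)
  then show ?thesis by (simp only: scaleR_cancel_left) simp
qed

lemma spin_group_left_inverse: "a \<in> spin_group M \<Longrightarrow> \<exists>b. b * a = 1"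
proof -
  have "set vs \<subseteq> {v \<in> \<mm>. metric M v v = 1} \<Longrightarrow> \<exists>b. b * prod_list (map (cliff M) vs) = 1" for vs
  proof (induction vs)
    case (Cons v vs)
    then obtain b where b: "b * prod_list (map (cliff M) vs) = 1" by auto
    have "cliff M v * cliff M v = - 1" using Cons.prems by (simp add: cliff_unit_square)
    then have "cliff M v * (cliff M v * x) = - x" for x
      by (simp add: mult.assoc[symmetric])
    then have "(- (b * cliff M v)) * prod_list (map (cliff M) (v # vs)) = 1"
      using b by (simp add: mult.assoc)
    then show ?case by blast
  qed (auto intro: exI[of _ 1])
  then show "a \<in> spin_group M \<Longrightarrow> \<exists>b. b * a = 1" unfolding spin_group_def by blast
qed

text \<open>An isometry with square -1 is skew. Skewness, unlike being an isometry, is linear in the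
  vector, so it passes from the \<open>e j\<close> to all of \<open>m\<close>; a unit vector again
  has square -1 and is therefore an isometry.\<close>

lemma spin_group_isometry:
  assumes B: "bilinear B" "\<And>j x y. j \<in> {1..n} \<Longrightarrow> B (e j * x) (e j * y) = B x y"
    and a: "a \<in> spin_group M"
  shows "B (a * x) (a * y) = (B x y :: real)"
proof -
  interpret B: bounded_bilinear B using B(1) bilinear_conv_bounded_bilinear by blast
  have skew: "B (e j * x) y = - B x (e j * y)" if "j \<in> {1..n}" for j x y
  proof -
    have "B (e j * x) y = - B (e j * x) (e j * (e j * y))"
      using e_square[OF that] by (simp add: mult.assoc[symmetric] B.minus_right)
    then show ?thesis using B(2)[OF that] by simp
  qed
  have unit: "B (cliff M v * x) (cliff M v * y) = B x y" if v: "v \<in> \<mm>" "metric M v v = 1" for v x y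
  proof -
    have "B (cliff M v * x) z = - B x (cliff M v * z)" for z
      by (simp add: cliff_expand[OF v(1)] sum_distrib_right B.sum_left B.sum_right B.scaleR_left
          B.scaleR_right skew sum_negf)
    moreover have "cliff M v * (cliff M v * y) = - y"
      using cliff_unit_square[OF v] by (simp add: mult.assoc[symmetric])
    ultimately show ?thesis by (simp add: B.minus_right)
  qed
  have "set vs \<subseteq> {v \<in> \<mm>. metric M v v = 1} \<Longrightarrow>
      B (prod_list (map (cliff M) vs) * x) (prod_list (map (cliff M) vs) * y) = B x y" for vs
    by (induction vs) (auto simp: mult.assoc unit)
  then show ?thesis using a unfolding spin_group_def by blast
qed

lemma slift_in: "h \<in> isotropy M \<Longrightarrow> slift M h \<in> spin_group M"
  and slift_mult: "h \<in> isotropy M \<Longrightarrow> k \<in> isotropy M \<Longrightarrow> slift M (h \<otimes> k) = slift M h * slift M k"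
  and slift_cont: "continuous_on (isotropy M) (slift M)"
  and slift_cliff: "h \<in> isotropy M \<Longrightarrow> v \<in> \<mm> \<Longrightarrow> slift M h * cliff M v = cliff M (Ad M h v) * slift M h"
  using spin unfolding homogeneous_spin_structure_def spin_lift_def by blast+

lemma one_H: "\<one> \<in> isotropy M"
  using subgroup_H by (rule subgroup.one_closed)

text \<open>The value is idempotent and has a left inverse.\<close>

lemma slift_one: "slift M \<one> = 1"
proof -
  obtain b where "b * slift M \<one> = 1" using spin_group_left_inverse[OF slift_in[OF one_H]] by blast
  moreover have "slift M \<one> * slift M \<one> = slift M \<one>" using slift_mult[OF one_H one_H] by simp
  ultimately show ?thesis by (metis mult.assoc mult_1)
qed

text \<open>Invariance of \<open>Q\<close> frees \<open>Y\<close> from the bracket, so that it can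
  be contracted with dual bases or replaced by the \<open>h\<close>-part of a bracket.\<close>

lemma ad_lift_eq: "Y \<in> \<hh> \<Longrightarrow>
  ad_lift M Z Y = (1/4) *\<^sub>R (\<Sum>i=1..n. \<Sum>j=1..n. Q Y (br (Z i) (Z j)) *\<^sub>R (e i * e j))"
  unfolding ad_lift_def
  by (intro arg_cong2[where f=scaleR] refl sum.cong)
    (simp add: Q_metric[symmetric] bracket_h_m Z_m Q_bracket_assoc)

text \<open>The infinitesimal form of \<open>slift_cliff\<close>: commutation with
  \<open>ad_lift\<close> is the isotropy action on vectors.\<close>

lemma ad_lift_commute:
  assumes "Y \<in> \<hh>" "l \<in> {1..n}"
  shows "ad_lift M Z Y * e l - e l * ad_lift M Z Y = cliff M (br Y (Z l))"
proof -
  let ?S = "\<Sum>i=1..n. \<Sum>j=1..n. Q Y (br (Z i) (Z j)) *\<^sub>R (e i * e j)"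
  have "?S * e l - e l * ?S = 4 *\<^sub>R (\<Sum>j=1..n. Q Y (br (Z l) (Z j)) *\<^sub>R e j)"
  proof (rule bivector_commute[OF _ assms(2)])
    fix i j show "Q Y (br (Z j) (Z i)) = - Q Y (br (Z i) (Z j))"
      using lie_bracket_anti[of "Z j" "Z i"] by (simp add: Q_simps)
  qed
  also have "(\<Sum>j=1..n. Q Y (br (Z l) (Z j)) *\<^sub>R e j) = cliff M (br Y (Z l))"
    by (simp add: cliff_expand[OF bracket_h_m[OF assms(1) Z_m[OF assms(2)]]] Q_bracket_assoc)
  finally have "(1/4) *\<^sub>R (?S * e l - e l * ?S) = (1/4) *\<^sub>R (4 *\<^sub>R cliff M (br Y (Z l)))" by simp
  then show ?thesis by (simp add: ad_lift_eq[OF assms(1)] scaleR_right_diff_distrib)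
qed

lemma ad_lift_even:
  assumes "Y \<in> \<hh>"
  shows "ad_lift M Z Y \<in> graded n True"
  unfolding ad_lift_eq[OF assms]
proof (intro subspace_scale[OF subspace_graded] subspace_sum[OF subspace_graded])
  fix i j assume "i \<in> {1..n}" "j \<in> {1..n}"
  then show "e i * e j \<in> graded n True"
    using graded_mult_e[OF graded_mult_e[OF one_graded]] by fastforce
qed

text \<open>\<open>slift\<close> is assumed continuous only. Differentiability comes from the
  covering relation: conjugation by \<open>slift M (\<gamma> s)\<close> is \<open>Ad\<close>, which
  is smooth, and the even element with the right commutators and no scalar component is
  \<open>ad_lift M Z Y\<close>.\<close>

lemma slift_derivative:
  assumes Y: "Y \<in> \<hh>" and c: "0 < \<epsilon>" "\<gamma> 0 = \<one>" "\<And>s. s \<in> {-\<epsilon><..<\<epsilon>} \<Longrightarrow> \<gamma> s \<in> isotropy M"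
    "\<And>s. s \<in> {-\<epsilon><..<\<epsilon>} \<Longrightarrow> \<gamma> s \<in> id_dom M"
    "((\<lambda>s. id_coord M (\<gamma> s)) has_vector_derivative Y) (at 0)"
  shows "((\<lambda>s. slift M (\<gamma> s)) has_vector_derivative ad_lift M Z Y) (at 0)"
proof -
  let ?\<omega> = "ad_lift M Z Y"
  have ev: "eventually (\<lambda>s. s \<in> {-\<epsilon><..<\<epsilon>}) (at 0)"
    by (rule eventually_at_in_open') (use c(1) in auto)
  obtain B where B: "bilinear B" "\<And>x y. B x y = B y x" "\<And>x::'c. x \<noteq> 0 \<Longrightarrow> 0 < (B x x::real)"
    "\<And>j x y. j \<in> {1..n} \<Longrightarrow> B (e j * x) (e j * y) = B x y"
    using invariant_inner_product[OF order_refl] by blast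
  interpret B: bounded_bilinear B using B(1) bilinear_conv_bounded_bilinear by blast
  show ?thesis
  proof (rule has_vector_derivative_even[where B=B])
    show "eventually (\<lambda>u. slift M (\<gamma> u) \<in> graded n True) (at 0)"
      using ev by (rule eventually_mono) (intro spin_group_even slift_in c(3))
    show "bilinear B" "0 < B 1 1" by (simp_all add: B(1,3))
    show "B x y = B y x" for x y by (rule B(2))
    show "eventually (\<lambda>u. B (slift M (\<gamma> u)) (slift M (\<gamma> u)) = B 1 1) (at 0)"
      using ev
    proof (rule eventually_mono)
      fix u assume "u \<in> {-\<epsilon><..<\<epsilon>}"
      from spin_group_isometry[OF B(1,4) slift_in[OF c(3)[OF this]], of 1 1]
      show "B (slift M (\<gamma> u)) (slift M (\<gamma> u)) = B 1 1" by simp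
    qed
    show "slift M (\<gamma> 0) = 1" by (simp add: c(2) slift_one)
    show "?\<omega> \<in> graded n True" by (rule ad_lift_even[OF Y])
    \<comment> \<open>The curve is differentiable in coordinates; applying \<open>\<iota>\<close>
      makes it continuous in the group, where \<open>slift\<close> is continuous.\<close>
    show "((\<lambda>s. slift M (\<gamma> s)) \<longlongrightarrow> 1) (at 0)"
    proof -
      have "isCont (\<lambda>s. id_coord M (\<gamma> s)) 0"
        using c(5) has_vector_derivative_continuous by blast
      then have "((\<lambda>s. id_coord M (\<gamma> s)) \<longlongrightarrow> c0) (at 0)" by (simp add: isCont_def c(2))
      moreover have "isCont \<iota> c0"
        using plotD(2)[OF plot_\<iota>] open_V0 c0_V0 continuous_on_eq_continuous_at by blast
      ultimately have "((\<lambda>s. \<iota> (id_coord M (\<gamma> s))) \<longlongrightarrow> \<iota> c0) (at 0)"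
        by (rule isCont_tendsto_compose[rotated])
      then have "((\<lambda>s. \<iota> (id_coord M (\<gamma> s))) \<longlongrightarrow> \<one>) (at 0)" by simp
      then have "(\<gamma> \<longlongrightarrow> \<one>) (at 0)"
        by (rule Lim_transform_eventually) (rule eventually_mono[OF ev], simp add: \<iota>_\<phi>0 c(4))
      then have "((\<lambda>s. slift M (\<gamma> s)) \<longlongrightarrow> slift M \<one>) (at 0)"
        by (rule continuous_on_tendsto_compose[OF slift_cont _ one_H eventually_mono[OF ev c(3)]])
      then show ?thesis by (simp add: slift_one)
    qed
    \<comment> \<open>Isometry of \<open>e i\<close> gives
      \<open>B 1 (e i * e j) = - B (e i) (e j)\<close>, which is symmetric in \<open>i\<close> and
      \<open>j\<close>, while the coefficients are antisymmetric.\<close>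
    show "B 1 ?\<omega> = 0"
    proof -
      let ?q = "\<lambda>i j. Q Y (br (Z i) (Z j))"
      have 1: "B 1 (e i * e j) = - B (e i) (e j)" if "i \<in> {1..n}" for i j
        using B(4)[OF that, of 1 "e i * e j"] e_square[OF that]
        by (simp add: mult.assoc[symmetric] B.minus_right)
      have "B 1 ?\<omega> = - (1/4) * (\<Sum>i=1..n. \<Sum>j=1..n. ?q i j * B (e i) (e j))"
        by (simp add: ad_lift_eq[OF Y] B.scaleR_right B.sum_right 1 sum_negf)
      also have "(\<Sum>i=1..n. \<Sum>j=1..n. ?q i j * B (e i) (e j)) = 0"
      proof -
        have "(\<Sum>i=1..n. \<Sum>j=1..n. ?q i j * B (e i) (e j)) = (\<Sum>j=1..n. \<Sum>i=1..n. ?q i j * B (e i) (e j))"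
          by (rule sum.swap)
        also have "\<dots> = (\<Sum>j=1..n. \<Sum>i=1..n. - (?q j i * B (e j) (e i)))"
        proof (rule sum.cong[OF refl], rule sum.cong[OF refl])
          fix i j
          show "?q i j * B (e i) (e j) = - (?q j i * B (e j) (e i))"
            using lie_bracket_anti[of "Z i" "Z j"] B(2)[of "e i" "e j"] by (simp add: Q_simps)
        qed
        finally show ?thesis by (simp add: sum_negf)
      qed
      finally show ?thesis by simp
    qed
    fix j assume j: "j \<in> {1..n}"
    \<comment> \<open>By the covering relation the commutator of \<open>slift M (\<gamma> u)\<close>
      with \<open>e j\<close> is Clifford multiplication by
      \<open>Ad (\<gamma> u) (Z j) - Z j\<close>, times \<open>slift M (\<gamma> u)\<close>; so its
      difference quotient is controlled by that of \<open>Ad\<close>.\<close>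
    have "((\<lambda>s. Ad M (\<one> \<otimes> \<gamma> s) (Z j)) has_vector_derivative lderiv M Y (\<lambda>k. Ad M k (Z j)) \<one>) (at 0)"
      by (rule has_vector_derivative_along_curve[where \<epsilon>=\<epsilon> and \<Omega>=UNIV]) (use c lsmooth_Ad in auto)
    then have "((\<lambda>s. Ad M (\<gamma> s) (Z j)) has_vector_derivative br Y (Z j)) (at 0)"
      by (simp add: lderiv_Ad)
    then have "((\<lambda>u. (1 / u) *\<^sub>R (Ad M (\<gamma> u) (Z j) - Z j)) \<longlongrightarrow> br Y (Z j)) (at 0)"
      unfolding has_vector_derivative_at_0_iff by (simp add: c(2) Ad_one)
    from bounded_linear.tendsto[OF bounded_linear_cl this]
    have "((\<lambda>u. cl ((1 / u) *\<^sub>R (Ad M (\<gamma> u) (Z j) - Z j)) * slift M (\<gamma> u)) \<longlongrightarrow> cl (br Y (Z j)) * 1) (at 0)"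
      by (rule cm.tendsto) fact
    then have "((\<lambda>u. cl ((1 / u) *\<^sub>R (Ad M (\<gamma> u) (Z j) - Z j)) * slift M (\<gamma> u)) \<longlongrightarrow>
        ?\<omega> * e j - e j * ?\<omega>) (at 0)"
      by (simp add: ad_lift_commute[OF Y j] cl_m[OF bracket_h_m[OF Y Z_m[OF j]]])
    then show "((\<lambda>u. (1 / u) *\<^sub>R (slift M (\<gamma> u) * e j - e j * slift M (\<gamma> u))) \<longlongrightarrow>
        ?\<omega> * e j - e j * ?\<omega>) (at 0)"
    proof (rule Lim_transform_eventually, intro eventually_mono[OF ev])
      fix u assume "u \<in> {-\<epsilon><..<\<epsilon>}"
      then have u: "\<gamma> u \<in> isotropy M" by (rule c(3))
      show "cl ((1 / u) *\<^sub>R (Ad M (\<gamma> u) (Z j) - Z j)) * slift M (\<gamma> u)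
          = (1 / u) *\<^sub>R (slift M (\<gamma> u) * e j - e j * slift M (\<gamma> u))"
        using Ad_m[OF u Z_m[OF j]] Z_m[OF j]
        by (simp add: linear_scale[OF linear_cl] linear_diff[OF linear_cl] cl_m
            slift_cliff[OF u Z_m[OF j]] left_diff_distrib)
    qed
  qed
qed

section \<open>Equivariance of spinor fields\<close>

definition act :: "'c \<Rightarrow> complex^'k \<Rightarrow> complex^'k" where
  "act a v = spinrep M a *v v"

lemma act_mult: "act (a * b) v = act a (act b v)" and act_one: "act 1 v = v"
  using spin by (simp_all add: homogeneous_spin_structure_def spinor_module_def act_def
      matrix_vector_mul_assoc)

lemma bounded_bilinear_act: "bounded_bilinear act"
proof -
  have lin: "linear (spinrep M)"
    using spin by (simp add: homogeneous_spin_structure_def spinor_module_def)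
  have sc: "(r *\<^sub>R A) *v v = r *\<^sub>R (A *v v)" "A *v (r *\<^sub>R v) = r *\<^sub>R (A *v v)"
    for r and A :: "complex^'k^'k" and v
    by (simp_all add: matrix_vector_mult_def vec_eq_iff scaleR_sum_right)
  have "bilinear act"
    unfolding bilinear_def act_def
    by (auto intro!: linearI simp: linear_add[OF lin] linear_scale[OF lin] sc
        matrix_vector_mult_add_rdistrib matrix_vector_right_distrib)
  then show ?thesis using bilinear_conv_bounded_bilinear by blast
qed

sublocale act: bounded_bilinear act by (rule bounded_bilinear_act)

lemma spinor_field_lsmooth: "spinor_field M \<psi> \<Longrightarrow> lsmooth \<psi> UNIV"
  by (simp add: spinor_field_def smooth_map_iff_lsmooth)

text \<open>Along a curve in the isotropy group \<open>slift (\<gamma> s)\<close> applied to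
  \<open>\<psi> (g \<otimes> \<gamma> s)\<close> is constantly \<open>\<psi> g\<close>; the product
  rule at \<open>s = 0\<close> gives the claim.\<close>

lemma spinor_deriv_h:
  assumes \<psi>: "spinor_field M \<psi>" and Y: "Y \<in> \<hh>"
  shows "lderiv M Y \<psi> g = - act (ad_lift M Z Y) (\<psi> g)"
proof -
  note sm = spinor_field_lsmooth[OF \<psi>]
  obtain \<gamma> \<epsilon> where c: "0 < \<epsilon>" "\<gamma> 0 = \<one>" "\<And>s. s \<in> {-\<epsilon><..<\<epsilon>} \<Longrightarrow> \<gamma> s \<in> isotropy M"
    "\<And>s. s \<in> {-\<epsilon><..<\<epsilon>} \<Longrightarrow> \<gamma> s \<in> id_dom M"
    "((\<lambda>s. id_coord M (\<gamma> s)) has_vector_derivative Y) (at 0)"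
    by (rule h_curve[OF Y], rule that) simp_all
  have "((\<lambda>s. slift M (\<gamma> s)) has_vector_derivative ad_lift M Z Y) (at 0)"
    by (rule slift_derivative[OF Y c])
  moreover have "((\<lambda>s. \<psi> (g \<otimes> \<gamma> s)) has_vector_derivative lderiv M Y \<psi> g) (at 0)"
    by (rule has_vector_derivative_along_curve[where \<epsilon>=\<epsilon> and \<Omega>=UNIV]) (use sm c in auto)
  ultimately have "((\<lambda>s. act (slift M (\<gamma> s)) (\<psi> (g \<otimes> \<gamma> s))) has_vector_derivative
      act (slift M (\<gamma> 0)) (lderiv M Y \<psi> g) + act (ad_lift M Z Y) (\<psi> (g \<otimes> \<gamma> 0))) (at 0)"
    by (rule act.has_vector_derivative)
  then have "((\<lambda>s. act (slift M (\<gamma> s)) (\<psi> (g \<otimes> \<gamma> s))) has_vector_derivative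
      lderiv M Y \<psi> g + act (ad_lift M Z Y) (\<psi> g)) (at 0)"
    by (simp add: c(2) slift_one act_one)
  moreover have "((\<lambda>s. act (slift M (\<gamma> s)) (\<psi> (g \<otimes> \<gamma> s))) has_vector_derivative 0) (at 0)"
  proof (rule has_vector_derivative_transform_within_open[OF has_vector_derivative_const[of "\<psi> g"]
        open_greaterThanLessThan[of "-\<epsilon>" \<epsilon>]])
    fix s assume "s \<in> {-\<epsilon><..<\<epsilon>}"
    then have h: "\<gamma> s \<in> isotropy M" by (rule c(3))
    have "\<psi> (g \<otimes> \<gamma> s) = act (slift M (inv (\<gamma> s))) (\<psi> g)"
      using \<psi> h by (simp add: spinor_field_def act_def)
    then show "\<psi> g = act (slift M (\<gamma> s)) (\<psi> (g \<otimes> \<gamma> s))"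
      using slift_mult[OF h inv_H[OF h]] by (simp add: act_mult[symmetric] slift_one act_one)
  qed (use c(1) in simp)
  ultimately show ?thesis
    using vector_derivative_unique_at by (fastforce simp: eq_neg_iff_add_eq_0)
qed

section \<open>The zeroth order term\<close>

definition cc :: "nat \<Rightarrow> nat \<Rightarrow> nat \<Rightarrow> real" where
  "cc i j k = Q (br (Z i) (Z j)) (Z k)"

text \<open>Minus the curvature tensor of the canonical connection in the frame
  \<open>Z\<close>.\<close>

definition RR :: "nat \<Rightarrow> nat \<Rightarrow> nat \<Rightarrow> nat \<Rightarrow> real" where
  "RR i j k l = Q_h M Q (br (Z i) (Z j)) (br (Z k) (Z l))"

sublocale cubic: clifford_frame_3form "{1..n}" e cc
proof
  fix i j k
  show "cc j i k = - cc i j k"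
    using lie_bracket_anti[of "Z j" "Z i"] by (simp add: cc_def Q_simps)
  show "cc i k j = - cc i j k"
    using Q_bracket[of "Z i" "Z j" "Z k"] by (simp add: cc_def Q_sym[of "Z j"])
qed

lemma cubic_element_eq: "cubic_element M Z = cubic.H"
  unfolding cubic_element_def cubic.H_def cc_def
  by (intro arg_cong2[where f=scaleR] refl sum.cong) (simp add: Q_mpart Z_m)

lemma Q_m_eq:
  "Q_m M (br (Z i) (Z j)) (br (Z k) (Z l)) = (\<Sum>p=1..n. cc i j p * cc k l p)"
  unfolding Q_m_def metric_expand[OF mpart_in mpart_in] cc_def
  by (intro sum.cong refl) (simp add: Q_mpart Z_m Q_metric)

text \<open>The \<open>m\<close>-part completes \<open>Q_h\<close> to \<open>Q\<close>, and
  invariance then produces a double bracket. Through this form the Jacobi identity supplies the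
  Bianchi identity, which \<open>RR\<close> alone need not satisfy.\<close>

lemma RR_plus: "RR i j k l + (\<Sum>p=1..n. cc i j p * cc k l p) = Q (br (br (Z i) (Z j)) (Z k)) (Z l)"
  unfolding RR_def Q_m_eq[symmetric] Q_split[symmetric] Q_bracket_assoc ..

text \<open>The lifted Casimir element written without bases of \<open>h\<close>. It also arises
  from the \<open>h\<close>-parts of the brackets \<open>[Z i, Z j]\<close> when the Dirac operator
  is squared.\<close>

definition cas :: 'c where
  "cas = - (1/16) *\<^sub>R (\<Sum>i=1..n. \<Sum>j=1..n. \<Sum>k=1..n. \<Sum>l=1..n. RR i j k l *\<^sub>R (e i * e j * e k * e l))"

lemma cas_plus_cubic_square:
  "cas + (1/9) *\<^sub>R (cubic.H * cubic.H) = (1/8 * ((\<Sum>i=1..n. \<Sum>j=1..n. RR i j i j)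
      + 1/3 * (\<Sum>i=1..n. \<Sum>j=1..n. Q_m M (br (Z i) (Z j)) (br (Z i) (Z j))))) *\<^sub>R 1"
proof -
  have hneg: "hpart M (- A) = - hpart M A" for A by (rule linear_neg[OF linear_hpart])
  have anti: "RR j i k l = - RR i j k l" for i j k l
    using lie_bracket_anti[of "Z j" "Z i"] by (simp add: RR_def Q_h_def hneg Q_simps)
  have pair: "RR k l i j = RR i j k l" for i j k l
    by (simp add: RR_def Q_h_def Q_sym)
  have bianchi: "(RR i j k l + (\<Sum>p=1..n. cc i j p * cc k l p)) + (RR j k i l + (\<Sum>p=1..n. cc j k p * cc i l p))
      + (RR k i j l + (\<Sum>p=1..n. cc k i p * cc j l p)) = 0" for i j k l
  proof -
    have "br (br (Z i) (Z j)) (Z k) + br (br (Z j) (Z k)) (Z i) + br (br (Z k) (Z i)) (Z j) = 0"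
      using lie_bracket_jacobi[of "Z i" "Z j" "Z k"]
      unfolding lie_bracket_anti[of "br (Z i) (Z j)" "Z k"] lie_bracket_anti[of "br (Z j) (Z k)" "Z i"]
        lie_bracket_anti[of "br (Z k) (Z i)" "Z j"] minus_add_distrib[symmetric] neg_equal_0_iff_equal
      by (simp add: add_ac)
    then show ?thesis
      unfolding RR_plus Q_simps(1)[symmetric] by (simp add: Q_simps)
  qed
  show ?thesis
    unfolding cas_def Q_m_eq cubic.N_def[symmetric]
    by (rule cubic.casimir_plus_H_square[of RR, OF anti pair bianchi])
qed

lemma sum_ad_lift_brackets:
  "(\<Sum>i=1..n. \<Sum>j=1..n. e i * e j * ad_lift M Z (hpart M (br (Z i) (Z j)))) = - 4 *\<^sub>R cas"
proof -
  have "(\<Sum>i=1..n. \<Sum>j=1..n. e i * e j * ad_lift M Z (hpart M (br (Z i) (Z j))))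
      = (\<Sum>i=1..n. \<Sum>j=1..n. (1/4) *\<^sub>R (\<Sum>k=1..n. \<Sum>l=1..n. RR i j k l *\<^sub>R (e i * e j * e k * e l)))"
  proof (rule sum.cong[OF refl], rule sum.cong[OF refl])
    fix i j
    have "Q (hpart M (br (Z i) (Z j))) (br (Z k) (Z l)) = RR i j k l" for k l
      using Q_hpart[OF hpart_in, of "br (Z k) (Z l)" "br (Z i) (Z j)"]
      by (simp add: RR_def Q_h_def Q_sym)
    then show "e i * e j * ad_lift M Z (hpart M (br (Z i) (Z j)))
        = (1/4) *\<^sub>R (\<Sum>k=1..n. \<Sum>l=1..n. RR i j k l *\<^sub>R (e i * e j * e k * e l))"
      by (simp add: ad_lift_eq sum_distrib_left mult.assoc)
  qed
  then show ?thesis by (simp add: cas_def scaleR_sum_right)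
qed

lemma casimir_h_eq:
  assumes dual: "dual_bases_h M Q Xs Ys"
  shows "casimir_h M Z Xs Ys = cas"
proof -
  let ?J = "{1..dim \<hh>}"
  have Xh: "Xs a \<in> \<hh>" and Yh: "Ys a \<in> \<hh>" if "a \<in> ?J" for a
    using dual that span_base[of "Xs a" "Xs ` ?J"] span_base[of "Ys a" "Ys ` ?J"]
    unfolding dual_bases_h_def by blast+
  have exp: "A = (\<Sum>a\<in>?J. Q (Xs a) A *\<^sub>R Ys a)" if "A \<in> \<hh>" for A
  proof (rule span_eqI[symmetric])
    show "linear (\<lambda>A. \<Sum>a\<in>?J. Q (Xs a) A *\<^sub>R Ys a)"
      by (rule linearI) (simp_all add: Q_simps scaleR_add_left sum.distrib scaleR_sum_right)
    show "A \<in> span (Ys ` ?J)" using dual that by (simp add: dual_bases_h_def)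
    fix A assume "A \<in> Ys ` ?J"
    then obtain b where b: "b \<in> ?J" "A = Ys b" by blast
    have "(\<Sum>a\<in>?J. Q (Xs a) A *\<^sub>R Ys a) = (\<Sum>a\<in>?J. if b = a then Ys a else 0)"
      by (intro sum.cong refl) (use b dual in \<open>auto simp: dual_bases_h_def\<close>)
    then show "(\<Sum>a\<in>?J. Q (Xs a) A *\<^sub>R Ys a) = A" using b by simp
  qed
  \<comment> \<open>Completeness relation of dual bases; it removes every dependence on their
    choice.\<close>
  have Qh: "(\<Sum>a\<in>?J. Q (Xs a) A * Q (Ys a) B) = Q_h M Q A B" for A B
  proof -
    have "Q_h M Q A B = Q (hpart M A) B"
      using Q_hpart[OF hpart_in, of B A] by (simp add: Q_h_def Q_sym)
    also have "\<dots> = Q (\<Sum>a\<in>?J. Q (Xs a) (hpart M A) *\<^sub>R Ys a) B"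
      using exp[OF hpart_in, of A] by simp
    also have "\<dots> = (\<Sum>a\<in>?J. Q (Xs a) (hpart M A) * Q (Ys a) B)"
      by (simp add: Q_sum_left Q_simps)
    also have "\<dots> = (\<Sum>a\<in>?J. Q (Xs a) A * Q (Ys a) B)"
    proof (intro sum.cong refl)
      fix a assume "a \<in> ?J"
      then have "Q (Xs a) (hpart M A) = Q (Xs a) A"
        using Q_hpart[OF Xh, of a A] Q_sym by metis
      then show "Q (Xs a) (hpart M A) * Q (Ys a) B = Q (Xs a) A * Q (Ys a) B" by simp
    qed
    finally show ?thesis by simp
  qed
  have "(\<Sum>a\<in>?J. ad_lift M Z (Xs a) * ad_lift M Z (Ys a))
      = (\<Sum>a\<in>?J. (1/16) *\<^sub>R (\<Sum>i=1..n. \<Sum>j=1..n. \<Sum>k=1..n. \<Sum>l=1..n.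
          (Q (Xs a) (br (Z i) (Z j)) * Q (Ys a) (br (Z k) (Z l))) *\<^sub>R (e i * e j * e k * e l)))"
  proof (rule sum.cong[OF refl])
    fix a assume a: "a \<in> ?J"
    show "ad_lift M Z (Xs a) * ad_lift M Z (Ys a) = (1/16) *\<^sub>R (\<Sum>i=1..n. \<Sum>j=1..n. \<Sum>k=1..n. \<Sum>l=1..n.
          (Q (Xs a) (br (Z i) (Z j)) * Q (Ys a) (br (Z k) (Z l))) *\<^sub>R (e i * e j * e k * e l))"
      unfolding ad_lift_eq[OF Xh[OF a]] ad_lift_eq[OF Yh[OF a]] mult_scaleR_left mult_scaleR_right
        scaleR_scaleR sum_distrib_right
      unfolding sum_distrib_left
      by (simp add: mult.assoc mult.commute[where 'a=real] scaleR_sum_right)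
  qed
  also have "\<dots> = (1/16) *\<^sub>R (\<Sum>i=1..n. \<Sum>j=1..n. \<Sum>k=1..n. \<Sum>l=1..n.
      (\<Sum>a\<in>?J. Q (Xs a) (br (Z i) (Z j)) * Q (Ys a) (br (Z k) (Z l))) *\<^sub>R (e i * e j * e k * e l))"
    unfolding scaleR_sum_right[symmetric] scaleR_sum_left
    by (subst sum.swap[of _ _ "?J"], rule arg_cong[where f="scaleR _"], rule sum.cong[OF refl],
        (subst sum.swap[of _ _ "?J"], rule sum.cong[OF refl])+) (rule refl)
  finally show ?thesis
    unfolding casimir_h_def Qh cas_def RR_def by simp
qed

section \<open>The square of the Dirac operator\<close>

lemma lderiv_bracket:
  assumes \<psi>: "spinor_field M \<psi>"
  shows "lderiv M (br (Z i) (Z j)) \<psi> g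
    = (\<Sum>k=1..n. cc i j k *\<^sub>R lderiv M (Z k) \<psi> g) - act (ad_lift M Z (hpart M (br (Z i) (Z j)))) (\<psi> g)"
proof -
  note sm = spinor_field_lsmooth[OF \<psi>]
  have lin: "linear (\<lambda>X. lderiv M X \<psi> g)" by (rule lderiv_linear[OF sm UNIV_I])
  let ?b = "br (Z i) (Z j)"
  have "lderiv M ?b \<psi> g = lderiv M (hpart M ?b) \<psi> g + lderiv M (\<pi> ?b) \<psi> g"
    by (simp add: linear_add[OF lin, symmetric] hpart_plus_mpart)
  also have "lderiv M (hpart M ?b) \<psi> g = - act (ad_lift M Z (hpart M ?b)) (\<psi> g)"
    by (rule spinor_deriv_h[OF \<psi> hpart_in])
  also have "lderiv M (\<pi> ?b) \<psi> g = lderiv M (\<Sum>k=1..n. Q (\<pi> ?b) (Z k) *\<^sub>R Z k) \<psi> g"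
    using m_expand[OF mpart_in, of ?b] by simp
  also have "\<dots> = (\<Sum>k=1..n. Q (\<pi> ?b) (Z k) *\<^sub>R lderiv M (Z k) \<psi> g)"
    by (simp add: linear_sum[OF lin] linear_scale[OF lin])
  also have "\<dots> = (\<Sum>k=1..n. cc i j k *\<^sub>R lderiv M (Z k) \<psi> g)"
    by (intro sum.cong refl) (simp add: cc_def Q_mpart Q_metric Z_m)
  finally show ?thesis by simp
qed

text \<open>Antisymmetrise: the Clifford relations leave the Laplacian, the rest only sees brackets.\<close>

lemma sum_second_derivatives:
  assumes \<psi>: "spinor_field M \<psi>"
  shows "(\<Sum>i=1..n. \<Sum>j=1..n. act (e i * e j) (lderiv M (Z i) (lderiv M (Z j) \<psi>) g))
    = - (\<Sum>i=1..n. lderiv M (Z i) (lderiv M (Z i) \<psi>) g)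
      + (1/2) *\<^sub>R (\<Sum>k=1..n. act (cubic.A k) (lderiv M (Z k) \<psi> g)) + act (2 *\<^sub>R cas) (\<psi> g)"
proof -
  note sm = spinor_field_lsmooth[OF \<psi>]
  let ?L = "\<lambda>i j. lderiv M (Z i) (lderiv M (Z j) \<psi>) g"
  let ?S = "\<Sum>i=1..n. \<Sum>j=1..n. act (e i * e j) (?L i j)"
  let ?D = "\<Sum>i=1..n. ?L i i"
  have "?S = (\<Sum>i=1..n. \<Sum>j=1..n. act (e j * e i) (?L j i))" by (rule sum.swap)
  also have "\<dots> = (\<Sum>i=1..n. \<Sum>j=1..n. - act (e i * e j) (?L j i) - (if i = j then 2 *\<^sub>R ?L i i else 0))"
  proof (rule sum.cong[OF refl], rule sum.cong[OF refl])
    fix i j assume "i \<in> {1..n}" "j \<in> {1..n}"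
    then have "e j * e i = - (e i * e j) - (2 * delta j i) *\<^sub>R 1" by (intro e_swap)
    then show "act (e j * e i) (?L j i) = - act (e i * e j) (?L j i) - (if i = j then 2 *\<^sub>R ?L i i else 0)"
      by (simp add: act.diff_left act.minus_left act.scaleR_left act_one)
  qed
  also have "\<dots> = - (\<Sum>i=1..n. \<Sum>j=1..n. act (e i * e j) (?L j i)) - 2 *\<^sub>R ?D"
    by (simp add: sum_subtractf sum_negf scaleR_sum_right)
  finally have "?S + ?S = (\<Sum>i=1..n. \<Sum>j=1..n. act (e i * e j) (?L i j - ?L j i)) - 2 *\<^sub>R ?D"
    by (simp add: act.diff_right sum_subtractf)
  also have "(\<Sum>i=1..n. \<Sum>j=1..n. act (e i * e j) (?L i j - ?L j i))
      = (\<Sum>i=1..n. \<Sum>j=1..n. (\<Sum>k=1..n. cc i j k *\<^sub>R act (e i * e j) (lderiv M (Z k) \<psi> g))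
          - act (e i * e j * ad_lift M Z (hpart M (br (Z i) (Z j)))) (\<psi> g))"
    by (simp add: lderiv_commutator[OF sm UNIV_I] lderiv_bracket[OF \<psi>] act.diff_right act.sum_right
        act.scaleR_right act_mult)
  also have "\<dots> = (\<Sum>i=1..n. \<Sum>j=1..n. \<Sum>k=1..n. cc i j k *\<^sub>R act (e i * e j) (lderiv M (Z k) \<psi> g))
      - act (\<Sum>i=1..n. \<Sum>j=1..n. e i * e j * ad_lift M Z (hpart M (br (Z i) (Z j)))) (\<psi> g)"
    by (simp only: sum_subtractf act.sum_left)
  also have "(\<Sum>i=1..n. \<Sum>j=1..n. \<Sum>k=1..n. cc i j k *\<^sub>R act (e i * e j) (lderiv M (Z k) \<psi> g))
      = (\<Sum>k=1..n. \<Sum>i=1..n. \<Sum>j=1..n. cc i j k *\<^sub>R act (e i * e j) (lderiv M (Z k) \<psi> g))"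
    by (rule sum3_rot)
  also have "\<dots> = (\<Sum>k=1..n. act (cubic.A k) (lderiv M (Z k) \<psi> g))"
    unfolding cubic.A_def by (simp only: act.sum_left act.scaleR_left)
  finally have "?S + ?S = (\<Sum>k=1..n. act (cubic.A k) (lderiv M (Z k) \<psi> g)) + act (4 *\<^sub>R cas) (\<psi> g) - 2 *\<^sub>R ?D"
    unfolding sum_ad_lift_brackets by (simp add: act.minus_left act.scaleR_left)
  then have "(1/2) *\<^sub>R (2 *\<^sub>R ?S) = (1/2) *\<^sub>R ((\<Sum>k=1..n. act (cubic.A k) (lderiv M (Z k) \<psi> g))
      + act (4 *\<^sub>R cas) (\<psi> g) - 2 *\<^sub>R ?D)"
    by (simp only: scaleR_2)
  then show ?thesis
    by (simp add: scaleR_add_right scaleR_right_diff_distrib act.scaleR_left)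
qed

lemma dirac_square:
  assumes \<psi>: "spinor_field M \<psi>"
  shows "dirac M Z (1/3) (dirac M Z (1/3) \<psi>) g
    = - (\<Sum>i=1..n. lderiv M (Z i) (lderiv M (Z i) \<psi>) g)
      + act (2 *\<^sub>R cas + (1/9) *\<^sub>R (cubic.H * cubic.H)) (\<psi> g)"
proof -
  note sm = spinor_field_lsmooth[OF \<psi>]
  note smL = lsmooth_lderiv[OF sm]
  let ?H = "cubic.H"
  have bl: "bounded_linear (act a)" for a by (rule act.bounded_linear_right)
  have dirac_eq: "dirac M Z (1/3) \<phi> k = (\<Sum>i=1..n. act (e i) (lderiv M (Z i) \<phi> k)) + act ((1/3) *\<^sub>R ?H) (\<phi> k)" for \<phi> k
    by (simp add: dirac_def cubic_element_eq act_def[symmetric] act.scaleR_left)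
  have deriv: "lderiv M X (dirac M Z (1/3) \<psi>) g = (\<Sum>j=1..n. act (e j) (lderiv M X (lderiv M (Z j) \<psi>) g))
      + act ((1/3) *\<^sub>R ?H) (lderiv M X \<psi> g)" for X
  proof -
    have t: "lsmooth (\<lambda>k. act (e j) (lderiv M (Z j) \<psi> k)) UNIV" for j
      by (rule lsmooth_bounded_linear[OF bl smL])
    have "lderiv M X (dirac M Z (1/3) \<psi>) g
        = lderiv M X (\<lambda>k. (\<Sum>j=1..n. act (e j) (lderiv M (Z j) \<psi> k)) + act ((1/3) *\<^sub>R ?H) (\<psi> k)) g"
      by (simp only: dirac_eq[of \<psi>, abs_def])
    also have "\<dots> = lderiv M X (\<lambda>k. \<Sum>j=1..n. act (e j) (lderiv M (Z j) \<psi> k)) g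
        + lderiv M X (\<lambda>k. act ((1/3) *\<^sub>R ?H) (\<psi> k)) g"
      by (rule lderiv_add[OF lsmooth_sum[OF _ open_UNIV t] lsmooth_bounded_linear[OF bl sm]]) auto
    finally show ?thesis
      by (simp only: lderiv_sum[OF t UNIV_I] lderiv_bounded_linear[OF bl smL UNIV_I]
          lderiv_bounded_linear[OF bl sm UNIV_I])
  qed
  have "dirac M Z (1/3) (dirac M Z (1/3) \<psi>) g
      = (\<Sum>i=1..n. \<Sum>j=1..n. act (e i * e j) (lderiv M (Z i) (lderiv M (Z j) \<psi>) g))
        + (\<Sum>i=1..n. act ((1/3) *\<^sub>R (e i * ?H + ?H * e i)) (lderiv M (Z i) \<psi> g))
        + act ((1/9) *\<^sub>R (?H * ?H)) (\<psi> g)"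
    unfolding dirac_eq[of "dirac M Z (1/3) \<psi>"] deriv unfolding dirac_eq
    by (simp add: act.add_right act.add_left act.sum_right act_mult act.scaleR_left act.scaleR_right
        sum.distrib scaleR_add_right scaleR_sum_right)
  \<comment> \<open>The cross terms carry 1/3 times -3/2, that is -1/2, against the 1/2 left over
    from the second derivatives.\<close>
  also have "(\<Sum>i=1..n. act ((1/3) *\<^sub>R (e i * ?H + ?H * e i)) (lderiv M (Z i) \<psi> g))
      = - ((1/2) *\<^sub>R (\<Sum>i=1..n. act (cubic.A i) (lderiv M (Z i) \<psi> g)))"
    unfolding scaleR_sum_right sum_negf[symmetric]
  proof (intro sum.cong refl)
    fix i assume "i \<in> {1..n}"
    then have "(1/3) *\<^sub>R (e i * ?H + ?H * e i) = - (1/2) *\<^sub>R cubic.A i"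
      by (simp only: cubic.H_anticommute) simp
    then show "act ((1/3) *\<^sub>R (e i * ?H + ?H * e i)) (lderiv M (Z i) \<psi> g)
        = - ((1/2) *\<^sub>R act (cubic.A i) (lderiv M (Z i) \<psi> g))"
      by (simp only: act.scaleR_left scaleR_minus_left act.minus_left)
  qed
  finally show ?thesis
    unfolding sum_second_derivatives[OF \<psi>] by (simp add: act.add_left)
qed

lemma kostant_parthasarathy:
  assumes \<psi>: "spinor_field M \<psi>" and dual: "dual_bases_h M Q Xs Ys"
  shows "dirac M Z (1/3) (dirac M Z (1/3) \<psi>) g = Omega_g M Z Xs Ys \<psi> g +
      (1/8 * ((\<Sum>i=1..n. \<Sum>j=1..n. Q_h M Q (br (Z i) (Z j)) (br (Z i) (Z j)))
        + 1/3 * (\<Sum>i=1..n. \<Sum>j=1..n. Q_m M (br (Z i) (Z j)) (br (Z i) (Z j))))) *\<^sub>R \<psi> g"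
    (is "_ = _ + ?s *\<^sub>R _")
proof -
  \<comment> \<open>Of the two Casimir elements one belongs to \<open>Omega_g\<close>, the other
    joins the square of the cubic element to form the scalar.\<close>
  have "act (2 *\<^sub>R cas + (1/9) *\<^sub>R (cubic.H * cubic.H)) (\<psi> g)
      = act cas (\<psi> g) + act (cas + (1/9) *\<^sub>R (cubic.H * cubic.H)) (\<psi> g)"
    by (simp add: act.add_left scaleR_2)
  also have "\<dots> = act cas (\<psi> g) + ?s *\<^sub>R \<psi> g"
    unfolding cas_plus_cubic_square RR_def by (simp only: act.scaleR_left act_one)
  finally show ?thesis
    unfolding dirac_square[OF \<psi>] Omega_g_def casimir_h_eq[OF dual]
    by (simp add: act_def add.assoc)
qed

end



theorem theorem3p3:
  fixes M :: "('g::{t2_space,second_countable_topology}, 'e::euclidean_space,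
      'c::{euclidean_space,real_algebra_1}, 'k::finite, 'z) spin_space_scheme"
    and Q :: "'e \<Rightarrow> 'e \<Rightarrow> real"
    and Z Xs Ys :: "nat \<Rightarrow> 'e"
    and n :: nat
    and \<psi> :: "'g \<Rightarrow> complex^'k"
    and g :: 'g
  assumes "naturally_reductive M"
    and "homogeneous_spin_structure M"
    and "invariant_form M Q"
    and "n = dim (mspace M)"
    and "n = 3 \<or> n \<ge> 5"
    and "orthonormal_basis_m M Z"
    and "dual_bases_h M Q Xs Ys"
    and "spinor_field M \<psi>"
  shows "dirac M Z (1/3) (dirac M Z (1/3) \<psi>) g =
      Omega_g M Z Xs Ys \<psi> g +
      (1/8 * ((\<Sum>i=1..n. \<Sum>j=1..n. Q_h M Q (lie_bracket M (Z i) (Z j)) (lie_bracket M (Z i) (Z j)))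
        + 1/3 * (\<Sum>i=1..n. \<Sum>j=1..n. Q_m M (lie_bracket M (Z i) (Z j)) (lie_bracket M (Z i) (Z j)))))
        *\<^sub>R \<psi> g
    \<and> dirac M Z (1/3) (dirac M Z (1/3) \<psi>) g =
      Omega_g M Z Xs Ys \<psi> g +
      (1/8 * (scal M Z (1/3) g
        + 1/9 * (\<Sum>i=1..n. \<Sum>j=1..n. Q_m M (lie_bracket M (Z i) (Z j)) (lie_bracket M (Z i) (Z j)))))
        *\<^sub>R \<psi> g"
proof -
  interpret spin_homogeneous M Q Z
    using assms by unfold_locales
  \<comment> \<open>At \<open>t = 1/3\<close> the weight \<open>t - t * t\<close> is 2/9, so adding
    1/9 yields the 1/3 of the other form.\<close>
  have scal: "scal M Z (1/3) g = (\<Sum>i=1..n. \<Sum>j=1..n. Q_h M Q (lie_bracket M (Z i) (Z j)) (lie_bracket M (Z i) (Z j)))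
      + (1/3 - 1/3 * (1/3)) * (\<Sum>i=1..n. \<Sum>j=1..n. Q_m M (lie_bracket M (Z i) (Z j)) (lie_bracket M (Z i) (Z j)))"
    unfolding assms(4) by (rule scal_eq[OF Z_m])
  have "1/8 * (scal M Z (1/3) g
        + 1/9 * (\<Sum>i=1..n. \<Sum>j=1..n. Q_m M (lie_bracket M (Z i) (Z j)) (lie_bracket M (Z i) (Z j))))
    = 1/8 * ((\<Sum>i=1..n. \<Sum>j=1..n. Q_h M Q (lie_bracket M (Z i) (Z j)) (lie_bracket M (Z i) (Z j)))
        + 1/3 * (\<Sum>i=1..n. \<Sum>j=1..n. Q_m M (lie_bracket M (Z i) (Z j)) (lie_bracket M (Z i) (Z j))))"
    unfolding scal by (simp add: field_simps)
  then show ?thesis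
    using kostant_parthasarathy[OF assms(8,7), of g] unfolding assms(4) by simp
qed

end
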